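(* Let $K\subset\mathbb{R}^2$ be a compact convex set of constant width, with boundary of class $C^2$ and support function of class $C^2$, let $F$ be the area of $K$ and $L$ the length of $\partial K$, and let $\omega=\omega(P)$ be the visual angle of $K$ from the point $P$. Let $m\ge1$ be an integer and let $$M_m=\int_0^\pi\frac{(\omega^m-\sin^m\omega)'}{1-\cos\omega}\,d\omega .$$ Then $$\int_{P\notin K}(\omega^m-\sin^m\omega)\,dP\ \ge\ -\pi^mF+M_m\frac{L^2}{2\pi}-\frac{\pi^{m-1}}{4}\left(1-\left(\frac34\right)^m\right)\Delta\ \ge\ 0,$$ where $\Delta=L^2-4\pi F$ is the isoperimetric deficit. The first inequality becomes an equality only when $\partial K$ is a circle.
   Context: The support function of a compact convex set $K$ is the $2\pi$-periodic function $p(\varphi)=\sup\{x\cos\varphi+y\sin\varphi : (x,y)\in K\}$. $K$ has constant width $w$ if its orthogonal projection on every direction has the same length $w$, i.e. $p(\varphi)+p(\varphi+\pi)=w$ for all $\varphi$. For $P\notin K$, the visual angle $\omega(P)\in(0,\pi)$ is the angle between the two tangent lines from $P$ to $\partial K$ (the angle at $P$ under which $K$ is seen). $dP$ denotes Lebesgue (area) measure on $\mathbb{R}^2$, and $\int_{P\notin K}$ is integration over $\mathbb{R}^2\setminus K$. The prime in $M_m$ denotes the derivative with respect to $\omega$. *)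

theory Defs
  imports "HOL-Analysis.Analysis"
begin

definition C2_fun :: "(real \<Rightarrow> 'a::real_normed_vector) \<Rightarrow> bool" where
  "C2_fun f \<longleftrightarrow> (\<exists>f' f''.
     (\<forall>t. (f has_vector_derivative f' t) (at t)) \<and>
     (\<forall>t. (f' has_vector_derivative f'' t) (at t)) \<and>
     continuous_on UNIV f'')"

definition support_fun :: "(real^2) set \<Rightarrow> real \<Rightarrow> real" where
  "support_fun K \<phi> = (SUP X\<in>K. X$1 * cos \<phi> + X$2 * sin \<phi>)"

definition constant_width :: "(real^2) set \<Rightarrow> bool" where
  "constant_width K \<longleftrightarrow> (\<exists>w. \<forall>\<phi>. support_fun K \<phi> + support_fun K (\<phi> + pi) = w)"

text \<open>The boundary of \<open>K\<close> is of class \<open>C\<^sup>2\<close> if it has a regular, simple, closed \<open>C\<^sup>2\<close>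
  parametrization. Taking the parametrization \<open>1\<close>-periodic on the whole real line includes
  the \<open>C\<^sup>2\<close> condition at the point where the curve closes up.\<close>

definition C2_boundary_param :: "(real^2) set \<Rightarrow> (real \<Rightarrow> real^2) \<Rightarrow> bool" where
  "C2_boundary_param K \<gamma> \<longleftrightarrow>
     C2_fun \<gamma> \<and> (\<forall>t. \<gamma> (t + 1) = \<gamma> t) \<and> inj_on \<gamma> {0..<1} \<and>
     (\<forall>t. vector_derivative \<gamma> (at t) \<noteq> 0) \<and> range \<gamma> = frontier K"

text \<open>The length of one period of a \<open>1\<close>-periodic curve.\<close>

definition closed_curve_length :: "(real \<Rightarrow> real^2) \<Rightarrow> real" where
  "closed_curve_length \<gamma> = integral {0..1} (\<lambda>t. norm (vector_derivative \<gamma> (at t)))"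

text \<open>The unit vector \<open>u\<close> points from \<open>P\<close> to a point of \<open>K\<close> on a tangent line of \<open>K\<close> through
  \<open>P\<close>, i.e. a line which meets \<open>K\<close> and has \<open>K\<close> on one side.\<close>

definition tangent_direction :: "(real^2) set \<Rightarrow> real^2 \<Rightarrow> real^2 \<Rightarrow> bool" where
  "tangent_direction K P u \<longleftrightarrow>
     norm u = 1 \<and> (\<exists>s>0. P + s *\<^sub>R u \<in> K) \<and>
     (\<exists>n. n \<noteq> 0 \<and> n \<bullet> u = 0 \<and> (\<forall>X\<in>K. n \<bullet> (X - P) \<le> 0))"

text \<open>From a point outside a compact convex set with interior points there are exactly two
  tangent directions. Orienting them towards the points of contact selects, among the
  supplementary angles formed by the two tangent lines, the one of the sector containing \<open>K\<close>.
  For \<open>P \<in> K\<close> the value is unspecified.\<close>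

definition visual_angle :: "(real^2) set \<Rightarrow> real^2 \<Rightarrow> real" where
  "visual_angle K P = (THE \<omega>. \<exists>u v. tangent_direction K P u \<and> tangent_direction K P v \<and>
     u \<noteq> v \<and> \<omega> = arccos (u \<bullet> v))"

text \<open>At \<open>\<omega> = 0\<close> the integrand is \<open>0\<close> because of division by zero; this does not affect
  the integral.\<close>

definition M_coeff :: "nat \<Rightarrow> real" where
  "M_coeff m = integral {0..pi} (\<lambda>\<omega>. deriv (\<lambda>t. t ^ m - sin t ^ m) \<omega> / (1 - cos \<omega>))"

end

theory Submission
  imports Defs
begin

text \<open>Let \<open>p\<close> be the support function, \<open>w\<close> the width and \<open>u = p - w/2\<close>, so that \<open>u (x + \<pi>) = - u x\<close>.
  A point outside \<open>K\<close> is uniquely \<open>X x + t N' x\<close> with \<open>t > 0\<close>, where \<open>X x\<close> is the contact point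
  of the support line with normal \<open>N x\<close>; the Jacobian is \<open>t\<close>, and the visual angle exceeds \<open>s\<close> iff
  \<open>t < T x s\<close> for an explicit \<open>T\<close>. Hence the integral is
  \<open>\<integral> f'(s) \<integral> T\<^sup>2/2 dx ds\<close>. Here \<open>T = w/2 cot (s/2) + \<tau>\<close> with \<open>\<tau>\<close> linear in \<open>u\<close> and of
  mean \<open>0\<close>, and with \<open>E = \<integral> f' \<integral> \<tau>\<^sup>2\<close> and \<open>D = \<integral> (u'\<^sup>2 - u\<^sup>2) = \<Delta> / (2\<pi>)\<close> the claim becomes
  \<open>E \<ge> (3\<pi>/4)^m D\<close>. On the Fourier mode \<open>k = 2n + 1\<close> the form \<open>\<integral> \<tau>\<^sup>2\<close> has multiplier
  \<open>16 \<Sum>j\<le>n. j sin\<^sup>2 (j s)\<close>, while \<open>D\<close> has multiplier \<open>k\<^sup>2 - 1 = 8 \<Sum>j\<le>n. j\<close>, and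
  \<open>\<integral> f'(s) sin\<^sup>2 (j s) ds \<ge> (\<pi> - 1/2)^m / 2\<close> for all \<open>j \<ge> 1\<close>. As \<open>\<pi> - 1/2 > 3\<pi>/4\<close>, equality
  forces \<open>D = E = 0\<close>, hence \<open>\<tau> = 0\<close>, which makes \<open>K\<close> a disc.\<close>

section \<open>Periodic functions\<close>

text \<open>Constant width acts through the antiperiodicity of \<open>u\<close>, in three ways. Only
  odd Fourier modes survive, and for these both forms are nonnegative combinations of the same terms
  in j; the modes 1 and -1, which belong to translations of \<open>K\<close>, contribute nothing to
  either. The cross term in \<open>T^2\<close> integrates to 0. Finally the numerator of
  \<open>\<tau>\<close> vanishes at s = pi as well as at s = 0, so |\<open>\<tau>\<close>| is at
  most 7 times the sup norm of \<open>u'\<close>, uniformly in s. By this bound, uniform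
  approximation of \<open>u'\<close> by odd trigonometric polynomials carries the spectral
  inequality over to \<open>u\<close>.

  The coefficient of \<open>\<Delta>\<close> comes out as follows. With a = w/2 one has L = 2 pi a
  and F = pi a^2 - D/2. The disc value pi a^2 (2 M_m - pi^m) stands on both sides of the claim, the
  area contributes pi^m D/2 to the right side, and the deficit term reduces this to (3 pi/4)^m D/2.

  The visual angle is a definite description and the length that of an arbitrary parametrization, so
  neither is given by \<open>p\<close> directly: the angle is reached through its level sets on
  tangent rays, the length through projections.\<close>

lemma periodic_add_int:
  fixes g :: "real \<Rightarrow> 'a"
  assumes per: "\<And>x. g (x + p) = g x"
  shows "g (x + of_int n * p) = g x"
proof -
  have nat: "g (x + real n * p) = g x" for n x
  proof (induction n)
    case (Suc n)
    show ?case using per[of "x + real n * p"] Suc by (simp add: algebra_simps)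
  qed simp
  show ?thesis
  proof (cases "n \<ge> 0")
    case True then show ?thesis using nat[of x "nat n"] by simp
  next
    case False then show ?thesis using nat[of "x + of_int n * p" "nat (-n)"] by simp
  qed
qed

lemma periodic_reduce:
  fixes g :: "real \<Rightarrow> 'a"
  assumes per: "\<And>x. g (x + p) = g x" and "p > 0"
  obtains y where "0 \<le> y" "y < p" "g x = g y"
proof (rule that)
  let ?y = "x + of_int (- \<lfloor>x / p\<rfloor>) * p"
  have "of_int \<lfloor>x / p\<rfloor> \<le> x / p" "x / p < of_int \<lfloor>x / p\<rfloor> + 1" by linarith+
  then have "of_int \<lfloor>x / p\<rfloor> * p \<le> x" "x < (of_int \<lfloor>x / p\<rfloor> + 1) * p"
    using \<open>p > 0\<close> by (simp_all only: pos_le_divide_eq pos_divide_less_eq)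
  then show "0 \<le> ?y" "?y < p" by (auto simp: algebra_simps)
  show "g x = g ?y" by (rule periodic_add_int[of g p, OF per, symmetric])
qed

lemma integral_period_shift:
  fixes f :: "real \<Rightarrow> 'a::euclidean_space"
  assumes cont: "continuous_on UNIV f" and per: "\<And>x. f (x + p) = f x" and "p > 0"
  shows "integral {0..p} (\<lambda>x. f (x + a)) = integral {0..p} f"
proof -
  have int: "f integrable_on {a..b}" for a b
    using cont by (meson continuous_on_subset integrable_continuous_real subset_UNIV)
  have *: "integral {0..p} (\<lambda>x. f (x + b)) = integral {0..p} f" if b: "0 \<le> b" "b < p" for b
  proof -
    have "integral {0..p} (\<lambda>x. f (x + b)) = integral {b..p + b} f"
      using integral_shift_Icc_real[of 0 p f b] by (simp add: o_def add.commute)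
    also have "\<dots> = integral {b..p} f + integral {p..p + b} f"
      by (rule Henstock_Kurzweil_Integration.integral_combine[symmetric]) (use b int in auto)
    also have "integral {p..p + b} f = integral {0..b} (\<lambda>x. f (x + p))"
      using integral_shift_Icc_real[of 0 b f p] by (simp add: o_def add.commute)
    also have "integral {b..p} f + \<dots> = integral {0..p} f"
      unfolding per using Henstock_Kurzweil_Integration.integral_combine[of 0 b p f] b int
      by (simp add: add.commute)
    finally show ?thesis .
  qed
  \<comment> \<open>The map sending \<open>a\<close> to the translate of \<open>f\<close> by
    \<open>a\<close> is itself periodic, so an arbitrary shift reduces to one in [0, p).\<close>
  have "(\<lambda>x. f (x + (a + p))) = (\<lambda>x. f (x + a))" for a
    using per[of "x + a" for x] by (simp add: add.assoc)
  from periodic_reduce[of "\<lambda>a x. f (x + a)", OF this \<open>p > 0\<close>, of a]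
  obtain b where "0 \<le> b" "b < p" "(\<lambda>x. f (x + a)) = (\<lambda>x. f (x + b))" by metis
  with * show ?thesis by simp
qed

lemma has_integral_antiperiodic:
  fixes f :: "real \<Rightarrow> 'a::euclidean_space"
  assumes cont: "continuous_on UNIV f" and anti: "\<And>x. f (x + p) = - f x" and "p > 0"
  shows "(f has_integral 0) {0..2 * p}"
proof -
  have int: "f integrable_on {a..b}" for a b
    using cont by (meson continuous_on_subset integrable_continuous_real subset_UNIV)
  have "integral {0..2 * p} f = integral {0..p} f + integral {p..2 * p} f"
    by (rule Henstock_Kurzweil_Integration.integral_combine[symmetric]) (use \<open>p > 0\<close> int in auto)
  also have "integral {p..2 * p} f = integral {0..p} (\<lambda>x. f (x + p))"
    using integral_shift_Icc_real[of 0 p f p] by (simp add: o_def add.commute)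
  also have "integral {0..p} f + \<dots> = 0"
    unfolding anti by simp
  finally show ?thesis using int has_integral_integral by metis
qed

section \<open>Trigonometric polynomials\<close>

text \<open>The frequencies form an arbitrary set instead of a range up to a degree, so that the odd
  part is obtained by filtering the set.\<close>

definition trig_poly :: "int set \<Rightarrow> (int \<Rightarrow> complex) \<Rightarrow> real \<Rightarrow> complex" where
  "trig_poly A c x = (\<Sum>k\<in>A. c k * cis (of_int k * x))"

text \<open>The frequencies \<open>n i\<close> may repeat, as they do in sums and products;
  coefficients over each fibre of \<open>n\<close> are collected.\<close>

lemma trig_polyI:
  assumes "finite I"
  shows "\<exists>A c. finite A \<and> (\<forall>x. (\<Sum>i\<in>I. d i * cis (of_int (n i) * x)) = trig_poly A c x)"
proof (intro exI conjI allI)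
  show "finite (n ` I)" using assms by simp
  fix x
  have "(\<Sum>i\<in>I. d i * cis (of_int (n i) * x))
      = (\<Sum>k\<in>n ` I. \<Sum>i | i \<in> I \<and> n i = k. d i * cis (of_int (n i) * x))"
    by (rule sum.image_gen[OF assms])
  also have "\<dots> = trig_poly (n ` I) (\<lambda>k. \<Sum>i | i \<in> I \<and> n i = k. d i) x"
    unfolding trig_poly_def sum_distrib_right by (intro sum.cong refl) auto
  finally show "(\<Sum>i\<in>I. d i * cis (of_int (n i) * x))
      = trig_poly (n ` I) (\<lambda>k. \<Sum>i | i \<in> I \<and> n i = k. d i) x" .
qed

lemma trig_poly_add:
  assumes "finite A" "finite B"
  shows "\<exists>C c. finite C \<and> (\<forall>x. trig_poly A a x + trig_poly B b x = trig_poly C c x)"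
proof -
  have "trig_poly A a x + trig_poly B b x = (\<Sum>i\<in>A <+> B.
      (case i of Inl k \<Rightarrow> a k | Inr k \<Rightarrow> b k) * cis (of_int (case i of Inl k \<Rightarrow> k | Inr k \<Rightarrow> k) * x))" for x
    using assms by (simp add: trig_poly_def sum.Plus)
  then show ?thesis
    using trig_polyI[of "A <+> B" "case_sum a b" "case_sum (\<lambda>k. k) (\<lambda>k. k)"] assms
    by auto
qed

lemma trig_poly_mult:
  assumes "finite A" "finite B"
  shows "\<exists>C c. finite C \<and> (\<forall>x. trig_poly A a x * trig_poly B b x = trig_poly C c x)"
proof -
  have "trig_poly A a x * trig_poly B b x = (\<Sum>i\<in>A \<times> B.
      (a (fst i) * b (snd i)) * cis (of_int (fst i + snd i) * x))" for x
    unfolding trig_poly_def sum_product sum.cartesian_product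
    by (intro sum.cong refl) (auto simp: distrib_left distrib_right cis_mult mult_ac)
  then show ?thesis
    using trig_polyI[of "A \<times> B" "\<lambda>i. a (fst i) * b (snd i)" "\<lambda>i. fst i + snd i"] assms by simp
qed

text \<open>\<open>Arg\<close> jumps on the negative real axis and \<open>Arg2pi\<close> on the
  positive one. Their values differ by 0 or 2 pi, which \<open>g\<close> does not see, so at each
  point of the circle a continuous branch can be used.\<close>

lemma continuous_on_sphere_of_periodic:
  fixes g :: "real \<Rightarrow> real"
  assumes g: "continuous_on UNIV g" and per: "\<And>x. g (x + 2 * pi) = g x"
  shows "continuous_on (sphere 0 1) (\<lambda>z. g (Arg z))"
proof -
  have iso: "isCont g x" for x
    using g by (simp add: continuous_on_eq_continuous_at)
  have A2: "g (Arg z) = g (Arg2pi z)" if "z \<noteq> 0" for z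
  proof (cases "Arg z \<ge> 0")
    case True
    then have "Arg2pi z = Arg z"
      using Arg_eq[OF that] Arg_le_pi[of z] that pi_gt_zero
      by (intro Arg2pi_unique[where r="cmod z"]) (auto intro: le_less_trans)
    then show ?thesis by simp
  next
    case False
    have e: "exp (\<i> * (2 * complex_of_real pi)) = 1"
      using exp_two_pi_i by (simp add: mult_ac)
    have "Arg2pi z = Arg z + 2 * pi"
      using e Arg_eq[OF that] mpi_less_Arg[of z] that False
      by (intro Arg2pi_unique[where r="cmod z"]) (auto simp: exp_add ring_distribs)
    then show ?thesis using per by simp
  qed
  have "continuous (at z within sphere 0 1) (\<lambda>z. g (Arg z))" if z: "z \<in> sphere 0 1" for z :: complex
  proof (cases "z \<in> \<real>\<^sub>\<le>\<^sub>0")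
    case False
    then have "isCont Arg z" by (rule continuous_at_Arg)
    then have "isCont (\<lambda>z. g (Arg z)) z"
      using iso by (rule isCont_o2)
    then show ?thesis by (rule continuous_at_imp_continuous_at_within)
  next
    case True
    have "z \<noteq> 0" using z by auto
    with True have "z \<notin> \<real>\<^sub>\<ge>\<^sub>0"
      by (auto simp: complex_nonpos_Reals_iff complex_nonneg_Reals_iff complex_eq_iff)
    then have "isCont Arg2pi z" by (rule continuous_at_Arg2pi)
    then have "isCont (\<lambda>z. g (Arg2pi z)) z"
      using iso by (rule isCont_o2)
    then have "continuous (at z within sphere 0 1) (\<lambda>z. g (Arg2pi z))"
      by (rule continuous_at_imp_continuous_at_within)
    then show ?thesis
    proof (rule continuous_transform_within[where \<delta>=1])
      fix x' :: complex assume "x' \<in> sphere 0 1"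
      then show "g (Arg2pi x') = g (Arg x')" using A2[of x'] by (cases "x' = 0") auto
    qed (use z in auto)
  qed
  then show ?thesis by (simp add: continuous_on_eq_continuous_within)
qed

text \<open>Stone-Weierstrass on the unit circle. The algebra \<open>P\<close> consists of
  continuous functions on the plane that become trigonometric polynomials along \<open>cis\<close>;
  \<open>Re\<close> and \<open>Im\<close> belong to it and separate points.\<close>

lemma trig_poly_dense:
  fixes g :: "real \<Rightarrow> real"
  assumes g: "continuous_on UNIV g" and per: "\<And>x. g (x + 2 * pi) = g x" and "e > 0"
  obtains A c where "finite A" "\<And>x. norm (complex_of_real (g x) - trig_poly A c x) < e"
proof -
  define P :: "(complex \<Rightarrow> real) \<Rightarrow> bool" where
    "P h \<longleftrightarrow> continuous_on UNIV h \<and> (\<exists>A c. finite A \<and> (\<forall>x. complex_of_real (h (cis x)) = trig_poly A c x))" for h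
  have const: "P (\<lambda>x. c)" for c
  proof -
    have "trig_poly {0} (\<lambda>_. complex_of_real c) x = complex_of_real c" for x by (simp add: trig_poly_def)
    then show ?thesis unfolding P_def
      by (auto intro!: exI[of _ "{0}"] exI[of _ "\<lambda>_. complex_of_real c"])
  qed
  have R: "P Re"
  proof -
    have "trig_poly {1,-1} (\<lambda>_. 1/2) x = complex_of_real (Re (cis x))" for x
      by (simp add: trig_poly_def complex_eq_iff)
    then show ?thesis unfolding P_def
      by (auto intro!: continuous_intros exI[of _ "{1,-1}"] exI[of _ "\<lambda>_. 1/2"] simp del: cis.simps)
  qed
  have I: "P Im"
  proof -
    have "trig_poly {1,-1} (\<lambda>k. - of_int k * \<i> / 2) x = complex_of_real (Im (cis x))" for x
      by (simp add: trig_poly_def complex_eq_iff)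
    then show ?thesis unfolding P_def
      by (auto intro!: continuous_intros exI[of _ "{1,-1}"] exI[of _ "\<lambda>k. - of_int k * \<i> / 2"] simp del: cis.simps)
  qed
  have "\<exists>h. P h \<and> (\<forall>z\<in>sphere 0 1. \<bar>g (Arg z) - h z\<bar> < e)"
  proof (rule Stone_Weierstrass_HOL)
    show "continuous_on (sphere 0 1) (\<lambda>z. g (Arg z))"
      by (rule continuous_on_sphere_of_periodic[OF g per])
    show "P (\<lambda>x. h x + k x)" if "P h \<and> P k" for h k
      using that trig_poly_add unfolding P_def by (simp add: continuous_on_add) metis
    show "P (\<lambda>x. h x * k x)" if "P h \<and> P k" for h k
      using that trig_poly_mult unfolding P_def by (simp add: continuous_on_mult) metis
    show "\<exists>f. P f \<and> f x \<noteq> f y" if "x \<in> sphere 0 1 \<and> y \<in> sphere 0 1 \<and> x \<noteq> y" for x y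
      using that R I complex_eq_iff[of x y] by blast
    show "continuous_on (sphere 0 1) h" if "P h" for h
      using that unfolding P_def using continuous_on_subset by blast
  qed (use const \<open>e > 0\<close> in auto)
  then obtain h A c where h: "\<And>z. z \<in> sphere 0 1 \<Longrightarrow> \<bar>g (Arg z) - h z\<bar> < e"
    and A: "finite A" "\<And>x. complex_of_real (h (cis x)) = trig_poly A c x"
    unfolding P_def by blast
  have gA: "g (Arg (cis x)) = g x" for x
  proof -
    obtain n where "x = Arg (cis x) + 2 * pi * of_int n"
    proof -
      have "cis (Arg (cis x)) = cis x" by (simp add: cis_Arg)
      then have "sin (Arg (cis x)) = sin x \<and> cos (Arg (cis x)) = cos x"
        by (metis cis.simps)
      then obtain n where "x = Arg (cis x) + 2 * pi * of_int n" using sin_cos_eq_iff[of x "Arg (cis x)"]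
        by auto
      then show ?thesis using that by blast
    qed
    then show ?thesis using periodic_add_int[of g, OF per, of "Arg (cis x)" n] by (simp add: mult.commute)
  qed
  show ?thesis
  proof (rule that[OF A(1)])
    fix x
    have "norm (complex_of_real (g x) - trig_poly A c x) = \<bar>g (Arg (cis x)) - h (cis x)\<bar>"
      by (simp add: gA A(2)[symmetric] flip: of_real_diff)
    also have "\<dots> < e" by (rule h) simp
    finally show "norm (complex_of_real (g x) - trig_poly A c x) < e" .
  qed
qed

text \<open>For a body of constant width \<open>w\<close> and \<open>u = p - w/2\<close> this is the amount by which the tangent
  segment at \<open>x\<close> from a point of visual angle \<open>s\<close> is longer than for a disc of radius \<open>w/2\<close>.\<close>

definition tangent_defect :: "(real \<Rightarrow> 'a::real_normed_vector) \<Rightarrow> (real \<Rightarrow> 'a) \<Rightarrow> real \<Rightarrow> real \<Rightarrow> 'a" where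
  "tangent_defect u u' s x = (cos s *\<^sub>R u x - u (x - s)) /\<^sub>R sin s - u' x"

text \<open>The eigenvalue of the translation-invariant map taking \<open>u\<close> to
  \<open>tangent_defect u u' s\<close>, on the mode \<open>cis (k * x)\<close>.\<close>

definition defect_multiplier :: "int \<Rightarrow> real \<Rightarrow> complex" where
  "defect_multiplier k s =
     (complex_of_real (cos s) - cis (- of_int k * s)) / complex_of_real (sin s) - \<i> * of_int k"

lemma tangent_defect_trig_poly:
  "tangent_defect (trig_poly A c) (trig_poly A (\<lambda>k. \<i> * of_int k * c k)) s x
     = trig_poly A (\<lambda>k. defect_multiplier k s * c k) x"
proof -
  have "cis (of_int k * (x - s)) = cis (- of_int k * s) * cis (of_int k * x)" for k
    by (simp add: cis_mult algebra_simps)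
  then have "tangent_defect (trig_poly A c) (trig_poly A (\<lambda>k. \<i> * of_int k * c k)) s x
     = (\<Sum>k\<in>A. (cos s *\<^sub>R (c k * cis (of_int k * x))
          - c k * (cis (- of_int k * s) * cis (of_int k * x))) /\<^sub>R sin s
          - \<i> * of_int k * c k * cis (of_int k * x))"
    by (simp add: tangent_defect_def trig_poly_def scaleR_sum_right sum_subtractf scaleR_diff_right)
  also have "\<dots> = trig_poly A (\<lambda>k. defect_multiplier k s * c k) x"
    unfolding trig_poly_def defect_multiplier_def
    by (intro sum.cong refl) (simp add: scaleR_conv_of_real field_simps)
  finally show ?thesis .
qed

section \<open>Parseval's identity and the size of the multiplier\<close>

lemma has_integral_cis_period:
  "((\<lambda>x. cis (of_int n * x)) has_integral (if n = 0 then of_real (2 * pi) else 0)) {0..2 * pi}"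
proof (cases "n = 0")
  case True
  then show ?thesis using has_integral_const_real[of "1::complex" 0 "2 * pi"]
    by (simp add: scaleR_conv_of_real)
next
  case False
  have "((\<lambda>x. cis (of_int n * x)) has_integral
      (cis (of_int n * (2 * pi)) / (\<i> * of_int n) - cis (of_int n * 0) / (\<i> * of_int n))) {0..2 * pi}"
  proof (rule fundamental_theorem_of_calculus)
    fix x
    show "((\<lambda>x. cis (of_int n * x) / (\<i> * of_int n)) has_vector_derivative cis (of_int n * x)) (at x within {0..2 * pi})"
      using False unfolding cis_conv_exp
      by (auto intro!: derivative_eq_intros has_vector_derivative_real_field simp: field_simps)
  qed simp
  moreover have "cis (of_int n * (2 * pi)) = 1"
    using cis_multiple_2pi[of "of_int n"] by (simp add: mult_ac)
  ultimately show ?thesis using False by simp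
qed

lemma has_integral_norm_trig_poly:
  assumes "finite A"
  shows "((\<lambda>x. (norm (trig_poly A c x))\<^sup>2) has_integral (2 * pi * (\<Sum>k\<in>A. (norm (c k))\<^sup>2))) {0..2 * pi}"
proof -
  have eq: "complex_of_real ((norm (trig_poly A c x))\<^sup>2)
      = (\<Sum>k\<in>A. \<Sum>l\<in>A. c k * cnj (c l) * cis (of_int (k - l) * x))" for x
  proof -
    have "cis (of_int (k - l) * x) = cis (of_int k * x) * cnj (cis (of_int l * x))" for k l
      by (simp add: cis_cnj cis_mult algebra_simps)
    then show ?thesis
      unfolding complex_norm_square trig_poly_def cnj_sum sum_product
      by (intro sum.cong refl) (simp add: mult_ac)
  qed
  have "((\<lambda>x. \<Sum>k\<in>A. \<Sum>l\<in>A. c k * cnj (c l) * cis (of_int (k - l) * x)) has_integral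
      (\<Sum>k\<in>A. \<Sum>l\<in>A. c k * cnj (c l) * (if k - l = 0 then of_real (2 * pi) else 0))) {0..2 * pi}"
    by (intro has_integral_sum assms has_integral_mult_right has_integral_cis_period)
  also have "(\<Sum>k\<in>A. \<Sum>l\<in>A. c k * cnj (c l) * (if k - l = 0 then of_real (2 * pi) else 0))
      = (\<Sum>k\<in>A. complex_of_real (2 * pi * (norm (c k))\<^sup>2))"
    using assms
    by (intro sum.cong refl) (simp add: if_distrib complex_norm_square mult_ac cong: if_cong del: of_real_power)
  also have "\<dots> = complex_of_real (2 * pi * (\<Sum>k\<in>A. (norm (c k))\<^sup>2))"
    by (simp add: sum_distrib_left)
  finally have "((\<lambda>x. complex_of_real ((norm (trig_poly A c x))\<^sup>2)) has_integral
      complex_of_real (2 * pi * (\<Sum>k\<in>A. (norm (c k))\<^sup>2))) {0..2 * pi}"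
    by (simp only: eq)
  from has_integral_linear[OF this bounded_linear_Re] show ?thesis
    by (simp add: o_def)
qed

text \<open>The left side is \<open>(sin s)\<^sup>2\<close> times the squared modulus of the
  multiplier at 2n + 1. Passing from n to n + 1 replaces the angle a - s by a + s, where a = (2n +
  2) s, and adds 8 (n + 1) sin^2 s (1 - cos a). The factor sin^2 s thus cancels the denominator of
  the multiplier.\<close>

lemma defect_sum_identity:
  "(cos s - cos (real (2*n+1) * s))\<^sup>2 + (sin (real (2*n+1) * s) - real (2*n+1) * sin s)\<^sup>2
     = 16 * (sin s)\<^sup>2 * (\<Sum>j=1..n. real j * (sin (real j * s))\<^sup>2)"
proof (induction n)
  case (Suc n)
  define a where "a = real (2 * n + 2) * s"
  have 1: "real (2*n+1) * s = a - s" and 2: "real (2*Suc n+1) * s = a + s"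
    by (auto simp: a_def algebra_simps)
  have "(sin (real (Suc n) * s))\<^sup>2 = (1 - cos a) / 2"
    using cos_double_sin[of "real (Suc n) * s"] by (simp add: a_def algebra_simps)
  from this have 3: "16 * (sin s)\<^sup>2 * (\<Sum>j=1..Suc n. real j * (sin (real j * s))\<^sup>2)
      = 16 * (sin s)\<^sup>2 * (\<Sum>j=1..n. real j * (sin (real j * s))\<^sup>2)
        + 8 * real (Suc n) * (sin s)\<^sup>2 * (1 - cos a)"
    by (simp only: sum.nat_ivl_Suc' le_add1 add.commute[of 1]) (simp add: field_simps)
  show ?case
    unfolding 3 Suc.IH[symmetric] unfolding 1 2 cos_add cos_diff sin_add sin_diff
    by (simp add: power2_eq_square algebra_simps)
qed simp

lemma norm_defect_multiplier:
  assumes "sin s \<noteq> 0"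
  shows "(norm (defect_multiplier k s))\<^sup>2 =
    ((cos s - cos (of_int k * s))\<^sup>2 + (sin (of_int k * s) - of_int k * sin s)\<^sup>2) / (sin s)\<^sup>2"
proof -
  have "Re (defect_multiplier k s) = (cos s - cos (of_int k * s)) / sin s"
    by (simp add: defect_multiplier_def Re_divide power2_eq_square)
  moreover have "Im (defect_multiplier k s) = (sin (of_int k * s) - of_int k * sin s) / sin s"
    using assms by (simp add: defect_multiplier_def Im_divide power2_eq_square field_simps)
  ultimately show ?thesis
    by (simp add: cmod_power2 power_divide add_divide_distrib)
qed

lemma norm_defect_multiplier_odd:
  assumes "sin s \<noteq> 0" "\<bar>k\<bar> = int (2*n+1)"
  shows "(norm (defect_multiplier k s))\<^sup>2 = 16 * (\<Sum>j=1..n. real j * (sin (real j * s))\<^sup>2)"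
proof -
  \<comment> \<open>Cosine is even, and both terms of the second square are odd in \<open>k\<close>,
    so only the absolute value of \<open>k\<close> matters.\<close>
  have "(cos s - cos (of_int k * s))\<^sup>2 + (sin (of_int k * s) - of_int k * sin s)\<^sup>2
      = (cos s - cos (of_int \<bar>k\<bar> * s))\<^sup>2 + (sin (of_int \<bar>k\<bar> * s) - of_int \<bar>k\<bar> * sin s)\<^sup>2"
    by (cases "k \<ge> 0") (auto simp: power2_eq_square algebra_simps)
  also have "\<dots> = 16 * (sin s)\<^sup>2 * (\<Sum>j=1..n. real j * (sin (real j * s))\<^sup>2)"
    using defect_sum_identity[of s n] by (simp only: assms(2) of_int_of_nat_eq)
  finally show ?thesis using assms(1) by (simp add: norm_defect_multiplier)
qed

section \<open>The weight of the integral\<close>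

text \<open>The derivative of the integrand as a function of the angle; it is the weight with which
  the level sets of the visual angle are counted.\<close>

definition dmoment :: "nat \<Rightarrow> real \<Rightarrow> real" where
  "dmoment m s = real m * s ^ (m - 1) - real m * sin s ^ (m - 1) * cos s"

lemma DERIV_moment:
  "((\<lambda>t. t ^ m - sin t ^ m) has_real_derivative dmoment m s) (at s within A)"
  unfolding dmoment_def by (auto intro!: derivative_eq_intros simp: mult_ac)

lemma continuous_dmoment [continuous_intros]:
  "continuous_on A g \<Longrightarrow> continuous_on A (\<lambda>x. dmoment m (g x))"
  for g :: "'a::t2_space \<Rightarrow> real"
  unfolding dmoment_def by (intro continuous_intros)

lemma dmoment_nonneg:
  assumes "0 \<le> s" "s \<le> pi"
  shows "0 \<le> dmoment m s"
proof -
  have "sin s ^ (m - 1) * cos s \<le> sin s ^ (m - 1) * 1"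
    using assms by (intro mult_left_mono) (auto simp: sin_ge_zero)
  also have "\<dots> \<le> s ^ (m - 1)"
    using assms by (auto intro!: power_mono sin_x_le_x sin_ge_zero)
  finally show ?thesis by (simp add: dmoment_def mult_left_mono mult.assoc)
qed

lemma dmoment_pos:
  assumes "0 < s" "s < pi" "1 \<le> m"
  shows "0 < dmoment m s"
proof -
  have "cos s < 1" using cos_monotone_0_pi[of 0 s] assms by simp
  then have "sin s ^ (m - 1) * cos s < sin s ^ (m - 1) * 1"
    using assms by (intro mult_strict_left_mono) (auto simp: sin_gt_zero)
  also have "\<dots> \<le> s ^ (m - 1)"
    using assms by (auto intro!: power_mono sin_x_le_x sin_ge_zero)
  finally show ?thesis using assms by (simp add: dmoment_def mult.assoc)
qed

lemma x_cos_le_sin: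
  assumes "0 \<le> x" "x \<le> pi"
  shows "x * cos x \<le> sin (x::real)"
proof -
  have "(\<lambda>x. sin x - x * cos x) 0 \<le> (\<lambda>x. sin x - x * cos x) x"
  proof (rule DERIV_nonneg_imp_nondecreasing[OF assms(1)])
    fix y assume "0 \<le> y" "y \<le> x"
    then show "\<exists>d. ((\<lambda>x. sin x - x * cos x) has_real_derivative d) (at y) \<and> 0 \<le> d"
      using assms by (intro exI[of _ "y * sin y"]) (auto intro!: derivative_eq_intros mult_nonneg_nonneg sin_ge_zero)
  qed
  then show ?thesis by simp
qed

lemma power_diff_le:
  fixes a b :: real
  assumes "0 \<le> a" "a \<le> b"
  shows "b ^ n - a ^ n \<le> real n * b ^ (n - 1) * (b - a)"
proof (induction n)
  case (Suc n)
  have "b ^ Suc n - a ^ Suc n = b * (b ^ n - a ^ n) + a ^ n * (b - a)" by (simp add: algebra_simps)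
  also have "\<dots> \<le> b * (real n * b ^ (n - 1) * (b - a)) + b ^ n * (b - a)"
    using assms by (intro add_mono mult_left_mono mult_right_mono Suc power_mono) auto
  also have "\<dots> = real (Suc n) * b ^ (Suc n - 1) * (b - a)"
    by (cases n) (auto simp: algebra_simps)
  finally show ?case .
qed simp

text \<open>Keeps the integrand of \<open>M_coeff\<close> bounded near 0. It rests on s - sin s
  \<le> s (1 - cos s), which is \<open>x_cos_le_sin\<close>, and on the power difference being
  controlled by s - sin s.\<close>

lemma dmoment_le:
  assumes "0 \<le> s" "s \<le> pi"
  shows "dmoment m s \<le> real m * real m * pi ^ (m - 1) * (1 - cos s)"
proof -
  define n where "n = m - 1"
  have sn: "0 \<le> sin s" "sin s \<le> s" using assms by (auto simp: sin_ge_zero sin_x_le_x)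
  have P: "s ^ n \<le> pi ^ n" using assms by (intro power_mono) auto
  have "s ^ n - sin s ^ n \<le> real n * s ^ (n - 1) * (s - sin s)"
    by (rule power_diff_le) fact+
  also have "\<dots> \<le> real n * s ^ (n - 1) * (s * (1 - cos s))"
    using x_cos_le_sin[OF assms] assms by (intro mult_left_mono) (auto simp: algebra_simps)
  also have "\<dots> = real n * s ^ n * (1 - cos s)" by (cases n) auto
  also have "\<dots> \<le> real n * pi ^ n * (1 - cos s)"
    using P by (intro mult_right_mono mult_left_mono) auto
  finally have A: "s ^ n - sin s ^ n \<le> real n * pi ^ n * (1 - cos s)" .
  have A0: "0 \<le> s ^ n - sin s ^ n" using sn by (simp add: power_mono)
  have "s ^ n - sin s ^ n * cos s = s ^ n * (1 - cos s) + cos s * (s ^ n - sin s ^ n)"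
    by (simp add: algebra_simps)
  also have "\<dots> \<le> pi ^ n * (1 - cos s) + 1 * (s ^ n - sin s ^ n)"
    using P A0 by (intro add_mono mult_right_mono) auto
  also have "\<dots> \<le> (real n + 1) * pi ^ n * (1 - cos s)"
    using A by (simp add: algebra_simps)
  finally have B: "s ^ n - sin s ^ n * cos s \<le> (real n + 1) * pi ^ n * (1 - cos s)" .
  show ?thesis
  proof (cases m)
    case (Suc k)
    then have nm: "real n + 1 = real m" by (simp add: n_def)
    have "dmoment m s = real m * (s ^ n - sin s ^ n * cos s)"
      by (simp add: dmoment_def n_def algebra_simps)
    also have "\<dots> \<le> real m * (real m * pi ^ n * (1 - cos s))"
      using B unfolding nm by (rule mult_left_mono) simp
    finally show ?thesis by (simp add: n_def mult.assoc)
  qed (simp add: dmoment_def)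
qed

lemma has_integral_dmoment:
  assumes "1 \<le> m" "0 \<le> t" "t \<le> pi"
  shows "(dmoment m has_integral t ^ m - sin t ^ m) {0..t}"
proof -
  have "(dmoment m has_integral (t ^ m - sin t ^ m) - (0 ^ m - sin 0 ^ m)) {0..t}"
    by (rule fundamental_theorem_of_calculus[OF assms(2)])
       (simp add: DERIV_moment flip: has_real_derivative_iff_has_vector_derivative)
  then show ?thesis using assms by simp
qed

text \<open>Integration by parts leaves \<open>- sin (2 j s) / (2 j)\<close> against the increasing weight, which is at
  most \<open>1/2\<close> on \<open>[0, \<pi> - 1/2]\<close> and at most \<open>\<pi> - s\<close> on the rest.\<close>

lemma integral_power_cos_le:
  assumes m: "1 \<le> m" and j: "1 \<le> j"
  shows "integral {0..pi} (\<lambda>s. real m * s ^ (m - 1) * cos (2 * real j * s)) \<le> pi ^ m - (pi - 1/2) ^ m"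
proof -
  define h where "h s = real m * s ^ (m - 1)" for s :: real
  define h' where "h' s = real m * (real (m - 1) * s ^ (m - 2))" for s :: real
  define k where "k = 2 * real j"
  have k: "k \<ge> 2" using j by (simp add: k_def)
  \<comment> \<open>The point where the two majorants 1/2 and pi - s agree, so that the boundary
    terms of the two partial integrations cancel there.\<close>
  define a where "a = pi - 1/2"
  have a: "0 \<le> a" "a \<le> pi" using pi_gt3 by (auto simp: a_def)
  have dh: "(h has_real_derivative h' s) (at s within A)" for s A
    unfolding h_def h'_def
    by (auto intro!: derivative_eq_intros simp: numeral_2_eq_2)
  have h'0: "h' s \<ge> 0" if "s \<ge> 0" for s using that by (simp add: h'_def)
  \<comment> \<open>As \<open>k * pi\<close> is a multiple of 2 pi, the sine can be measured from
    the right end point, which gives the majorant pi - s.\<close>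
  have sink: "- sin (k * s) = sin (k * (pi - s))" for s
  proof -
    have "sin (k * (pi - s)) = sin (2 * real j * pi - k * s)" by (simp add: k_def algebra_simps)
    also have "\<dots> = - sin (k * s)"
      using sin_npi[of "2*j"] cos_npi[of "2*j"] by (simp add: sin_diff algebra_simps)
    finally show ?thesis by simp
  qed
  have c: "continuous_on A (\<lambda>s. h s * cos (k * s))" for A
    unfolding h_def by (intro continuous_intros)
  have int: "(\<lambda>s. h s * cos (k * s)) integrable_on {b..c}" for b c
    by (intro integrable_continuous_real c)
  \<comment> \<open>The constant 1/2 added to the antiderivative of the cosine makes the term with
    \<open>h'\<close> nonnegative; discarding it bounds the integral by boundary terms.\<close>
  have d1: "((\<lambda>s. h s * (sin (k * s) / k + 1/2)) has_real_derivative
      (h s * cos (k * s) + h' s * (sin (k * s) / k + 1/2))) (at s within A)" for s A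
    using k by (auto intro!: derivative_eq_intros dh simp: field_simps)
  have I1: "((\<lambda>s. h s * cos (k * s) + h' s * (sin (k * s) / k + 1/2)) has_integral
      h a * (sin (k * a) / k + 1/2) - h 0 * (sin (k * 0) / k + 1/2)) {0..a}"
    by (rule fundamental_theorem_of_calculus[OF a(1)])
       (use d1 in \<open>simp flip: has_real_derivative_iff_has_vector_derivative\<close>)
  have L1: "integral {0..a} (\<lambda>s. h s * cos (k * s)) \<le> h a * (sin (k * a) / k + 1/2) - h 0 * (sin (k * 0) / k + 1/2)"
  proof (rule has_integral_le[OF integrable_integral[OF int] I1])
    fix s assume s: "s \<in> {0..a}"
    have "- k \<le> 2 * sin (k * s)" using sin_ge_minus_one[of "k * s"] k by linarith
    then have "- 1/2 \<le> sin (k * s) / k"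
      using k by (simp add: field_simps)
    then show "h s * cos (k * s) \<le> h s * cos (k * s) + h' s * (sin (k * s) / k + 1/2)"
      using h'0[of s] s by auto
  qed
  have dpow: "((\<lambda>s. s ^ m) has_real_derivative h s) (at s within A)" for s A
    unfolding h_def by (auto intro!: derivative_eq_intros)
  \<comment> \<open>Now the added term is pi - s, whose derivative produces -\<open>h\<close>; the
    summand \<open>s ^ m\<close>, with derivative \<open>h\<close>, compensates for it.\<close>
  have d2: "((\<lambda>s. h s * (sin (k * s) / k + (pi - s)) + s ^ m) has_real_derivative
      (h s * cos (k * s) + h' s * (sin (k * s) / k + (pi - s)))) (at s within A)" for s A
    using k by (auto intro!: derivative_eq_intros dh DERIV_cong[OF dpow] simp: field_simps)
  have I2: "((\<lambda>s. h s * cos (k * s) + h' s * (sin (k * s) / k + (pi - s))) has_integral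
      (h pi * (sin (k * pi) / k + (pi - pi)) + pi ^ m) - (h a * (sin (k * a) / k + (pi - a)) + a ^ m)) {a..pi}"
    by (rule fundamental_theorem_of_calculus[OF a(2)])
       (use d2 in \<open>simp flip: has_real_derivative_iff_has_vector_derivative\<close>)
  have L2: "integral {a..pi} (\<lambda>s. h s * cos (k * s)) \<le>
      (h pi * (sin (k * pi) / k + (pi - pi)) + pi ^ m) - (h a * (sin (k * a) / k + (pi - a)) + a ^ m)"
  proof (rule has_integral_le[OF integrable_integral[OF int] I2])
    fix s assume s: "s \<in> {a..pi}"
    have "sin (k * (pi - s)) \<le> k * (pi - s)" using k s by (intro sin_x_le_x) auto
    then have "- sin (k * s) / k \<le> pi - s"
      unfolding sink using k by (simp add: field_simps)
    then show "h s * cos (k * s) \<le> h s * cos (k * s) + h' s * (sin (k * s) / k + (pi - s))"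
      using h'0[of s] s a by auto
  qed
  have "integral {0..pi} (\<lambda>s. h s * cos (k * s))
      = integral {0..a} (\<lambda>s. h s * cos (k * s)) + integral {a..pi} (\<lambda>s. h s * cos (k * s))"
    by (rule Henstock_Kurzweil_Integration.integral_combine[symmetric]) (use a int in auto)
  also have "\<dots> \<le> pi ^ m - a ^ m - h 0 / 2"
    using L1 L2 sink[of 0] sink[of pi] by (simp add: a_def algebra_simps)
  also have "\<dots> \<le> pi ^ m - a ^ m" by (simp add: h_def)
  finally show ?thesis by (simp add: h_def k_def a_def)
qed

text \<open>The reflection of s to pi - s fixes sin s and cos (2 j s) and negates cos s.\<close>

lemma integral_sin_power_cos_even:
  "integral {0..pi} (\<lambda>s. real m * sin s ^ (m - 1) * cos s * cos (2 * real j * s)) = 0"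
proof -
  define g where "g s = real m * sin s ^ (m - 1) * cos s * cos (2 * real j * s)" for s
  have refl: "g (pi - s) = - g s" for s
  proof -
    have "cos (2 * real j * (pi - s)) = cos (2 * real j * pi - 2 * real j * s)" by (simp add: algebra_simps)
    also have "\<dots> = cos (2 * real j * s)"
      using sin_npi[of "2*j"] cos_npi[of "2*j"] by (simp add: cos_diff algebra_simps)
    finally show ?thesis by (simp add: g_def)
  qed
  have gi: "g integrable_on {0..pi}"
    unfolding g_def by (intro integrable_continuous_real continuous_intros)
  have "((\<lambda>x. g (pi - x)) has_integral integral {0..pi} g) {0..pi}"
    using has_integral_affinity[of g "integral {0..pi} g" 0 pi "-1" pi] gi
    by (simp add: has_integral_integral algebra_simps)
  then have "((\<lambda>x. - g x) has_integral integral {0..pi} g) {0..pi}"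
    unfolding refl .
  moreover have "((\<lambda>x. - g x) has_integral - integral {0..pi} g) {0..pi}"
    using gi by (intro has_integral_neg) auto
  ultimately have "integral {0..pi} g = - integral {0..pi} g"
    by (rule has_integral_unique)
  then have "integral {0..pi} g = 0" by simp
  then show ?thesis unfolding g_def[abs_def] .
qed

text \<open>Writing sin^2 (j s) as (1 - cos (2 j s)) / 2, the constant part gives pi^m / 2, the sine
  power contributes nothing by symmetry, and the power of s is estimated by
  \<open>integral_power_cos_le\<close>.\<close>

lemma integral_dmoment_sin_ge:
  assumes "1 \<le> m" "1 \<le> j"
  shows "(pi - 1/2) ^ m / 2 \<le> integral {0..pi} (\<lambda>s. dmoment m s * (sin (real j * s))\<^sup>2)"
proof -
  have e: "dmoment m s * (sin (real j * s))\<^sup>2 = dmoment m s / 2 -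
      (real m * s ^ (m - 1) * cos (2 * real j * s)) / 2 +
      (real m * sin s ^ (m - 1) * cos s * cos (2 * real j * s)) / 2" for s
  proof -
    have "(sin (real j * s))\<^sup>2 = (1 - cos (2 * real j * s)) / 2"
      using cos_double_sin[of "real j * s"] by (simp add: algebra_simps)
    then have "dmoment m s * (sin (real j * s))\<^sup>2 = dmoment m s * ((1 - cos (2 * real j * s)) / 2)"
      by (rule arg_cong)
    also have "\<dots> = dmoment m s / 2 - (real m * s ^ (m - 1) * cos (2 * real j * s)) / 2 +
      (real m * sin s ^ (m - 1) * cos s * cos (2 * real j * s)) / 2"
      unfolding dmoment_def by (simp only: diff_divide_distrib right_diff_distrib left_diff_distrib)
    finally show ?thesis .
  qed
  have i1: "(\<lambda>s. dmoment m s / 2) integrable_on {0..pi}"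
    by (intro integrable_continuous_real continuous_intros) auto
  have i2: "(\<lambda>s. (real m * s ^ (m - 1) * cos (2 * real j * s)) / 2) integrable_on {0..pi}"
    by (intro integrable_continuous_real continuous_intros) auto
  have i3: "(\<lambda>s. (real m * sin s ^ (m - 1) * cos s * cos (2 * real j * s)) / 2) integrable_on {0..pi}"
    by (intro integrable_continuous_real continuous_intros) auto
  have "integral {0..pi} (dmoment m) = pi ^ m"
    using has_integral_dmoment[OF assms(1), of pi] assms by (simp add: integral_unique)
  moreover have "integral {0..pi} (\<lambda>s. dmoment m s * (sin (real j * s))\<^sup>2)
      = integral {0..pi} (\<lambda>s. dmoment m s / 2)
      - integral {0..pi} (\<lambda>s. real m * s ^ (m - 1) * cos (2 * real j * s) / 2)
      + integral {0..pi} (\<lambda>s. real m * sin s ^ (m - 1) * cos s * cos (2 * real j * s) / 2)"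
    unfolding e
    by (simp only: Henstock_Kurzweil_Integration.integral_add[OF integrable_diff[OF i1 i2] i3]
        Henstock_Kurzweil_Integration.integral_diff[OF i1 i2])
  ultimately have "2 * integral {0..pi} (\<lambda>s. dmoment m s * (sin (real j * s))\<^sup>2)
      = pi ^ m - integral {0..pi} (\<lambda>s. real m * s ^ (m - 1) * cos (2 * real j * s))"
    unfolding Henstock_Kurzweil_Integration.integral_divide integral_sin_power_cos_even by simp
  then show ?thesis
    using integral_power_cos_le[OF assms] by linarith
qed

section \<open>Antiperiodic functions\<close>

text \<open>Values in a normed space cover both the real function \<open>centered\<close> and its
  complex trigonometric approximations.\<close>

definition antiperiodic_C1 :: "(real \<Rightarrow> 'a::real_normed_vector) \<Rightarrow> (real \<Rightarrow> 'a) \<Rightarrow> bool" where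
  "antiperiodic_C1 u u' \<longleftrightarrow> (\<forall>x. (u has_vector_derivative u' x) (at x)) \<and>
     continuous_on UNIV u' \<and> (\<forall>x. u (x + pi) = - u x)"

lemma antiperiodic_C1_continuous:
  "antiperiodic_C1 u u' \<Longrightarrow> continuous_on UNIV u"
  unfolding antiperiodic_C1_def
  by (auto simp: continuous_on_eq_continuous_at intro: has_vector_derivative_continuous)

lemma antiperiodic_C1_diff:
  assumes "antiperiodic_C1 u u'" "antiperiodic_C1 v v'"
  shows "antiperiodic_C1 (\<lambda>x. u x - v x) (\<lambda>x. u' x - v' x)"
  using assms unfolding antiperiodic_C1_def
  by (auto intro!: derivative_intros continuous_intros)

lemma antiperiodic_C1_of_real:
  assumes "antiperiodic_C1 u u'"
  shows "antiperiodic_C1 (\<lambda>x. complex_of_real (u x)) (\<lambda>x. complex_of_real (u' x))"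
  using assms unfolding antiperiodic_C1_def
  by (auto intro!: has_vector_derivative_of_real continuous_intros
      simp: has_real_derivative_iff_has_vector_derivative)

lemma antiperiodic_C1_deriv:
  assumes "antiperiodic_C1 u u'"
  shows "u' (x + pi) = - u' x"
proof -
  have d: "(u has_vector_derivative u' x) (at x)" for x using assms by (simp add: antiperiodic_C1_def)
  have "((u \<circ> (\<lambda>x. x + pi)) has_vector_derivative 1 *\<^sub>R u' (x + pi)) (at x)"
    by (rule vector_diff_chain_at[OF _ d]) (auto intro!: derivative_eq_intros)
  moreover have "u \<circ> (\<lambda>x. x + pi) = (\<lambda>x. - u x)"
    using assms by (auto simp: antiperiodic_C1_def)
  ultimately have "((\<lambda>x. - u x) has_vector_derivative u' (x + pi)) (at x)" by simp
  moreover have "((\<lambda>x. - u x) has_vector_derivative - u' x) (at x)"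
    using d by (auto intro!: derivative_intros)
  ultimately show ?thesis by (rule vector_derivative_unique_at)
qed

lemma antiperiodic_C1_bounded:
  assumes "antiperiodic_C1 u u'"
  obtains B where "B > 0" "\<And>x. norm (u' x) \<le> B"
proof -
  have c: "continuous_on {0..pi} u'"
    using assms unfolding antiperiodic_C1_def by (meson continuous_on_subset subset_UNIV)
  have "bounded (u' ` {0..pi})"
    by (intro compact_imp_bounded compact_continuous_image c) simp
  then obtain B where B: "B > 0" "\<And>x. x \<in> {0..pi} \<Longrightarrow> norm (u' x) \<le> B"
    unfolding bounded_pos by auto
  have "norm (u' x) \<le> B" for x
  proof -
    obtain y where "0 \<le> y" "y < pi" "norm (u' x) = norm (u' y)"
      using periodic_reduce[of "\<lambda>x. norm (u' x)" pi] antiperiodic_C1_deriv[OF assms]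
      by (metis norm_minus_cancel pi_gt_zero)
    then show ?thesis using B by auto
  qed
  with B(1) show ?thesis by (rule that)
qed

lemma norm_increment_le:
  fixes u :: "real \<Rightarrow> 'a::real_normed_vector"
  assumes "a \<le> b" and "\<And>x. (u has_vector_derivative u' x) (at x)" and "\<And>x. a < x \<Longrightarrow> x < b \<Longrightarrow> norm (u' x) \<le> B"
  shows "norm (u b - u a) \<le> B * (b - a)"
proof (cases "a = b")
  case False
  have "norm (u b - u a) \<le> (\<lambda>x. B * x) b - (\<lambda>x. B * x) a"
  proof (rule differentiable_bound_general)
    show "a < b" using assms(1) False by simp
    show "continuous_on {a..b} u"
      using assms(2) by (auto intro!: continuous_at_imp_continuous_on intro: has_vector_derivative_continuous)
    show "((\<lambda>x. B * x) has_vector_derivative B) (at x)" for x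
      by (auto intro!: derivative_eq_intros)
  qed (use assms in \<open>auto intro!: continuous_intros\<close>)
  then show ?thesis by (simp add: algebra_simps)
qed simp

text \<open>The increment of \<open>u\<close> over half a period is -2 u, so \<open>u'\<close> alone
  controls \<open>u\<close>; the constant comes from pi < 4.\<close>

lemma antiperiodic_C1_norm_le:
  assumes "antiperiodic_C1 u u'" "\<And>x. norm (u' x) \<le> B"
  shows "norm (u x) \<le> 2 * B"
proof -
  have "norm (u (x + pi) - u x) \<le> B * (x + pi - x)"
    by (rule norm_increment_le) (use assms in \<open>auto simp: antiperiodic_C1_def\<close>)
  also have "\<dots> \<le> B * 4"
    using pi_less_4 order_trans[OF norm_ge_zero assms(2)] by (intro mult_left_mono) auto
  also have "u (x + pi) - u x = - (2 *\<^sub>R u x)"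
    using assms(1) by (simp add: antiperiodic_C1_def scaleR_2)
  finally show ?thesis by simp
qed

lemma sin_ge_half:
  assumes "0 \<le> s" "s \<le> pi / 2"
  shows "s / 2 \<le> sin (s::real)"
proof -
  have c: "0 \<le> cos s" "0 \<le> cos (s / 2)" using assms by (auto intro!: cos_ge_zero)
  have "s / 2 \<le> s * ((1 + cos s) / 2)" using assms c by (simp add: algebra_simps)
  also have "(1 + cos s) / 2 = (cos (s / 2))\<^sup>2"
    using cos_double_cos[of "s / 2"] by simp
  also have "s * (cos (s / 2))\<^sup>2 = 2 * (s / 2 * cos (s / 2)) * cos (s / 2)"
    by (simp add: power2_eq_square)
  also have "\<dots> \<le> 2 * sin (s / 2) * cos (s / 2)"
    using assms c by (intro mult_right_mono mult_left_mono x_cos_le_sin) auto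
  also have "\<dots> = sin s" using sin_double[of "s / 2"] by simp
  finally show ?thesis .
qed

text \<open>The numerator \<open>h\<close> vanishes at 0 and, by antiperiodicity, at pi, and its
  derivative is at most 3 B. Hence it is at most 3 B times the distance to the nearer end point,
  which is at most 6 B sin s; the summand \<open>u'\<close> adds one more B.\<close>

lemma norm_tangent_defect_le:
  assumes u: "antiperiodic_C1 u u'" and B: "\<And>x. norm (u' x) \<le> B" and s: "0 < s" "s < pi"
  shows "norm (tangent_defect u u' s x) \<le> 7 * B"
proof -
  have du: "(u has_vector_derivative u' x) (at x)" for x using u by (simp add: antiperiodic_C1_def)
  have B0: "0 \<le> B" using order_trans[OF norm_ge_zero B] .
  define h where "h t = cos t *\<^sub>R u x - u (x - t)" for t
  define h' where "h' t = - sin t *\<^sub>R u x + u' (x - t)" for t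
  have dh: "(h has_vector_derivative h' t) (at t)" for t
  proof -
    have "((u \<circ> (\<lambda>t. x - t)) has_vector_derivative (-1) *\<^sub>R u' (x - t)) (at t)"
      by (rule vector_diff_chain_at[OF _ du]) (auto intro!: derivative_eq_intros)
    then have "((\<lambda>t. u (x - t)) has_vector_derivative - u' (x - t)) (at t)" by (simp add: o_def)
    moreover have "((\<lambda>t. cos t *\<^sub>R u x) has_vector_derivative - sin t *\<^sub>R u x) (at t)"
      by (auto intro!: derivative_eq_intros simp: has_vector_derivative_def has_field_derivative_def)
    ultimately show ?thesis
      unfolding h_def h'_def using has_vector_derivative_diff by fastforce
  qed
  have h'B: "norm (h' t) \<le> 3 * B" for t
  proof -
    have "norm (h' t) \<le> \<bar>sin t\<bar> * norm (u x) + norm (u' (x - t))"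
      unfolding h'_def by (rule order_trans[OF norm_triangle_ineq]) simp
    also have "\<dots> \<le> 1 * (2 * B) + B"
      using antiperiodic_C1_norm_le[OF u B] by (intro add_mono mult_mono B) auto
    finally show ?thesis by simp
  qed
  have "u x = - u (x - pi)" using u unfolding antiperiodic_C1_def by (metis diff_add_cancel)
  then have h0: "h 0 = 0" "h pi = 0" by (auto simp: h_def)
  have hs: "norm (h s) \<le> 6 * B * sin s"
  proof (cases "s \<le> pi / 2")
    case True
    have "norm (h s - h 0) \<le> 3 * B * (s - 0)"
      by (rule norm_increment_le) (use dh h'B s in auto)
    also have "\<dots> \<le> 3 * B * (2 * sin s)"
      using sin_ge_half[of s] True s B0 by (intro mult_left_mono) auto
    finally show ?thesis by (simp add: h0)
  next
    case False
    have "norm (h pi - h s) \<le> 3 * B * (pi - s)"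
      by (rule norm_increment_le) (use dh h'B s in auto)
    also have "\<dots> \<le> 3 * B * (2 * sin s)"
      using sin_ge_half[of "pi - s"] False s B0 by (intro mult_left_mono) auto
    finally show ?thesis by (simp add: h0)
  qed
  have "norm (tangent_defect u u' s x) \<le> norm (h s) / sin s + norm (u' x)"
    unfolding tangent_defect_def h_def[symmetric]
    by (rule order_trans[OF norm_triangle_ineq4]) (use sin_gt_zero[OF s] in \<open>simp add: divide_inverse_commute\<close>)
  also have "\<dots> \<le> 6 * B + B"
    using hs s by (intro add_mono B) (simp add: divide_le_eq sin_gt_zero)
  finally show ?thesis by simp
qed

lemma tangent_defect_diff:
  "tangent_defect (\<lambda>x. u x - v x) (\<lambda>x. u' x - v' x) s x = tangent_defect u u' s x - tangent_defect v v' s x"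
  by (simp add: tangent_defect_def algebra_simps)

lemma tangent_defect_of_real:
  "tangent_defect (\<lambda>x. complex_of_real (u x)) (\<lambda>x. complex_of_real (u' x)) s x
     = complex_of_real (tangent_defect u u' s x)"
  by (simp add: tangent_defect_def scaleR_conv_of_real)

lemma cis_odd_shift:
  assumes "odd k"
  shows "cis (of_int k * (x + pi)) = - cis (of_int k * x)"
proof -
  have "cis (of_int k * pi) = -1"
    using assms by (simp add: complex_eq_iff cos_npi_int sin_npi_int mult.commute[of _ pi])
  then show ?thesis by (simp add: ring_distribs flip: cis_mult)
qed

lemma cis_even_shift:
  assumes "even k"
  shows "cis (of_int k * (x + pi)) = cis (of_int k * x)"
proof -
  have "cis (of_int k * pi) = 1"
    using assms by (simp add: complex_eq_iff cos_npi_int sin_npi_int mult.commute[of _ pi])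
  then show ?thesis by (simp add: ring_distribs flip: cis_mult)
qed

lemma antiperiodic_C1_trig_poly:
  assumes "finite A" "\<And>k. k \<in> A \<Longrightarrow> odd k"
  shows "antiperiodic_C1 (trig_poly A c) (trig_poly A (\<lambda>k. \<i> * of_int k * c k))"
proof -
  have "((\<lambda>x. cis (of_int k * x)) has_vector_derivative \<i> * of_int k * cis (of_int k * x)) (at x)" for k x
    unfolding cis_conv_exp
    by (auto intro!: derivative_eq_intros has_vector_derivative_real_field simp: field_simps)
  then have "(trig_poly A c has_vector_derivative trig_poly A (\<lambda>k. \<i> * of_int k * c k) x) (at x)" for x
    unfolding trig_poly_def
    by (intro has_vector_derivative_sum) (auto intro!: derivative_eq_intros simp: mult_ac)
  moreover have "continuous_on UNIV (trig_poly A (\<lambda>k. \<i> * of_int k * c k))"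
    unfolding trig_poly_def by (intro continuous_intros)
  moreover have "trig_poly A c (x + pi) = - trig_poly A c x" for x
    unfolding trig_poly_def sum_negf[symmetric]
    by (intro sum.cong refl) (use assms cis_odd_shift in \<open>simp\<close>)
  ultimately show ?thesis by (auto simp: antiperiodic_C1_def)
qed

text \<open>The derivative is approximated and then integrated mode by mode, so that closeness of
  the functions follows later from \<open>antiperiodic_C1_norm_le\<close>.\<close>

lemma antiperiodic_trig_poly_dense:
  fixes u :: "real \<Rightarrow> real"
  assumes u: "antiperiodic_C1 u u'" and "e > 0"
  obtains A c where "finite A" "\<And>k. k \<in> A \<Longrightarrow> odd k"
    "\<And>x. norm (complex_of_real (u' x) - trig_poly A (\<lambda>k. \<i> * of_int k * c k) x) \<le> e"
proof -
  have per: "u' (x + 2 * pi) = u' x" for x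
    using antiperiodic_C1_deriv[OF u, of "x + pi"] antiperiodic_C1_deriv[OF u, of x]
    by (simp add: add.assoc)
  have "continuous_on UNIV u'" using u by (simp add: antiperiodic_C1_def)
  from trig_poly_dense[OF this per \<open>e > 0\<close>]
  obtain B d where B: "finite B" "\<And>x. norm (complex_of_real (u' x) - trig_poly B d x) < e" by metis
  define A where "A = {k\<in>B. odd k}"
  \<comment> \<open>Antisymmetrizing under the shift by pi extracts the odd frequencies. As
    \<open>u'\<close> is antiperiodic, this does not enlarge the error.\<close>
  have split: "trig_poly A d x = (trig_poly B d x - trig_poly B d (x + pi)) / 2" for x
  proof -
    have "trig_poly B d x - trig_poly B d (x + pi)
        = (\<Sum>k\<in>B. if odd k then 2 * (d k * cis (of_int k * x)) else 0)"
      unfolding trig_poly_def sum_subtractf[symmetric]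
      by (intro sum.cong refl) (simp add: cis_odd_shift cis_even_shift)
    also have "\<dots> = 2 * trig_poly A d x"
      using B(1) by (simp add: trig_poly_def A_def sum_distrib_left flip: sum.inter_filter)
    finally show ?thesis by simp
  qed
  have "norm (complex_of_real (u' x) - trig_poly A d x) \<le> e" for x
  proof -
    let ?a = "complex_of_real (u' x) - trig_poly B d x"
    let ?b = "complex_of_real (u' (x + pi)) - trig_poly B d (x + pi)"
    have "complex_of_real (u' x) - trig_poly A d x = (?a - ?b) / 2"
      unfolding split antiperiodic_C1_deriv[OF u] by (simp add: field_simps)
    then have "norm (complex_of_real (u' x) - trig_poly A d x) = norm (?a - ?b) / 2"
      by (simp only: norm_divide norm_numeral)
    also have "\<dots> \<le> (norm ?a + norm ?b) / 2" by (intro divide_right_mono norm_triangle_ineq4) auto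
    also have "\<dots> \<le> (e + e) / 2" by (intro divide_right_mono add_mono less_imp_le B) auto
    also have "\<dots> = e" by simp
    finally show ?thesis .
  qed
  \<comment> \<open>Odd frequencies are nonzero, so every mode has an antiderivative of the same
    frequency.\<close>
  moreover have "trig_poly A (\<lambda>k. \<i> * of_int k * (d k / (\<i> * of_int k))) x = trig_poly A d x" for x
    unfolding trig_poly_def A_def by (intro sum.cong refl) auto
  ultimately have "norm (complex_of_real (u' x) - trig_poly A (\<lambda>k. \<i> * of_int k * (d k / (\<i> * of_int k))) x) \<le> e" for x
    by metis
  then show ?thesis
    by (rule that[rotated 2]) (use B(1) in \<open>auto simp: A_def\<close>)
qed

section \<open>The energy inequality\<close>

definition defect_energy :: "(real \<Rightarrow> 'a::real_normed_vector) \<Rightarrow> (real \<Rightarrow> 'a) \<Rightarrow> real \<Rightarrow> real" where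
  "defect_energy u u' s = integral {0..2 * pi} (\<lambda>x. (norm (tangent_defect u u' s x))\<^sup>2)"

text \<open>For \<open>u = p - w/2\<close> this is the isoperimetric deficit divided by \<open>2\<pi>\<close>.\<close>

definition wirtinger_form :: "(real \<Rightarrow> 'a::real_normed_vector) \<Rightarrow> (real \<Rightarrow> 'a) \<Rightarrow> real" where
  "wirtinger_form u u' = integral {0..2 * pi} (\<lambda>x. (norm (u' x))\<^sup>2 - (norm (u x))\<^sup>2)"

lemma continuous_tangent_defect:
  assumes "antiperiodic_C1 u u'"
  shows "continuous_on ({0<..<pi} \<times> UNIV) (\<lambda>(s, x). tangent_defect u u' s x)"
proof -
  have c: "continuous_on UNIV u" "continuous_on UNIV u'"
    using assms antiperiodic_C1_continuous[OF assms] unfolding antiperiodic_C1_def by auto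
  have 1: "continuous_on ({0<..<pi} \<times> UNIV) (\<lambda>z::real\<times>real. u (snd z))"
    by (rule continuous_on_compose2[OF c(1)]) (auto intro!: continuous_intros)
  have 2: "continuous_on ({0<..<pi} \<times> UNIV) (\<lambda>z::real\<times>real. u' (snd z))"
    by (rule continuous_on_compose2[OF c(2)]) (auto intro!: continuous_intros)
  have 3: "continuous_on ({0<..<pi} \<times> UNIV) (\<lambda>z::real\<times>real. u (snd z - fst z))"
    by (rule continuous_on_compose2[OF c(1)]) (auto intro!: continuous_intros)
  have 4: "sin (fst z) \<noteq> 0" if "z \<in> {0<..<pi} \<times> UNIV" for z :: "real \<times> real"
    using that sin_gt_zero[of "fst z"] by auto
  show ?thesis
    unfolding tangent_defect_def case_prod_unfold
    by (intro continuous_on_diff continuous_on_scaleR continuous_on_inverse continuous_on_cos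
        continuous_on_sin continuous_on_fst continuous_on_id 1 2 3 ballI 4)
qed

lemma continuous_tangent_defect2:
  assumes "antiperiodic_C1 u u'" "0 < s" "s < pi"
  shows "continuous_on UNIV (tangent_defect u u' s)"
proof -
  have "continuous_on UNIV (\<lambda>x. (\<lambda>(s, x). tangent_defect u u' s x) (s, x))"
    by (rule continuous_on_compose2[OF continuous_tangent_defect[OF assms(1)]])
       (use assms in \<open>auto intro!: continuous_intros\<close>)
  then show ?thesis by simp
qed

lemma continuous_defect_energy:
  assumes "antiperiodic_C1 u u'"
  shows "continuous_on {0<..<pi} (defect_energy u u')"
  unfolding defect_energy_def cbox_interval[symmetric]
proof (rule integral_continuous_on_param)
  show "continuous_on ({0<..<pi} \<times> cbox 0 (2 * pi)) (\<lambda>(s, x). (norm (tangent_defect u u' s x))\<^sup>2)"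
    unfolding case_prod_unfold
    by (intro continuous_intros continuous_on_subset[OF continuous_tangent_defect[OF assms, unfolded case_prod_unfold]]) auto
qed

lemma defect_energy_bounds:
  assumes u: "antiperiodic_C1 u u'" and B: "\<And>x. norm (u' x) \<le> B" and s: "0 < s" "s < pi"
  shows "0 \<le> defect_energy u u' s" "defect_energy u u' s \<le> 2 * pi * (7 * B)\<^sup>2"
proof -
  have int: "(\<lambda>x. (norm (tangent_defect u u' s x))\<^sup>2) integrable_on {0..2 * pi}"
    by (intro integrable_continuous_real continuous_intros
        continuous_on_subset[OF continuous_tangent_defect2[OF u s]]) auto
  show "0 \<le> defect_energy u u' s"
    unfolding defect_energy_def by (rule integral_nonneg[OF int]) simp
  have "defect_energy u u' s \<le> integral {0..2 * pi} (\<lambda>x. (7 * B)\<^sup>2)"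
    unfolding defect_energy_def
    by (rule integral_le[OF int integrable_const_ivl])
       (rule power_mono[OF norm_tangent_defect_le[OF u B s] norm_ge_zero])
  then show "defect_energy u u' s \<le> 2 * pi * (7 * B)\<^sup>2" by simp
qed

text \<open>The defect is divided by \<open>sin s\<close>, so continuity is taken on the open
  interval; the uniform bound on the energy gives integrability up to both ends.\<close>

lemma absolutely_integrable_dmoment_energy:
  assumes u: "antiperiodic_C1 u u'"
  shows "(\<lambda>s. dmoment m s * defect_energy u u' s) absolutely_integrable_on {0<..<pi}"
proof -
  obtain B where B: "\<And>x. norm (u' x) \<le> B" using antiperiodic_C1_bounded[OF u] by metis
  show ?thesis
  proof (rule measurable_bounded_by_integrable_imp_absolutely_integrable)
    have "continuous_on {0<..<pi} (\<lambda>s. dmoment m s * defect_energy u u' s)"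
      by (intro continuous_intros continuous_defect_energy[OF u])
    then show "(\<lambda>s. dmoment m s * defect_energy u u' s) \<in> borel_measurable (lebesgue_on {0<..<pi})"
      by (rule continuous_imp_measurable_on_sets_lebesgue) auto
    have "(\<lambda>s. dmoment m s * (2 * pi * (7 * B)\<^sup>2)) integrable_on cbox 0 pi"
      by (intro integrable_continuous continuous_intros)
    then show "(\<lambda>s. dmoment m s * (2 * pi * (7 * B)\<^sup>2)) integrable_on {0<..<pi}"
      using integrable_on_open_interval[of _ 0 pi] by (metis box_real(1))
    show "norm (dmoment m s * defect_energy u u' s) \<le> dmoment m s * (2 * pi * (7 * B)\<^sup>2)" if "s \<in> {0<..<pi}" for s
      using that defect_energy_bounds[OF u B, of s] dmoment_nonneg[of s m]
      by (auto simp: abs_mult intro!: mult_left_mono)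
  qed auto
qed

section \<open>The two quadratic forms on trigonometric polynomials\<close>

lemma defect_energy_trig_poly:
  assumes "finite A"
  shows "defect_energy (trig_poly A c) (trig_poly A (\<lambda>k. \<i> * of_int k * c k)) s
      = 2 * pi * (\<Sum>k\<in>A. (norm (defect_multiplier k s))\<^sup>2 * (norm (c k))\<^sup>2)"
proof -
  have "defect_energy (trig_poly A c) (trig_poly A (\<lambda>k. \<i> * of_int k * c k)) s
      = 2 * pi * (\<Sum>k\<in>A. (norm (defect_multiplier k s * c k))\<^sup>2)"
    unfolding defect_energy_def tangent_defect_trig_poly
    by (rule integral_unique) (rule has_integral_norm_trig_poly[OF assms])
  then show ?thesis by (simp only: norm_mult power_mult_distrib)
qed

lemma wirtinger_form_trig_poly:
  assumes "finite A"
  shows "wirtinger_form (trig_poly A c) (trig_poly A (\<lambda>k. \<i> * of_int k * c k))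
      = 2 * pi * (\<Sum>k\<in>A. ((of_int k)\<^sup>2 - 1) * (norm (c k))\<^sup>2)"
proof -
  have "((\<lambda>x. (norm (trig_poly A (\<lambda>k. \<i> * of_int k * c k) x))\<^sup>2 - (norm (trig_poly A c x))\<^sup>2) has_integral
     2 * pi * (\<Sum>k\<in>A. (norm (\<i> * of_int k * c k))\<^sup>2) - 2 * pi * (\<Sum>k\<in>A. (norm (c k))\<^sup>2)) {0..2 * pi}"
    by (intro has_integral_diff has_integral_norm_trig_poly assms)
  also have "2 * pi * (\<Sum>k\<in>A. (norm (\<i> * of_int k * c k))\<^sup>2) - 2 * pi * (\<Sum>k\<in>A. (norm (c k))\<^sup>2)
      = 2 * pi * (\<Sum>k\<in>A. ((of_int k)\<^sup>2 - 1) * (norm (c k))\<^sup>2)"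
    by (simp add: norm_mult power_mult_distrib left_diff_distrib sum_subtractf right_diff_distrib)
  finally show ?thesis by (simp add: wirtinger_form_def integral_unique)
qed

lemma odd_int_cases:
  assumes "odd (k::int)"
  obtains n where "\<bar>k\<bar> = int (2 * n + 1)"
proof -
  have "odd (nat \<bar>k\<bar>)" using assms by (simp add: even_nat_iff)
  then obtain n where "nat \<bar>k\<bar> = 2 * n + 1" by (rule oddE)
  then have "\<bar>k\<bar> = int (2 * n + 1)" by linarith
  then show ?thesis by (rule that)
qed

lemma wirtinger_form_trig_poly_nonneg:
  assumes "finite A" "\<And>k. k \<in> A \<Longrightarrow> odd k"
  shows "0 \<le> wirtinger_form (trig_poly A c) (trig_poly A (\<lambda>k. \<i> * of_int k * c k))"
proof -
  have "1 \<le> (real_of_int k)\<^sup>2" if "k \<in> A" for k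
  proof -
    have "1 \<le> \<bar>k\<bar>" using assms(2)[OF that] by (cases "k = 0") auto
    then have "1\<^sup>2 \<le> \<bar>real_of_int k\<bar>\<^sup>2" by (intro power_mono) linarith+
    then show ?thesis by simp
  qed
  then show ?thesis
    unfolding wirtinger_form_trig_poly[OF assms(1)]
    by (intro mult_nonneg_nonneg sum_nonneg) auto
qed

text \<open>The sums for the multiplier and for k^2 - 1 are compared term by term in j. The interval
  is open because at 0 and pi the multiplier divides by \<open>sin s\<close> = 0 and the sum formula
  fails.\<close>

lemma integral_dmoment_multiplier_ge:
  assumes "1 \<le> m" "odd k"
  shows "(\<lambda>s. dmoment m s * (norm (defect_multiplier k s))\<^sup>2) integrable_on {0<..<pi}"
    and "(pi - 1/2) ^ m * ((of_int k)\<^sup>2 - 1)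
      \<le> integral {0<..<pi} (\<lambda>s. dmoment m s * (norm (defect_multiplier k s))\<^sup>2)"
proof -
  obtain n where n: "\<bar>k\<bar> = int (2 * n + 1)" using odd_int_cases[OF assms(2)] .
  let ?g = "\<lambda>j s. dmoment m s * (sin (real j * s))\<^sup>2"
  let ?f = "\<lambda>s. \<Sum>j=1..n. 16 * real j * ?g j s"
  have gi: "(\<lambda>s. 16 * real j * ?g j s) integrable_on {0..pi}" for j
    by (intro integrable_continuous_real continuous_intros)
  have eq: "dmoment m s * (norm (defect_multiplier k s))\<^sup>2 = ?f s" if "s \<in> {0<..<pi}" for s
  proof -
    have "sin s \<noteq> 0" using that sin_gt_zero[of s] by auto
    from norm_defect_multiplier_odd[OF this n] show ?thesis
      by (simp add: sum_distrib_left mult_ac)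
  qed
  have fi: "?f integrable_on {0..pi}"
    by (intro integrable_sum gi) auto
  then have "?f integrable_on {0<..<pi}"
    using integrable_on_open_interval[of ?f 0 pi] by (simp only: box_real cbox_interval)
  then show "(\<lambda>s. dmoment m s * (norm (defect_multiplier k s))\<^sup>2) integrable_on {0<..<pi}"
    using integrable_cong[of "{0<..<pi}", OF eq] by simp
  have sumj: "(\<Sum>j=1..n. real j) = real n * (real n + 1) / 2" by (induction n) (auto simp: field_simps)
  have "(real_of_int k)\<^sup>2 = (real_of_int \<bar>k\<bar>)\<^sup>2" by simp
  also have "\<dots> = (2 * real n + 1)\<^sup>2" unfolding n by simp
  finally have k2: "(real_of_int k)\<^sup>2 - 1 = (\<Sum>j=1..n. 8 * real j)"
    unfolding sum_distrib_left[symmetric] sumj by (simp add: power2_eq_square algebra_simps)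
  have "(pi - 1/2) ^ m * ((of_int k)\<^sup>2 - 1) = (\<Sum>j=1..n. 16 * real j * ((pi - 1/2) ^ m / 2))"
    unfolding k2 sum_distrib_left by (intro sum.cong refl) simp
  also have "\<dots> \<le> (\<Sum>j=1..n. 16 * real j * integral {0..pi} (?g j))"
    by (intro sum_mono mult_left_mono integral_dmoment_sin_ge assms) auto
  also have "\<dots> = integral {0..pi} ?f"
    by (subst Henstock_Kurzweil_Integration.integral_sum) (use gi in auto)
  also have "\<dots> = integral {0<..<pi} ?f"
    using integral_open_interval[of 0 pi ?f] by (simp only: box_real cbox_interval)
  also have "\<dots> = integral {0<..<pi} (\<lambda>s. dmoment m s * (norm (defect_multiplier k s))\<^sup>2)"
    by (rule Henstock_Kurzweil_Integration.integral_cong) (use eq in auto)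
  finally show "(pi - 1/2) ^ m * ((of_int k)\<^sup>2 - 1)
      \<le> integral {0<..<pi} (\<lambda>s. dmoment m s * (norm (defect_multiplier k s))\<^sup>2)" .
qed

lemma energy_trig_poly_ge:
  fixes c :: "int \<Rightarrow> complex"
  assumes m: "1 \<le> m" and A: "finite A" "\<And>k. k \<in> A \<Longrightarrow> odd k"
  defines "v \<equiv> trig_poly A c" and "v' \<equiv> trig_poly A (\<lambda>k. \<i> * of_int k * c k)"
  shows "(pi - 1/2) ^ m * wirtinger_form v v' \<le> integral {0<..<pi} (\<lambda>s. dmoment m s * defect_energy v v' s)"
proof -
  let ?g = "\<lambda>k s. dmoment m s * (norm (defect_multiplier k s))\<^sup>2"
  have gi: "(\<lambda>s. 2 * pi * (norm (c k))\<^sup>2 * ?g k s) integrable_on {0<..<pi}" if "k \<in> A" for k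
    using integral_dmoment_multiplier_ge(1)[OF m A(2)[OF that]] by (rule integrable_on_mult_right)
  have "(pi - 1/2) ^ m * wirtinger_form v v'
      = (\<Sum>k\<in>A. 2 * pi * (norm (c k))\<^sup>2 * ((pi - 1/2) ^ m * ((of_int k)\<^sup>2 - 1)))"
    unfolding v_def v'_def wirtinger_form_trig_poly[OF A(1)] sum_distrib_left
    by (intro sum.cong refl) (simp add: mult_ac)
  also have "\<dots> \<le> (\<Sum>k\<in>A. 2 * pi * (norm (c k))\<^sup>2 * integral {0<..<pi} (?g k))"
    by (intro sum_mono mult_left_mono integral_dmoment_multiplier_ge(2) m A) auto
  also have "\<dots> = integral {0<..<pi} (\<lambda>s. \<Sum>k\<in>A. 2 * pi * (norm (c k))\<^sup>2 * ?g k s)"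
    by (subst Henstock_Kurzweil_Integration.integral_sum) (use gi A in auto)
  also have "(\<lambda>s. \<Sum>k\<in>A. 2 * pi * (norm (c k))\<^sup>2 * ?g k s) = (\<lambda>s. dmoment m s * defect_energy v v' s)"
    unfolding v_def v'_def defect_energy_trig_poly[OF A(1)] sum_distrib_left
    by (intro ext sum.cong refl) (simp add: mult_ac)
  finally show ?thesis .
qed

section \<open>Passage from trigonometric polynomials to continuously differentiable
  functions\<close>

lemma norm_power2_perturb:
  fixes a b :: "'a::real_normed_vector"
  assumes "norm (a - b) \<le> d" "norm b \<le> M" "d \<le> 1"
  shows "(norm a)\<^sup>2 \<le> (norm b)\<^sup>2 + (2 * M + 1) * d"
proof -
  have d: "0 \<le> d" using order_trans[OF norm_ge_zero assms(1)] .
  have "norm a \<le> norm b + d" using norm_triangle_sub[of a b] assms(1) by linarith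
  then have "(norm a)\<^sup>2 \<le> (norm b + d)\<^sup>2" by (rule power_mono) simp
  also have "\<dots> = (norm b)\<^sup>2 + 2 * norm b * d + d * d" by (simp add: power2_eq_square algebra_simps)
  also have "\<dots> \<le> (norm b)\<^sup>2 + 2 * M * d + 1 * d"
    using assms d by (intro add_mono mult_right_mono mult_left_mono) auto
  finally show ?thesis by (simp add: algebra_simps)
qed

lemma le_of_le_add_mult:
  fixes x y K :: real
  assumes "\<And>e. 0 < e \<Longrightarrow> e \<le> 1 \<Longrightarrow> x \<le> y + K * e"
  shows "x \<le> y"
proof (rule ccontr)
  assume "\<not> x \<le> y"
  define e where "e = min 1 ((x - y) / (2 * (\<bar>K\<bar> + 1)))"
  have "0 < e" "e \<le> 1" using \<open>\<not> x \<le> y\<close> by (auto simp: e_def)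
  then have "x \<le> y + K * e" by (rule assms)
  also have "K * e \<le> (\<bar>K\<bar> + 1) * e" using \<open>0 < e\<close> by (intro mult_right_mono) auto
  also have "(\<bar>K\<bar> + 1) * e \<le> (\<bar>K\<bar> + 1) * ((x - y) / (2 * (\<bar>K\<bar> + 1)))"
    by (intro mult_left_mono) (auto simp: e_def)
  also have "\<dots> = (x - y) / 2" by (simp add: field_simps)
  finally have "x \<le> y + (x - y) / 2" by simp
  then show False using \<open>\<not> x \<le> y\<close> by (simp add: field_simps)
qed

text \<open>Because of the minus sign the two squares are compared in opposite directions; this is
  why the bounds \<open>M\<close> concern \<open>a\<close> and \<open>b'\<close>.\<close>

lemma wirtinger_form_perturb:
  fixes a b :: "real \<Rightarrow> 'a::real_normed_vector"
  assumes cont: "continuous_on UNIV a" "continuous_on UNIV a'" "continuous_on UNIV b" "continuous_on UNIV b'"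
    and close: "\<And>x. norm (a x - b x) \<le> d" "\<And>x. norm (a' x - b' x) \<le> d"
    and bound: "\<And>x. norm (a x) \<le> M" "\<And>x. norm (b' x) \<le> M" and "d \<le> 1"
  shows "wirtinger_form a a' \<le> wirtinger_form b b' + 4 * pi * (2 * M + 1) * d"
proof -
  have c: "continuous_on {0..2*pi} a" "continuous_on {0..2*pi} a'"
    "continuous_on {0..2*pi} b" "continuous_on {0..2*pi} b'"
    using cont by (meson continuous_on_subset subset_UNIV)+
  have i: "(\<lambda>x. (norm (a' x))\<^sup>2 - (norm (a x))\<^sup>2) integrable_on {0..2*pi}"
    "(\<lambda>x. (norm (b' x))\<^sup>2 - (norm (b x))\<^sup>2) integrable_on {0..2*pi}"
    by (intro integrable_continuous_real continuous_intros c)+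
  have "wirtinger_form a a' \<le> integral {0..2*pi} (\<lambda>x. ((norm (b' x))\<^sup>2 - (norm (b x))\<^sup>2) + 2 * (2 * M + 1) * d)"
    unfolding wirtinger_form_def
  proof (rule integral_le[OF i(1) integrable_add[OF i(2) integrable_const_ivl]])
    fix x
    have "(norm (a' x))\<^sup>2 \<le> (norm (b' x))\<^sup>2 + (2 * M + 1) * d"
      by (rule norm_power2_perturb) (use close bound \<open>d \<le> 1\<close> in auto)
    moreover have "(norm (b x))\<^sup>2 \<le> (norm (a x))\<^sup>2 + (2 * M + 1) * d"
      by (rule norm_power2_perturb) (use close bound \<open>d \<le> 1\<close> in \<open>auto simp: norm_minus_commute\<close>)
    ultimately show "(norm (a' x))\<^sup>2 - (norm (a x))\<^sup>2
        \<le> ((norm (b' x))\<^sup>2 - (norm (b x))\<^sup>2) + 2 * (2 * M + 1) * d"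
      by (simp only: mult.assoc)
  qed
  also have "\<dots> = wirtinger_form b b' + 4 * pi * (2 * M + 1) * d"
    unfolding wirtinger_form_def
    by (subst Henstock_Kurzweil_Integration.integral_add[OF i(2) integrable_const_ivl]) simp
  finally show ?thesis .
qed

text \<open>The defect is linear, so the difference of two defects is the defect of the difference
  and is at most 7 e.\<close>

lemma defect_energy_perturb:
  assumes u: "antiperiodic_C1 u u'" and v: "antiperiodic_C1 v v'" and B: "\<And>x. norm (u' x) \<le> B"
    and close: "\<And>x. norm (v' x - u' x) \<le> e" and e: "7 * e \<le> 1" and s: "0 < s" "s < pi"
  shows "defect_energy v v' s \<le> defect_energy u u' s + 2 * pi * (2 * (7 * B) + 1) * (7 * e)"
proof -
  have int: "(\<lambda>x. (norm (tangent_defect w w' s x))\<^sup>2) integrable_on {0..2 * pi}"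
    if "antiperiodic_C1 w w'" for w w' :: "real \<Rightarrow> 'a"
    by (intro integrable_continuous_real continuous_intros
        continuous_on_subset[OF continuous_tangent_defect2[OF that s]]) auto
  have "defect_energy v v' s \<le> integral {0..2 * pi}
      (\<lambda>x. (norm (tangent_defect u u' s x))\<^sup>2 + (2 * (7 * B) + 1) * (7 * e))"
    unfolding defect_energy_def
  proof (rule integral_le[OF int[OF v] integrable_add[OF int[OF u] integrable_const_ivl]])
    fix x
    have "norm (tangent_defect v v' s x - tangent_defect u u' s x) \<le> 7 * e"
      unfolding tangent_defect_diff[symmetric]
      by (rule norm_tangent_defect_le[OF antiperiodic_C1_diff[OF v u] close s])
    then show "(norm (tangent_defect v v' s x))\<^sup>2
        \<le> (norm (tangent_defect u u' s x))\<^sup>2 + (2 * (7 * B) + 1) * (7 * e)"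
      by (rule norm_power2_perturb[OF _ norm_tangent_defect_le[OF u B s] e])
  qed
  also have "\<dots> = defect_energy u u' s + 2 * pi * (2 * (7 * B) + 1) * (7 * e)"
    unfolding defect_energy_def
    by (subst Henstock_Kurzweil_Integration.integral_add[OF int[OF u] integrable_const_ivl]) simp
  finally show ?thesis .
qed

theorem energy_ge_wirtinger_form:
  fixes u u' :: "real \<Rightarrow> real"
  assumes u: "antiperiodic_C1 u u'" and m: "1 \<le> m"
  shows "0 \<le> wirtinger_form u u'"
    and "(pi - 1/2) ^ m * wirtinger_form u u' \<le> integral {0<..<pi} (\<lambda>s. dmoment m s * defect_energy u u' s)"
proof -
  define U where "U x = complex_of_real (u x)" for x
  define U' where "U' x = complex_of_real (u' x)" for x
  have U: "antiperiodic_C1 U U'" unfolding U_def U'_def by (rule antiperiodic_C1_of_real[OF u])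
  have eqW: "wirtinger_form U U' = wirtinger_form u u'"
    by (simp add: wirtinger_form_def U_def U'_def)
  have eqD: "defect_energy U U' s = defect_energy u u' s" for s
    unfolding defect_energy_def U_def U'_def tangent_defect_of_real by simp
  obtain B where B: "B > 0" "\<And>x. norm (U' x) \<le> B" using antiperiodic_C1_bounded[OF U] by metis
  let ?E = "\<lambda>v v'. integral {0<..<pi} (\<lambda>s. dmoment m s * defect_energy v v' s)"
  let ?c = "(pi - 1/2) ^ m"
  \<comment> \<open>A common bound for \<open>U\<close>, \<open>U'\<close> and for the
    approximations, which stay within 2 e of \<open>U\<close> and within e of
    \<open>U'\<close>.\<close>
  define M where "M = 2 * B + 2"
  define K1 where "K1 = 4 * pi * (2 * M + 1) * 2"
  define C where "C = 2 * pi * (2 * (7 * B) + 1) * 7"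
  define K2 where "K2 = integral {0<..<pi} (\<lambda>s. dmoment m s * C)"
  have c0: "0 \<le> ?c" using pi_gt3 by simp
  \<comment> \<open>The restriction to e \<le> 1/7 meets the condition 7 e \<le> 1 of
    \<open>defect_energy_perturb\<close>; the factors \<open>K1\<close> and \<open>K2\<close> do not
    depend on e, so e can tend to 0.\<close>
  have *: "0 \<le> wirtinger_form U U' + K1 * e" "?c * wirtinger_form U U' \<le> ?E U U' + (K2 + ?c * K1) * e"
    if e: "0 < e" "e \<le> 1/7" for e
  proof -
    obtain A d where A: "finite A" "\<And>k. k \<in> A \<Longrightarrow> odd k"
      and d: "\<And>x. norm (U' x - trig_poly A (\<lambda>k. \<i> * of_int k * d k) x) \<le> e"
      using antiperiodic_trig_poly_dense[OF u e(1)] unfolding U'_def by metis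
    define v where "v = trig_poly A d"
    define v' where "v' = trig_poly A (\<lambda>k. \<i> * of_int k * d k)"
    have v: "antiperiodic_C1 v v'" unfolding v_def v'_def by (rule antiperiodic_C1_trig_poly[OF A])
    have UV': "norm (U' x - v' x) \<le> e" for x using d by (simp add: v'_def)
    have UV0: "norm (U x - v x) \<le> 2 * e" for x
      by (rule antiperiodic_C1_norm_le[OF antiperiodic_C1_diff[OF U v] UV'])
    have UV1: "norm (U' x - v' x) \<le> 2 * e" for x using UV'[of x] e by linarith
    have b1: "norm (U x) \<le> M" for x
      using antiperiodic_C1_norm_le[OF U B(2), of x] by (simp add: M_def)
    have b2: "norm (U' x) \<le> M" for x using B(2)[of x] B(1) by (simp add: M_def)
    have b3: "norm (v' x) \<le> M" for x
      using norm_triangle_sub[of "v' x" "U' x"] UV'[of x] B(2)[of x] B(1) e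
      by (simp add: norm_minus_commute M_def)
    have b4: "norm (v x) \<le> M" for x
      using norm_triangle_sub[of "v x" "U x"] UV0[of x] antiperiodic_C1_norm_le[OF U B(2), of x] e
      by (simp add: norm_minus_commute M_def)
    have cont: "continuous_on UNIV U" "continuous_on UNIV U'" "continuous_on UNIV v" "continuous_on UNIV v'"
      using U v antiperiodic_C1_continuous[OF U] antiperiodic_C1_continuous[OF v]
      unfolding antiperiodic_C1_def by auto
    have W1: "wirtinger_form v v' \<le> wirtinger_form U U' + K1 * e"
      using wirtinger_form_perturb[OF cont(3,4,1,2), of "2 * e" M] UV0 UV1 b4 b2 e
      by (simp add: norm_minus_commute K1_def mult_ac)
    have W2: "wirtinger_form U U' \<le> wirtinger_form v v' + K1 * e"
      using wirtinger_form_perturb[OF cont, of "2 * e" M] UV0 UV1 b1 b3 e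
      by (simp add: K1_def mult_ac)
    have i: "(\<lambda>s. dmoment m s * defect_energy w w' s) integrable_on {0<..<pi}"
      if "antiperiodic_C1 w w'" for w w' :: "real \<Rightarrow> complex"
      using absolutely_integrable_dmoment_energy[OF that] by (rule set_lebesgue_integral_eq_integral(1))
    have iC: "(\<lambda>s. dmoment m s * C * e) integrable_on {0<..<pi}" for C
    proof -
      have "(\<lambda>s. dmoment m s * C * e) integrable_on cbox 0 pi"
        by (intro integrable_continuous continuous_intros)
      then show ?thesis
        using integrable_on_open_interval[of _ 0 pi] by (metis box_real(1))
    qed
    have "?E v v' \<le> integral {0<..<pi} (\<lambda>s. dmoment m s * defect_energy U U' s + dmoment m s * C * e)"
    proof (rule integral_le[OF i[OF v] integrable_add[OF i[OF U] iC]])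
      fix s assume s: "s \<in> {0<..<pi}"
      have "defect_energy v v' s \<le> defect_energy U U' s + C * e"
        using defect_energy_perturb[OF U v B(2), of e s] UV' e s
        by (simp add: norm_minus_commute C_def mult_ac)
      then have "dmoment m s * defect_energy v v' s \<le> dmoment m s * (defect_energy U U' s + C * e)"
        by (rule mult_left_mono) (use s dmoment_nonneg in auto)
      then show "dmoment m s * defect_energy v v' s \<le> dmoment m s * defect_energy U U' s + dmoment m s * C * e"
        by (simp add: algebra_simps)
    qed
    also have "\<dots> = ?E U U' + K2 * e"
      unfolding K2_def
      by (subst Henstock_Kurzweil_Integration.integral_add[OF i[OF U] iC])
         (simp only: Henstock_Kurzweil_Integration.integral_mult_left)
    finally have E: "?E v v' \<le> ?E U U' + K2 * e" .
    have "0 \<le> wirtinger_form v v'" unfolding v_def v'_def by (rule wirtinger_form_trig_poly_nonneg[OF A])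
    with W1 show "0 \<le> wirtinger_form U U' + K1 * e" by linarith
    have "?c * wirtinger_form v v' \<le> ?E v v'"
      unfolding v_def v'_def by (rule energy_trig_poly_ge[OF m A])
    moreover have "?c * wirtinger_form U U' \<le> ?c * (wirtinger_form v v' + K1 * e)"
      using W2 c0 by (rule mult_left_mono)
    ultimately show "?c * wirtinger_form U U' \<le> ?E U U' + (K2 + ?c * K1) * e"
      using E by (simp add: algebra_simps)
  qed
  have "0 \<le> wirtinger_form U U'"
    by (rule le_of_le_add_mult[of _ _ "K1 / 7"]) (use *(1)[of "e / 7" for e] in simp)
  then show "0 \<le> wirtinger_form u u'" by (simp add: eqW)
  have "?c * wirtinger_form U U' \<le> ?E U U'"
    by (rule le_of_le_add_mult[of _ _ "(K2 + ?c * K1) / 7"]) (use *(2)[of "e / 7" for e] in simp)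
  then show "?c * wirtinger_form u u' \<le> ?E u u'" by (simp add: eqW eqD)
qed

section \<open>Integration in the plane\<close>

lemma inner_vec2: "(x::real^2) \<bullet> y = x$1 * y$1 + x$2 * y$2"
  by (simp add: inner_vec_def sum_2)

lemma vector2_measurable [measurable]:
  "(\<lambda>z. vector [fst z, snd z] :: real^2) \<in> borel_measurable (borel \<Otimes>\<^sub>M borel)"
proof -
  have "continuous_on UNIV (\<lambda>z::real\<times>real. vector [fst z, snd z] :: real^2)"
    by (rule continuous_on_componentwise[THEN iffD2])
       (auto simp: Basis_vec_def inner_axis axis_eq_axis forall_2 intro!: continuous_intros)
  then show ?thesis
    by (simp add: borel_measurable_continuous_onI borel_prod)
qed

text \<open>Boxes determine Lebesgue measure. The product form lets Tonelli's theorem act on the two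
  tangent coordinates.\<close>

lemma lborel_vec2: "(lborel :: (real^2) measure) = distr (lborel \<Otimes>\<^sub>M lborel) borel (\<lambda>z. vector [fst z, snd z])"
proof (rule lborel_eqI)
  fix l u :: "real^2"
  assume lu: "\<And>b. b \<in> Basis \<Longrightarrow> l \<bullet> b \<le> u \<bullet> b"
  have le: "l $ i \<le> u $ i" for i
    using lu[of "axis i 1"] by (simp add: inner_axis axis_in_Basis_iff)
  have pre: "(\<lambda>z. vector [fst z, snd z]) -` box l u \<inter> space (lborel \<Otimes>\<^sub>M lborel)
      = {l$1<..<u$1} \<times> {l$2<..<u$2}"
    by (auto simp: mem_box_cart forall_2 space_pair_measure)
  have B: "(Basis :: (real^2) set) = (\<lambda>i. axis i 1) ` UNIV"
    by (auto simp: Basis_vec_def)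
  have inj: "inj (\<lambda>i::2. axis i (1::real))"
    by (auto simp: inj_on_def axis_eq_axis)
  have "(\<Prod>b\<in>Basis. (u - l) \<bullet> b) = (u$1 - l$1) * (u$2 - l$2)"
    unfolding B prod.reindex[OF inj] by (simp add: inner_axis UNIV_2)
  moreover have "emeasure (distr (lborel \<Otimes>\<^sub>M lborel) borel (\<lambda>z. vector [fst z, snd z])) (box l u)
      = ennreal (u$1 - l$1) * ennreal (u$2 - l$2)"
    using le by (subst emeasure_distr) (auto simp: pre lborel.emeasure_pair_measure_Times)
  ultimately show "emeasure (distr (lborel \<Otimes>\<^sub>M lborel) borel (\<lambda>z. vector [fst z, snd z])) (box l u)
      = ennreal (\<Prod>b\<in>Basis. (u - l) \<bullet> b)"
    using le by (simp add: ennreal_mult)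
qed simp

lemma nn_integral_vec2:
  fixes h :: "real^2 \<Rightarrow> ennreal"
  assumes [measurable]: "h \<in> borel_measurable borel"
  shows "(\<integral>\<^sup>+ x. h x \<partial>lborel) = (\<integral>\<^sup>+ a. \<integral>\<^sup>+ b. h (vector [a, b]) \<partial>lborel \<partial>lborel)"
proof -
  have "(\<integral>\<^sup>+ x. h x \<partial>lborel) = (\<integral>\<^sup>+ z. h (vector [fst z, snd z]) \<partial>(lborel \<Otimes>\<^sub>M lborel))"
    by (subst lborel_vec2) (simp add: nn_integral_distr)
  also have "\<dots> = (\<integral>\<^sup>+ a. \<integral>\<^sup>+ b. h (vector [a, b]) \<partial>lborel \<partial>lborel)"
    by (subst lborel.nn_integral_fst[symmetric]) (simp_all)
  finally show ?thesis .
qed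

text \<open>Goes through \<open>real^1\<close>, because the underlying theorem is about functions
  with values in \<open>real^n\<close>. Integrability of \<open>f\<close> on the image is a
  conclusion here.\<close>

lemma integrable_change_of_variables_real:
  fixes f :: "real^'m::{finite,wellorder} \<Rightarrow> real" and g :: "real^'m::_ \<Rightarrow> real^'m::_"
  assumes S: "S \<in> sets lebesgue"
    and der_g: "\<And>x. x \<in> S \<Longrightarrow> (g has_derivative g' x) (at x within S)"
    and inj: "inj_on g S"
    and int: "(\<lambda>x. \<bar>det (matrix (g' x))\<bar> * f (g x)) absolutely_integrable_on S"
  shows "f absolutely_integrable_on g ` S"
    and "integral (g ` S) f = integral S (\<lambda>x. \<bar>det (matrix (g' x))\<bar> * f (g x))"
proof -
  let ?v = "vec :: real \<Rightarrow> real^1"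
  let ?D = "\<lambda>x. \<bar>det (matrix (g' x))\<bar> *\<^sub>R ?v (f (g x))"
  have "?D absolutely_integrable_on S"
    using int by (simp add: absolutely_integrable_on_1_iff)
  then have *: "(\<lambda>x. ?v (f x)) absolutely_integrable_on g ` S \<and>
      integral (g ` S) (\<lambda>x. ?v (f x)) = integral S ?D"
    using has_absolute_integral_change_of_variables[OF S der_g inj, of "\<lambda>x. ?v (f x)" "integral S ?D"] by simp
  then show "f absolutely_integrable_on g ` S" by (simp add: absolutely_integrable_on_1_iff)
  from * have "integral (g ` S) (\<lambda>x. ?v (f x)) $ 1 = integral S ?D $ 1" by simp
  then show "integral (g ` S) f = integral S (\<lambda>x. \<bar>det (matrix (g' x))\<bar> * f (g x))"
    by (simp add: integral_on_1_eq)
qed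

lemma nn_integral_linear:
  assumes "0 \<le> c"
  shows "(\<integral>\<^sup>+ t. ennreal t * indicator {0<..<c} t \<partial>lborel) = ennreal (c\<^sup>2 / 2)"
proof -
  have "(\<integral>\<^sup>+ t. ennreal t * indicator {0<..<c} t \<partial>lborel) = (\<integral>\<^sup>+ t. ennreal t * indicator {0..c} t \<partial>lborel)"
    by (rule nn_integral_cong_AE, rule AE_mp[OF AE_lborel_singleton[of c]])
       (auto split: split_indicator simp: ennreal_eq_0_iff)
  also have "\<dots> = ennreal (c\<^sup>2 / 2 - 0\<^sup>2 / 2)"
    by (rule nn_integral_FTC_Icc) (use assms in \<open>auto intro!: derivative_eq_intros\<close>)
  finally show ?thesis by simp
qed

section \<open>Tangent lines and the visual angle\<close>

definition normal_dir :: "real \<Rightarrow> real^2" where "normal_dir x = vector [cos x, sin x]"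
definition tangent_dir :: "real \<Rightarrow> real^2" where "tangent_dir x = vector [- sin x, cos x]"

lemma normal_dir_nth [simp]: "normal_dir x $ 1 = cos x" "normal_dir x $ 2 = sin x"
  by (simp_all add: normal_dir_def)

lemma tangent_dir_nth [simp]: "tangent_dir x $ 1 = - sin x" "tangent_dir x $ 2 = cos x"
  by (simp_all add: tangent_dir_def)

lemma inner_dirs:
  "normal_dir x \<bullet> normal_dir y = cos (y - x)" "tangent_dir x \<bullet> tangent_dir y = cos (y - x)"
  "tangent_dir x \<bullet> normal_dir y = sin (y - x)" "normal_dir x \<bullet> tangent_dir y = - sin (y - x)"
  by (simp_all add: inner_vec2 cos_diff sin_diff algebra_simps)

lemma norm_dirs [simp]: "norm (normal_dir x) = 1" "norm (tangent_dir x) = 1"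
  by (simp_all add: norm_eq_sqrt_inner inner_dirs)

lemma dir_decomp: "v = (v \<bullet> normal_dir x) *\<^sub>R normal_dir x + (v \<bullet> tangent_dir x) *\<^sub>R tangent_dir x"
proof -
  have 1: "v$1 * (cos x * cos x) + v$1 * (sin x * sin x) = v$1"
    "v$2 * (cos x * cos x) + v$2 * (sin x * sin x) = v$2"
    by (simp_all flip: distrib_left power2_eq_square)
  show ?thesis
    using 1 by (simp add: vec_eq_iff forall_2 inner_vec2 algebra_simps)
qed

lemma dir_eqI: "v \<bullet> normal_dir x = w \<bullet> normal_dir x \<Longrightarrow> v \<bullet> tangent_dir x = w \<bullet> tangent_dir x \<Longrightarrow> v = w"
  by (metis dir_decomp)

lemma unit_vec2_normal_dir:
  assumes "norm (v :: real^2) = 1"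
  obtains x where "v = normal_dir x" "0 \<le> x" "x < 2 * pi"
proof -
  have "(v$1)\<^sup>2 + (v$2)\<^sup>2 = 1"
    using assms by (simp add: norm_eq_sqrt_inner inner_vec2 power2_eq_square)
  then obtain x where "0 \<le> x" "x < 2 * pi" "v$1 = cos x" "v$2 = sin x"
    by (rule sincos_total_2pi)
  then show ?thesis by (intro that[of x]) (auto simp: vec_eq_iff forall_2)
qed

lemma normal_dir_shift: "normal_dir (x + pi) = - normal_dir x" "tangent_dir (x + pi) = - tangent_dir x"
  by (simp_all add: vec_eq_iff forall_2)

lemma tangent_dir_eq: "normal_dir x = normal_dir y \<Longrightarrow> tangent_dir x = tangent_dir y"
  by (simp add: vec_eq_iff forall_2)

lemma normal_dir_inj:
  assumes "normal_dir x = normal_dir y" "0 \<le> x" "x < 2 * pi" "0 \<le> y" "y < 2 * pi"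
  shows "x = y"
proof -
  have "sin x = sin y \<and> cos x = cos y" using assms(1) by (simp add: vec_eq_iff forall_2)
  then obtain n where n: "x = y + 2 * pi * of_int n" using sin_cos_eq_iff[of x y] by auto
  have "2 * pi * real_of_int n < 2 * pi * 1" "2 * pi * (- 1) < 2 * pi * real_of_int n"
    using n assms(2-5) by linarith+
  then have "real_of_int n < 1" "- 1 < real_of_int n"
    by (simp_all only: mult_less_cancel_left_pos pi_gt_zero mult_pos_pos zero_less_numeral)
  then have "n < 1" "- 1 < n" by simp_all
  then have "n = 0" by simp
  then show ?thesis using n by simp
qed

lemma has_vector_derivative_dirs:
  "(normal_dir has_vector_derivative tangent_dir x) (at x within A)"
  "(tangent_dir has_vector_derivative - normal_dir x) (at x within A)"
proof -
  have N: "normal_dir = (\<lambda>x. cos x *\<^sub>R axis 1 1 + sin x *\<^sub>R axis 2 1)"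
    and T: "tangent_dir = (\<lambda>x. (- sin x) *\<^sub>R axis 1 1 + cos x *\<^sub>R axis 2 1)"
    by (auto simp: fun_eq_iff vec_eq_iff forall_2 axis_def)
  show "(normal_dir has_vector_derivative tangent_dir x) (at x within A)"
    "(tangent_dir has_vector_derivative - normal_dir x) (at x within A)"
    unfolding N T by (auto intro!: derivative_eq_intros)
qed

text \<open>Take the first point with f \<le> 0: f is positive to its left, so the derivative there
  cannot be positive. The sign of the derivative later decides on which side of a contact point a
  tangent line is met.\<close>

lemma downcrossing:
  fixes f :: "real \<Rightarrow> real"
  assumes "a < b" "f a > 0" "f b < 0" and d: "\<And>x. (f has_real_derivative f' x) (at x)"
  obtains c where "a < c" "c < b" "f c = 0" "f' c \<le> 0"
proof -
  have cont: "continuous_on A f" for A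
    using d by (meson DERIV_isCont continuous_at_imp_continuous_on)
  let ?S = "{x \<in> {a..b}. f x \<le> 0}"
  have "closed ({a..b} \<inter> f -` {..0})"
    by (rule continuous_closed_preimage[OF cont]) auto
  moreover have "{a..b} \<inter> f -` {..0} = ?S" by auto
  moreover have "bounded ?S" by (rule bounded_subset[of "{a..b}"]) auto
  ultimately have "compact ?S" by (simp add: compact_eq_bounded_closed)
  moreover have "?S \<noteq> {}" using assms by (auto intro: exI[of _ b])
  ultimately obtain c where c: "c \<in> ?S" "\<And>x. x \<in> ?S \<Longrightarrow> c \<le> x"
    using compact_attains_inf[of ?S] by metis
  have ac: "a < c" using c(1) assms(2) by (cases "a = c") auto
  have pos: "f x > 0" if "a \<le> x" "x < c" for x
    using c(2)[of x] c(1) that by force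
  have c0: "f c = 0"
  proof (rule ccontr)
    assume "f c \<noteq> 0"
    with c(1) have "f c < 0" by auto
    then obtain x where "a \<le> x" "x \<le> c" "f x = 0"
      using IVT2'[of f c 0 a] assms(2) ac cont[of "{a..c}"] by auto
    with pos[of x] \<open>f c < 0\<close> show False by (cases "x = c") auto
  qed
  have "f' c \<le> 0"
  proof (rule ccontr)
    assume "\<not> f' c \<le> 0"
    then obtain e where e: "e > 0" "\<And>h. 0 < h \<Longrightarrow> h < e \<Longrightarrow> f (c - h) < f c"
      using DERIV_pos_inc_left[OF d[of c]] by auto
    define h where "h = min (e / 2) (c - a)"
    have "0 < h" "h < e" "a \<le> c - h" "c - h < c" using e(1) ac by (auto simp: h_def)
    then show False using e(2)[of h] pos[of "c - h"] c0 by auto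
  qed
  moreover have "c < b" using c(1) c0 assms(3) by (cases "c = b") auto
  ultimately show ?thesis using that ac c0 by blast
qed

lemma support_fun_eq: "support_fun K x = (SUP Y\<in>K. Y \<bullet> normal_dir x)"
  by (simp add: support_fun_def inner_vec2)

lemma inner_le_support_fun:
  assumes "compact K" "Y \<in> K"
  shows "Y \<bullet> normal_dir x \<le> support_fun K x"
  unfolding support_fun_eq
  by (intro cSUP_upper bounded_imp_bdd_above compact_imp_bounded compact_continuous_image assms continuous_intros)

text \<open>Differentiability of \<open>p\<close> makes every support line touch \<open>K\<close> in
  a single point. \<open>w_pos\<close> excludes a one-point body and keeps opposite support lines
  apart.\<close>

locale support_body =
  fixes K :: "(real^2) set" and p p' :: "real \<Rightarrow> real" and w :: real
  assumes compact_K: "compact K" and convex_K: "convex K" and nonempty: "K \<noteq> {}"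
    and p_def: "p = support_fun K"
    and dp: "\<And>x. (p has_real_derivative p' x) (at x)"
    and width: "\<And>x. p x + p (x + pi) = w"
    and w_pos: "w > 0"
begin

text \<open>The envelope of the support lines: p N + p' N', with N =
  \<open>normal_dir\<close>.\<close>

definition contact :: "real \<Rightarrow> real^2" where
  "contact x = p x *\<^sub>R normal_dir x + p' x *\<^sub>R tangent_dir x"

lemma contact_inner: "contact x \<bullet> normal_dir y = p x * cos (y - x) + p' x * sin (y - x)"
  "contact x \<bullet> tangent_dir x = p' x"
  by (simp_all add: contact_def inner_add_left inner_dirs)

lemma p_eq: "p x = (SUP Y\<in>K. Y \<bullet> normal_dir x)"
  unfolding p_def by (rule support_fun_eq)

lemma inner_le_p: "Y \<in> K \<Longrightarrow> Y \<bullet> normal_dir x \<le> p x"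
  unfolding p_def by (rule inner_le_support_fun[OF compact_K])

lemma p_attained: "\<exists>Y\<in>K. Y \<bullet> normal_dir x = p x"
proof -
  obtain Y where Y: "Y \<in> K" "\<And>Z. Z \<in> K \<Longrightarrow> Z \<bullet> normal_dir x \<le> Y \<bullet> normal_dir x"
  proof -
    have "continuous_on K (\<lambda>Y. Y \<bullet> normal_dir x)" by (intro continuous_intros)
    from continuous_attains_sup[OF compact_K nonempty this] show ?thesis using that by auto
  qed
  have "p x \<le> Y \<bullet> normal_dir x" unfolding p_eq using Y(2) by (intro cSUP_least nonempty)
  with inner_le_p[OF Y(1), of x] Y(1) show ?thesis by (intro bexI[of _ Y]) auto
qed

text \<open>The gap between \<open>p\<close> and the support value of the single point Y is
  nonnegative and 0 at \<open>x\<close>, hence minimal there; its vanishing derivative fixes the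
  tangential component of Y.\<close>

lemma contact_unique:
  assumes Y: "Y \<in> K" "Y \<bullet> normal_dir x = p x"
  shows "Y = contact x"
proof -
  let ?f = "\<lambda>y. p y - Y \<bullet> normal_dir y"
  have "(?f has_real_derivative p' x - Y \<bullet> tangent_dir x) (at x)"
    unfolding inner_vec2 by (auto intro!: derivative_eq_intros dp)
  then have "p' x - Y \<bullet> tangent_dir x = 0"
    by (rule DERIV_local_min[of _ _ _ 1]) (use inner_le_p[OF Y(1)] Y(2) in auto)
  then show ?thesis
    by (intro dir_eqI[of _ x]) (auto simp: contact_inner Y(2))
qed

lemma contact_in: "contact x \<in> K"
  using p_attained[of x] contact_unique by metis

lemma p_periodic: "p (x + 2 * pi) = p x"
  using width[of x] width[of "x + pi"] by (simp add: add.assoc)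

lemma dp_at: "((\<lambda>z. p (x + z)) has_real_derivative p' (x + z)) (at z)"
proof -
  have "((\<lambda>z. x + z) has_real_derivative 1) (at z)" by (auto intro!: derivative_eq_intros)
  from DERIV_chain'[OF this dp[of "x + z"]] show ?thesis by simp
qed

lemma p'_periodic: "p' (x + 2 * pi) = p' x"
proof -
  have "((\<lambda>z. p (2 * pi + z)) has_real_derivative p' (2 * pi + x)) (at x)" by (rule dp_at)
  moreover have "(\<lambda>z. p (2 * pi + z)) = p" using p_periodic by (auto simp: add.commute)
  ultimately show ?thesis using DERIV_unique[OF _ dp[of x]] by (simp add: add.commute)
qed

lemma outside_iff: "P \<notin> K \<longleftrightarrow> (\<exists>x. p x < P \<bullet> normal_dir x)"
proof
  assume "P \<notin> K"
  then obtain a b where ab: "a \<bullet> P < b" "\<And>Y. Y \<in> K \<Longrightarrow> b < a \<bullet> Y"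
    using separating_hyperplane_closed_point[OF convex_K compact_imp_closed[OF compact_K]] by metis
  have "a \<noteq> 0" using ab nonempty by auto
  then have "norm (- a /\<^sub>R norm a) = 1" by simp
  then obtain x where x: "- a /\<^sub>R norm a = normal_dir x" using unit_vec2_normal_dir by metis
  obtain Y where Y: "Y \<in> K" "Y \<bullet> normal_dir x = p x" using p_attained by metis
  have "a \<bullet> P < a \<bullet> Y" using ab Y(1) by force
  then have "- (a \<bullet> Y) / norm a < - (a \<bullet> P) / norm a"
    using \<open>a \<noteq> 0\<close> by (simp add: divide_strict_right_mono)
  then have "Y \<bullet> normal_dir x < P \<bullet> normal_dir x"
    unfolding x[symmetric] by (simp add: inner_commute divide_inverse_commute)
  then show "\<exists>x. p x < P \<bullet> normal_dir x" using Y by auto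
qed (use inner_le_p not_less in blast)

lemma gap_deriv: "((\<lambda>y. p y - P \<bullet> normal_dir y) has_real_derivative p' y - P \<bullet> tangent_dir y) (at y)"
  unfolding inner_vec2 by (auto intro!: derivative_eq_intros dp)

text \<open>The gap between p and P is negative in some direction b. Gaps in opposite directions add
  up to w > 0, so it is positive at b - pi. At a downcrossing the support line passes through P,
  with P on the forward side of the contact point.\<close>

lemma forward_exists:
  assumes "P \<notin> K"
  obtains x t where "0 \<le> x" "x < 2 * pi" "t > 0" "P = contact x + t *\<^sub>R tangent_dir x"
proof -
  let ?g = "\<lambda>y. p y - P \<bullet> normal_dir y"
  obtain b where b: "?g b < 0" using assms outside_iff by auto
  have "?g (b - pi) > 0"
    using b width[of "b - pi"] normal_dir_shift(1)[of "b - pi"] w_pos by simp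
  then obtain c where c: "?g c = 0" "p' c - P \<bullet> tangent_dir c \<le> 0"
    using downcrossing[of "b - pi" b ?g, OF _ _ b gap_deriv] by auto
  \<comment> \<open>Normal, \<open>p\<close> and \<open>p'\<close> are reduced modulo the period as
    one triple, so that all three refer to the same angle.\<close>
  obtain d where d: "0 \<le> d" "d < 2 * pi" "normal_dir c = normal_dir d \<and> p c = p d \<and> p' c = p' d"
  proof -
    have "(\<lambda>x. (normal_dir x, p x, p' x)) (x + 2 * pi) = (\<lambda>x. (normal_dir x, p x, p' x)) x" for x
      using p_periodic p'_periodic by (simp add: vec_eq_iff forall_2)
    from periodic_reduce[of "\<lambda>x. (normal_dir x, p x, p' x)", OF this, of c] that show ?thesis by auto
  qed
  define t where "t = P \<bullet> tangent_dir d - p' d"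
  have eq: "P = contact d + t *\<^sub>R tangent_dir d"
    by (rule dir_eqI[of _ d]) (use c d in \<open>auto simp: inner_add_left contact_inner inner_dirs t_def\<close>)
  have "tangent_dir c = tangent_dir d" using d(3) tangent_dir_eq by blast
  then have "t \<ge> 0" using c d by (simp add: t_def)
  moreover have "t \<noteq> 0" using eq contact_in[of d] assms by auto
  ultimately show ?thesis using that[OF d(1,2) _ eq] by simp
qed

text \<open>Each contact point lies in the half plane of the other support line, which gives t sin
  (y - x) \<ge> 0 and s sin (x - y) \<ge> 0. With t and s of equal sign the sine is 0; opposite
  normals would force p x + p (x + pi) = 0.\<close>

lemma tangent_point_unique:
  assumes eq: "contact x + t *\<^sub>R tangent_dir x = contact y + s *\<^sub>R tangent_dir y" and ts: "t * s > 0"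
  shows "normal_dir x = normal_dir y"
proof -
  let ?P = "contact x + t *\<^sub>R tangent_dir x"
  have 1: "0 \<le> t * sin (y - x)"
    using inner_le_p[OF contact_in[of x], of y] arg_cong[OF eq, of "\<lambda>v. v \<bullet> normal_dir y"]
    by (simp add: inner_add_left inner_dirs contact_inner)
  have 2: "0 \<le> s * sin (x - y)"
    using inner_le_p[OF contact_in[of y], of x] arg_cong[OF eq, of "\<lambda>v. v \<bullet> normal_dir x"]
    by (simp add: inner_add_left inner_dirs contact_inner)
  have "sin (x - y) = - sin (y - x)" using sin_minus[of "y - x"] by simp
  with 1 2 ts have s0: "sin (y - x) = 0"
    by (auto simp: zero_less_mult_iff zero_le_mult_iff mult_le_0_iff)
  have c: "cos (y - x) = 1 \<or> cos (y - x) = -1"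
    using s0 sin_cos_squared_add[of "y - x"] by (auto simp: power2_eq_1_iff)
  have N: "normal_dir y = cos (y - x) *\<^sub>R normal_dir x"
    using dir_decomp[of "normal_dir y" x] s0 \<open>sin (x - y) = - sin (y - x)\<close>
    by (simp add: inner_dirs inner_commute)
  show ?thesis
  proof (rule ccontr)
    assume "normal_dir x \<noteq> normal_dir y"
    with c N have "normal_dir y = - normal_dir x" by auto
    then have Ny: "normal_dir y = normal_dir (x + pi)" by (simp add: normal_dir_shift)
    then have py: "p y = p (x + pi)" by (simp add: p_eq)
    have "?P \<bullet> normal_dir x = p x" by (simp add: inner_add_left inner_dirs contact_inner)
    moreover have "?P \<bullet> normal_dir y = p y" unfolding eq by (simp add: inner_add_left inner_dirs contact_inner)
    ultimately have "p x + p y = 0" using \<open>normal_dir y = - normal_dir x\<close> by simp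
    then show False using width[of x] w_pos py by simp
  qed
qed

lemma tangent_point_outside:
  assumes "t \<noteq> 0"
  shows "contact x + t *\<^sub>R tangent_dir x \<notin> K"
proof
  assume "contact x + t *\<^sub>R tangent_dir x \<in> K"
  then have "contact x + t *\<^sub>R tangent_dir x = contact x"
    by (rule contact_unique) (simp add: inner_add_left inner_dirs contact_inner)
  then have "t *\<^sub>R tangent_dir x = 0" by simp
  then show False using assms norm_dirs(2)[of x] by auto
qed

text \<open>The signed distance from \<open>contact x\<close> along \<open>tangent_dir x\<close> to
  the support line whose normal is turned by pi - s; there the two support lines enclose the angle
  s.\<close>

definition tangent_len :: "real \<Rightarrow> real \<Rightarrow> real" where
  "tangent_len x s = (p (x + (pi - s)) + p x * cos s) / sin s - p' x"

text \<open>\<open>G\<close> is the gap at P with angles counted from x. It is 0 at 0, negative just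
  after 0 and positive at pi. All its zeros in (0, 2 pi) are strict upcrossings, so there is just
  one zero d below pi, and it gives the other tangent line.\<close>

lemma backward_exists:
  fixes x t :: real
  assumes t: "t > 0"
  defines "P \<equiv> contact x + t *\<^sub>R tangent_dir x"
  obtains d r where "0 < d" "d < pi" "r > 0" "P = contact (x + d) - r *\<^sub>R tangent_dir (x + d)"
    "\<And>s. 0 < s \<Longrightarrow> s < pi \<Longrightarrow> t < tangent_len x s \<longleftrightarrow> d < pi - s"
proof -
  define G where "G z = p (x + z) - P \<bullet> normal_dir (x + z)" for z
  define G' where "G' z = p' (x + z) - P \<bullet> tangent_dir (x + z)" for z
  have dG: "(G has_real_derivative G' z) (at z)" for z
  proof -
    have "((\<lambda>z. x + z) has_real_derivative 1) (at z)" by (auto intro!: derivative_eq_intros)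
    from DERIV_chain'[OF this gap_deriv[of P "x + z"]] show ?thesis
      unfolding G_def G'_def by simp
  qed
  have contG: "continuous_on A G" for A
    using dG by (meson DERIV_isCont continuous_at_imp_continuous_on)
  have PK: "P \<notin> K" unfolding P_def using tangent_point_outside t by simp
  have G0: "G 0 = 0" by (simp add: G_def P_def inner_add_left inner_dirs contact_inner)
  have Gneg: "G' 0 < 0" using t by (simp add: G'_def P_def inner_add_left inner_dirs contact_inner)
  have Gpi: "G pi > 0"
    using G0 width[of x] w_pos by (simp add: G_def normal_dir_shift)
  \<comment> \<open>A zero with nonpositive derivative would either put P into \<open>K\<close> or
    give a second forward tangent, which \<open>tangent_point_unique\<close> excludes.\<close>
  have up: "G' z > 0" if z: "0 < z" "z < 2 * pi" "G z = 0" for z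
  proof (rule ccontr)
    assume "\<not> G' z > 0"
    define r where "r = - G' z"
    have eq: "P = contact (x + z) + r *\<^sub>R tangent_dir (x + z)"
      by (rule dir_eqI[of _ "x + z"])
         (use z(3) in \<open>auto simp: G_def G'_def inner_add_left contact_inner inner_dirs r_def\<close>)
    show False
    proof (cases "r = 0")
      case True
      then show False using eq contact_in PK by simp
    next
      case False
      then have "r > 0" using \<open>\<not> G' z > 0\<close> by (simp add: r_def)
      then have "normal_dir x = normal_dir (x + z)"
        using tangent_point_unique[of x t "x + z" r] eq t by (simp add: P_def)
      then have "normal_dir x \<bullet> normal_dir (x + z) = 1" by (metis norm_dirs(1) norm_eq_1)
      then have "cos z = 1" by (simp add: inner_dirs)
      then obtain n where n: "z = of_int n * (2 * pi)" using cos_one_2pi_int[of z] by (auto simp: mult_ac)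
      then have "0 < real_of_int n" "real_of_int n < 1"
        using z by (auto simp: zero_less_mult_iff)
      then have "0 < n" "n < 1" by simp_all
      then show False by simp
    qed
  qed
  have stay: "G b \<ge> 0" if ab: "0 < a" "a < b" "b < 2 * pi" "G a > 0" for a b
  proof (rule ccontr)
    assume "\<not> G b \<ge> 0"
    then have "G b < 0" by simp
    then obtain c where c: "a < c" "c < b" "G c = 0" "G' c \<le> 0"
      using downcrossing[OF ab(2,4) _ dG] by blast
    then have "0 < c" "c < 2 * pi" using ab by auto
    with up[of c] c show False by simp
  qed
  have right: "\<exists>a. z < a \<and> a < b \<and> G a > 0" if z: "0 < z" "z < b" "b \<le> pi" "G z = 0" for z b
  proof -
    have "G' z > 0" using up z by auto
    then obtain e where e: "e > 0" "\<And>h. 0 < h \<Longrightarrow> h < e \<Longrightarrow> G z < G (z + h)"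
      using DERIV_pos_inc_right[OF dG[of z]] by auto
    define h where "h = min (e / 2) ((b - z) / 2)"
    have "0 < h" "h < e" "z + h < b" using e(1) z by (auto simp: h_def min_def field_simps)
    then show ?thesis using e(2)[of h] z by (intro exI[of _ "z + h"]) auto
  qed
  have left: "\<exists>a. b < a \<and> a < z \<and> G a < 0" if z: "0 < z" "b < z" "z \<le> pi" "G z = 0" for z b
  proof -
    have "G' z > 0" using up z by auto
    then obtain e where e: "e > 0" "\<And>h. 0 < h \<Longrightarrow> h < e \<Longrightarrow> G (z - h) < G z"
      using DERIV_pos_inc_left[OF dG[of z]] by auto
    define h where "h = min (e / 2) ((z - b) / 2)"
    have "0 < h" "h < e" "b < z - h" using e(1) z by (auto simp: h_def min_def field_simps)
    then show ?thesis using e(2)[of h] z by (intro exI[of _ "z - h"]) auto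
  qed
  obtain e where e: "e > 0" "\<And>h. 0 < h \<Longrightarrow> h < e \<Longrightarrow> G (0 + h) < G 0"
    using DERIV_neg_dec_right[OF dG[of 0] Gneg] by auto
  define h where "h = min (e / 2) 1"
  have h: "0 < h" "h < pi" "G h < 0"
    using e(1) e(2)[of h] pi_gt3 G0 by (auto simp: h_def min_def)
  \<comment> \<open>Starting at h, where \<open>G\<close> is negative, avoids the trivial zero at
    0.\<close>
  obtain d where d: "h \<le> d" "d \<le> pi" "G d = 0"
    using IVT'[of G h 0 pi] h Gpi contG by auto
  have d0: "0 < d" "d < pi" using d h Gpi by (auto simp: le_less)
  have above: "G z > 0" if z: "d < z" "z < pi" for z
  proof (rule ccontr)
    assume n: "\<not> G z > 0"
    obtain a where a: "d < a" "a < z" "G a > 0" using right[of d z] d0 z d(3) by auto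
    have "G z = 0" using stay[of a z] a d0 z n by auto
    then obtain b where "a < b" "b < z" "G b < 0" using left[of z a] a d0 z by auto
    then show False using stay[of a b] a d0 z by auto
  qed
  have below: "\<not> G z > 0" if z: "0 < z" "z \<le> d" for z
  proof
    assume n: "G z > 0"
    then have "z < d" using z d(3) by (cases "z = d") auto
    then obtain b where "z < b" "b < d" "G b < 0" using left[of d z] d0 d(3) by auto
    then show False using stay[of z b] z n d0 by auto
  qed
  define r where "r = G' d"
  have "r > 0" using up[of d] d0 d(3) by (simp add: r_def)
  moreover have "P = contact (x + d) - r *\<^sub>R tangent_dir (x + d)"
    by (rule dir_eqI[of _ "x + d"])
       (use d(3) in \<open>auto simp: G_def G'_def inner_diff_left contact_inner inner_dirs r_def\<close>)
  \<comment> \<open>\<open>G (pi - s)\<close> is 0 exactly when P lies on the support line turned by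
    pi - s, that is at t = \<open>tangent_len x s\<close>; its sign therefore compares t with that
    length.\<close>
  moreover have "t < tangent_len x s \<longleftrightarrow> d < pi - s" if s: "0 < s" "s < pi" for s
  proof -
    have "G (pi - s) = sin s * (tangent_len x s - t)"
      using sin_gt_zero[OF s]
      by (simp add: G_def P_def tangent_len_def inner_add_left contact_inner inner_dirs field_simps)
    then have "t < tangent_len x s \<longleftrightarrow> G (pi - s) > 0"
      using sin_gt_zero[OF s] by (simp add: zero_less_mult_iff)
    also have "\<dots> \<longleftrightarrow> d < pi - s" using above[of "pi - s"] below[of "pi - s"] s by (cases "d < pi - s") auto
    finally show ?thesis .
  qed
  ultimately show ?thesis using that d0 by blast
qed

text \<open>The normal of a tangent line in the sense of \<open>tangent_direction\<close> is some
  \<open>normal_dir z\<close>, and the point of \<open>K\<close> on it must be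
  \<open>contact z\<close>. So u is \<open>tangent_dir z\<close> up to sign, and uniqueness on each
  side identifies z with x or y.\<close>

lemma tangent_direction_iff:
  assumes P: "P = contact x + t *\<^sub>R tangent_dir x" "P = contact y - r *\<^sub>R tangent_dir y" and "t > 0" "r > 0"
  shows "tangent_direction K P u \<longleftrightarrow> u = - tangent_dir x \<or> u = tangent_dir y"
proof
  assume "tangent_direction K P u"
  then obtain s n where u: "norm u = 1" and s: "s > 0" "P + s *\<^sub>R u \<in> K"
    and n: "n \<noteq> 0" "n \<bullet> u = 0" "\<And>Y. Y \<in> K \<Longrightarrow> n \<bullet> (Y - P) \<le> 0"
    unfolding tangent_direction_def by auto
  have "norm (n /\<^sub>R norm n) = 1" using n(1) by simp
  then obtain z where z: "n /\<^sub>R norm n = normal_dir z" using unit_vec2_normal_dir by metis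
  have uz: "u \<bullet> normal_dir z = 0" using n(2) by (simp add: z[symmetric] inner_commute)
  have u2: "u = (u \<bullet> tangent_dir z) *\<^sub>R tangent_dir z" using dir_decomp[of u z] uz by simp
  then have "\<bar>u \<bullet> tangent_dir z\<bar> = 1" using u by (metis norm_dirs(2) norm_scaleR mult.right_neutral)
  then have u3: "u = tangent_dir z \<or> u = - tangent_dir z" using u2 by (auto simp: abs_if split: if_splits)
  obtain Y where Y: "Y \<in> K" "Y \<bullet> normal_dir z = p z" using p_attained by metis
  have "normal_dir z \<bullet> (Y - P) \<le> 0"
    unfolding z[symmetric] using n(3)[OF Y(1)] by (simp add: mult_nonneg_nonpos)
  then have "p z \<le> P \<bullet> normal_dir z" using Y by (simp add: inner_diff_right inner_commute)
  moreover have eq: "(P + s *\<^sub>R u) \<bullet> normal_dir z = P \<bullet> normal_dir z"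
    using uz by (simp add: inner_add_left)
  \<comment> \<open>One inequality comes from this point lying in \<open>K\<close>, the other from
    the support point Y lying on the allowed side of the line through P.\<close>
  ultimately have "(P + s *\<^sub>R u) \<bullet> normal_dir z = p z"
    using inner_le_p[OF s(2), of z] by linarith
  then have c: "P + s *\<^sub>R u = contact z" by (rule contact_unique[OF s(2)])
  show "u = - tangent_dir x \<or> u = tangent_dir y"
    using u3
  proof
    assume u: "u = tangent_dir z"
    then have "contact y + (- r) *\<^sub>R tangent_dir y = contact z + (- s) *\<^sub>R tangent_dir z"
      using c P(2) by (simp add: algebra_simps)
    then have "normal_dir y = normal_dir z" by (rule tangent_point_unique) (use s \<open>r > 0\<close> in simp)
    then show ?thesis using u tangent_dir_eq by metis
  next
    assume u: "u = - tangent_dir z"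
    then have "contact x + t *\<^sub>R tangent_dir x = contact z + s *\<^sub>R tangent_dir z"
      using c P(1) by (simp add: algebra_simps)
    then have "normal_dir x = normal_dir z" by (rule tangent_point_unique) (use s \<open>t > 0\<close> in simp)
    then show ?thesis using u tangent_dir_eq by metis
  qed
next
  have *: "tangent_direction K P u" if "norm u = 1" "s > 0" "P + s *\<^sub>R u = contact z" "u \<bullet> normal_dir z = 0" for u s z
  proof -
    have "P \<bullet> normal_dir z = p z"
      using arg_cong[OF that(3), of "\<lambda>v. v \<bullet> normal_dir z"] that(4) by (simp add: inner_add_left contact_inner)
    then have "normal_dir z \<bullet> (Y - P) \<le> 0" if "Y \<in> K" for Y
      using inner_le_p[OF that, of z] by (simp add: inner_diff_right inner_commute)
    moreover have "normal_dir z \<noteq> 0" using norm_dirs(1)[of z] by (metis norm_zero zero_neq_one)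
    ultimately show ?thesis
      unfolding tangent_direction_def using that contact_in[of z] by (auto simp: inner_commute intro!: exI[of _ s] exI[of _ "normal_dir z"])
  qed
  assume "u = - tangent_dir x \<or> u = tangent_dir y"
  then show "tangent_direction K P u"
  proof
    assume "u = - tangent_dir x"
    then show ?thesis using \<open>t > 0\<close> by (intro *[of u t x]) (auto simp: P(1) inner_dirs)
  next
    assume "u = tangent_dir y"
    then show ?thesis using \<open>r > 0\<close> by (intro *[of u r y]) (auto simp: P(2) inner_dirs)
  qed
qed

text \<open>The two tangent directions make the visual angle equal to pi - d, with d from
  \<open>backward_exists\<close>. This turns a condition on the angle into an explicit bound on
  t.\<close>

lemma visual_angle_level:
  fixes x t :: real
  assumes t: "t > 0"
  defines "P \<equiv> contact x + t *\<^sub>R tangent_dir x"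
  shows "0 < visual_angle K P" "visual_angle K P < pi"
    and "\<And>s. 0 < s \<Longrightarrow> s < pi \<Longrightarrow> s < visual_angle K P \<longleftrightarrow> t < tangent_len x s"
proof -
  obtain d r where d: "0 < d" "d < pi" and r: "r > 0" "P = contact (x + d) - r *\<^sub>R tangent_dir (x + d)"
    and lev: "\<And>s. 0 < s \<Longrightarrow> s < pi \<Longrightarrow> t < tangent_len x s \<longleftrightarrow> d < pi - s"
    using backward_exists[OF t, of x] unfolding P_def by metis
  have iff: "tangent_direction K P u \<longleftrightarrow> u = - tangent_dir x \<or> u = tangent_dir (x + d)" for u
    by (rule tangent_direction_iff[OF _ r(2) t r(1)]) (simp add: P_def)
  have ip: "- tangent_dir x \<bullet> tangent_dir (x + d) = - cos d" by (simp add: inner_dirs)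
  have ne: "- tangent_dir x \<noteq> tangent_dir (x + d)"
  proof
    assume "- tangent_dir x = tangent_dir (x + d)"
    then have "- tangent_dir x \<bullet> tangent_dir (x + d) = 1" by (metis norm_dirs(2) norm_eq_1)
    then have "cos d = cos pi" using ip by simp
    then show False using cos_monotone_0_pi[of d pi] d by simp
  qed
  have ac: "arccos (- cos d) = pi - d"
    using arccos_cos[of "pi - d"] d by simp
  have "visual_angle K P = pi - d"
    unfolding visual_angle_def
  proof (rule the_equality)
    show "\<exists>u v. tangent_direction K P u \<and> tangent_direction K P v \<and> u \<noteq> v \<and> pi - d = arccos (u \<bullet> v)"
      using iff ne ip ac by (intro exI[of _ "- tangent_dir x"] exI[of _ "tangent_dir (x + d)"]) auto
    fix a assume "\<exists>u v. tangent_direction K P u \<and> tangent_direction K P v \<and> u \<noteq> v \<and> a = arccos (u \<bullet> v)"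
    then obtain u v where uv: "tangent_direction K P u" "tangent_direction K P v" "u \<noteq> v" "a = arccos (u \<bullet> v)"
      by blast
    then have "u = - tangent_dir x \<and> v = tangent_dir (x + d) \<or> v = - tangent_dir x \<and> u = tangent_dir (x + d)"
      using iff by auto
    then have "u \<bullet> v = - cos d" using ip by (auto simp: inner_commute)
    then show "a = pi - d" using uv(4) ac by simp
  qed
  then show "0 < visual_angle K P" "visual_angle K P < pi"
    "\<And>s. 0 < s \<Longrightarrow> s < pi \<Longrightarrow> s < visual_angle K P \<longleftrightarrow> t < tangent_len x s"
    using d lev by auto
qed

end

section \<open>The length of the boundary\<close>

lemma integral_abs_sin_period: "integral {0..2 * pi} (\<lambda>x. \<bar>sin x\<bar>) = 4"
proof -
  have 1: "((\<lambda>x. \<bar>sin x\<bar>) has_integral (- cos pi - - cos 0)) {0..pi}"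
  proof (rule fundamental_theorem_of_calculus)
    fix x assume "x \<in> {0..pi}"
    then have "\<bar>sin x\<bar> = sin x" using sin_ge_zero by auto
    then show "((\<lambda>x. - cos x) has_vector_derivative \<bar>sin x\<bar>) (at x within {0..pi})"
      by (auto intro!: derivative_eq_intros simp flip: has_real_derivative_iff_has_vector_derivative)
  qed simp
  have 2: "((\<lambda>x. \<bar>sin x\<bar>) has_integral (cos (2 * pi) - cos pi)) {pi..2 * pi}"
  proof (rule fundamental_theorem_of_calculus)
    fix x assume "x \<in> {pi..2 * pi}"
    then have "\<bar>sin x\<bar> = - sin x" using sin_ge_zero[of "x - pi"] by auto
    then show "((\<lambda>x. cos x) has_vector_derivative \<bar>sin x\<bar>) (at x within {pi..2 * pi})"
      by (auto intro!: derivative_eq_intros simp flip: has_real_derivative_iff_has_vector_derivative)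
  qed simp
  have "((\<lambda>x. \<bar>sin x\<bar>) has_integral (- cos pi - - cos 0) + (cos (2 * pi) - cos pi)) {0..2 * pi}"
    by (rule has_integral_combine[OF _ _ 1 2]) auto
  then show ?thesis by (simp add: integral_unique)
qed

text \<open>The constant 4 by which averaging projections over all directions recovers a
  length.\<close>

lemma integral_abs_inner_normal_dir: "integral {0..2 * pi} (\<lambda>x. \<bar>v \<bullet> normal_dir x\<bar>) = 4 * norm v"
proof (cases "v = 0")
  case False
  then have "norm (v /\<^sub>R norm v) = 1" by simp
  then obtain y where "v /\<^sub>R norm v = normal_dir y" using unit_vec2_normal_dir by metis
  then have v: "v = norm v *\<^sub>R normal_dir y" using False by (metis scaleR_right_diff_distrib divideR_right norm_eq_zero)
  have "\<bar>v \<bullet> normal_dir x\<bar> = norm v * \<bar>sin (x + (pi / 2 - y))\<bar>" for x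
  proof -
    have "v \<bullet> normal_dir x = norm v * cos (x - y)"
      by (subst v) (simp add: inner_dirs)
    also have "cos (x - y) = sin (x + (pi / 2 - y))"
      using sin_cos_eq[of "x + (pi / 2 - y)"] cos_minus[of "x - y"] by (simp add: algebra_simps)
    finally show ?thesis by (simp add: abs_mult)
  qed
  moreover have "integral {0..2 * pi} (\<lambda>x. \<bar>sin (x + (pi / 2 - y))\<bar>) = integral {0..2 * pi} (\<lambda>x. \<bar>sin x\<bar>)"
    by (rule integral_period_shift[of "\<lambda>x. \<bar>sin x\<bar>"]) (auto intro!: continuous_intros)
  ultimately show ?thesis by (simp add: integral_abs_sin_period)
qed simp

context support_body
begin

text \<open>A frontier point that is no contact point would have a positive gap in all directions;
  the minimum of the gap over one period is then the radius of a ball inside \<open>K\<close>.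
  Conversely, moving outward from a contact point along its normal leaves \<open>K\<close>.\<close>

lemma frontier_K: "frontier K = range contact"
proof (intro equalityI subsetI)
  fix B assume B: "B \<in> frontier K"
  then have BK: "B \<in> K" "B \<notin> interior K"
    using compact_imp_closed[OF compact_K] by (auto simp: frontier_def)
  show "B \<in> range contact"
  proof (rule ccontr)
    assume "B \<notin> range contact"
    then have pos: "p z - B \<bullet> normal_dir z > 0" for z
      using inner_le_p[OF BK(1), of z] contact_unique[OF BK(1), of z] by (cases "B \<bullet> normal_dir z = p z") auto
    have "continuous_on {0..2 * pi} (\<lambda>z. p z - B \<bullet> normal_dir z)"
      using gap_deriv by (meson DERIV_isCont continuous_at_imp_continuous_on)
    then obtain z0 where z0: "\<And>z. z \<in> {0..2 * pi} \<Longrightarrow> p z0 - B \<bullet> normal_dir z0 \<le> p z - B \<bullet> normal_dir z"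
      using continuous_attains_inf[of "{0..2 * pi}" "\<lambda>z. p z - B \<bullet> normal_dir z"]
      by (metis atLeastAtMost_iff compact_Icc empty_iff order_refl pi_ge_zero mult_nonneg_nonneg zero_le_numeral)
    define m where "m = p z0 - B \<bullet> normal_dir z0"
    have "ball B m \<subseteq> K"
    proof
      fix Y assume "Y \<in> ball B m"
      then have d: "norm (Y - B) < m" by (simp add: dist_norm norm_minus_commute)
      show "Y \<in> K"
      proof (rule ccontr)
        assume "Y \<notin> K"
        from forward_exists[OF this] obtain x t where x: "0 \<le> x" "x < 2 * pi" "Y = contact x + t *\<^sub>R tangent_dir x"
          by metis
        have "(Y - B) \<bullet> normal_dir x \<le> norm (Y - B)"
          using norm_cauchy_schwarz[of "Y - B" "normal_dir x"] by simp
        moreover have "Y \<bullet> normal_dir x = p x" using x(3) by (simp add: inner_add_left contact_inner inner_dirs)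
        ultimately have "p x - B \<bullet> normal_dir x < m" using d by (simp add: inner_diff_left)
        then show False using z0[of x] x by (simp add: m_def)
      qed
    qed
    moreover have "m > 0" using pos[of z0] by (simp add: m_def)
    ultimately have "B \<in> interior K" unfolding mem_interior by blast
    with BK show False by simp
  qed
next
  fix B assume "B \<in> range contact"
  then obtain x where x: "B = contact x" by auto
  have "B \<notin> interior K"
  proof
    assume "B \<in> interior K"
    then obtain e where e: "e > 0" "ball B e \<subseteq> K" by (auto simp: mem_interior)
    have "B + (e / 2) *\<^sub>R normal_dir x \<in> ball B e" using e(1) by (simp add: dist_norm)
    then have "B + (e / 2) *\<^sub>R normal_dir x \<in> K" using e by auto
    from inner_le_p[OF this, of x] show False using e(1) x by (simp add: inner_add_left contact_inner inner_dirs)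
  qed
  then show "B \<in> frontier K" using contact_in[of x] x closure_subset[of K] by (auto simp: frontier_def)
qed

text \<open>The support line at the middle point has both outer points on one side, so it contains
  them; but it touches \<open>K\<close> only once.\<close>

lemma chord_middle:
  assumes A: "A \<in> frontier K" and B: "B \<in> frontier K" and C: "C \<in> frontier K"
    and l: "A \<bullet> normal_dir x = B \<bullet> normal_dir x" "C \<bullet> normal_dir x = B \<bullet> normal_dir x"
    and o: "A \<bullet> tangent_dir x < B \<bullet> tangent_dir x" "B \<bullet> tangent_dir x < C \<bullet> tangent_dir x"
  shows False
proof -
  have AK: "A \<in> K" and CK: "C \<in> K" using A C frontier_K contact_in by auto
  obtain z where z: "B = contact z" using B frontier_K by auto
  have eq: "D - B = ((D - B) \<bullet> tangent_dir x) *\<^sub>R tangent_dir x" if "D \<bullet> normal_dir x = B \<bullet> normal_dir x" for D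
  proof -
    have "(D - B) \<bullet> normal_dir x = 0" using that by (simp add: inner_diff_left)
    then show ?thesis using dir_decomp[of "D - B" x] by (simp del: inner_diff_left)
  qed
  have le: "(D - B) \<bullet> normal_dir z \<le> 0" if "D \<in> K" for D
    using inner_le_p[OF that, of z] z by (simp add: inner_diff_left contact_inner)
  have 1: "((A - B) \<bullet> tangent_dir x) * (tangent_dir x \<bullet> normal_dir z) \<le> 0"
    using le[OF AK] by (subst (asm) eq[OF l(1)]) simp
  have 2: "((C - B) \<bullet> tangent_dir x) * (tangent_dir x \<bullet> normal_dir z) \<le> 0"
    using le[OF CK] by (subst (asm) eq[OF l(2)]) simp
  have "(A - B) \<bullet> tangent_dir x < 0" "(C - B) \<bullet> tangent_dir x > 0" using o by (simp_all add: inner_diff_left)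
  with 1 2 have 0: "tangent_dir x \<bullet> normal_dir z = 0" by (auto simp: mult_le_0_iff)
  have "(A - B) \<bullet> normal_dir z = 0" by (subst eq[OF l(1)]) (simp add: 0)
  then have "A \<bullet> normal_dir z = p z" using z by (simp add: inner_diff_left contact_inner)
  then have "A = B" using contact_unique[OF AK] z by simp
  then show False using o by simp
qed

lemma chord_points:
  assumes F: "A \<in> frontier K" "B \<in> frontier K" "C \<in> frontier K"
    and l: "A \<bullet> normal_dir x = B \<bullet> normal_dir x" "C \<bullet> normal_dir x = B \<bullet> normal_dir x"
  shows "A = B \<or> A = C \<or> B = C"
proof (rule ccontr)
  assume ne: "\<not> ?thesis"
  then have "A \<bullet> tangent_dir x \<noteq> B \<bullet> tangent_dir x" "A \<bullet> tangent_dir x \<noteq> C \<bullet> tangent_dir x"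
    "B \<bullet> tangent_dir x \<noteq> C \<bullet> tangent_dir x"
    using l dir_eqI[of A x B] dir_eqI[of A x C] dir_eqI[of B x C] by auto
  then consider "A \<bullet> tangent_dir x < B \<bullet> tangent_dir x" "B \<bullet> tangent_dir x < C \<bullet> tangent_dir x"
    | "C \<bullet> tangent_dir x < B \<bullet> tangent_dir x" "B \<bullet> tangent_dir x < A \<bullet> tangent_dir x"
    | "B \<bullet> tangent_dir x < A \<bullet> tangent_dir x" "A \<bullet> tangent_dir x < C \<bullet> tangent_dir x"
    | "C \<bullet> tangent_dir x < A \<bullet> tangent_dir x" "A \<bullet> tangent_dir x < B \<bullet> tangent_dir x"
    | "A \<bullet> tangent_dir x < C \<bullet> tangent_dir x" "C \<bullet> tangent_dir x < B \<bullet> tangent_dir x"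
    | "B \<bullet> tangent_dir x < C \<bullet> tangent_dir x" "C \<bullet> tangent_dir x < A \<bullet> tangent_dir x"
    by linarith
  then show False
    by cases (use chord_middle[where x = x] F l in metis)+
qed

end

section \<open>Total variation of the projected boundary\<close>

lemma periodic_inj:
  fixes \<gamma> :: "real \<Rightarrow> 'a"
  assumes per: "\<And>t. \<gamma> (t + 1) = \<gamma> t" and inj: "inj_on \<gamma> {0..<1}"
    and eq: "\<gamma> s = \<gamma> t" and st: "\<bar>s - t\<bar> < 1"
  shows "s = t"
proof -
  have f: "\<gamma> r = \<gamma> (frac r)" for r
    using periodic_add_int[of \<gamma> 1 "frac r" "\<lfloor>r\<rfloor>", OF per] by (simp add: frac_def)
  have "frac s = frac t"
    using inj eq f[of s] f[of t] by (auto simp: inj_on_def frac_lt_1)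
  then have "s - t = of_int (\<lfloor>s\<rfloor> - \<lfloor>t\<rfloor>)" by (simp add: frac_def algebra_simps)
  with st have "\<bar>real_of_int (\<lfloor>s\<rfloor> - \<lfloor>t\<rfloor>)\<bar> < 1" by simp
  then have "\<lfloor>s\<rfloor> - \<lfloor>t\<rfloor> = 0" by linarith
  with \<open>s - t = _\<close> show ?thesis by simp
qed

lemma has_integral_abs_deriv_inj:
  fixes g g' :: "real \<Rightarrow> real"
  assumes d: "\<And>t. (g has_real_derivative g' t) (at t)" and ab: "a < b" and inj: "inj_on g {a..b}"
  shows "((\<lambda>t. \<bar>g' t\<bar>) has_integral \<bar>g b - g a\<bar>) {a..b}"
proof -
  have cont: "continuous_on A g" for A
    using d by (meson DERIV_isCont continuous_at_imp_continuous_on)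
  have mono: "((\<lambda>t. \<bar>f' t\<bar>) has_integral \<bar>f b - f a\<bar>) {a..b}"
    if df: "\<And>t. (f has_real_derivative f' t) (at t)" and m: "strict_mono_on {a..b} f" for f f' :: "real \<Rightarrow> real"
  proof -
    have cf: "continuous_on {a..b} f"
      using df by (meson DERIV_isCont continuous_at_imp_continuous_on)
    have nonneg: "f' t \<ge> 0" if t: "a < t" "t < b" for t
    proof (rule ccontr)
      assume "\<not> f' t \<ge> 0"
      then obtain e where e: "e > 0" "\<And>h. 0 < h \<Longrightarrow> h < e \<Longrightarrow> f (t + h) < f t"
        using DERIV_neg_dec_right[OF df[of t]] by auto
      define h where "h = min (e / 2) (b - t)"
      have h: "0 < h" "h < e" "t + h \<le> b" using e(1) t by (auto simp: h_def)
      have "f t < f (t + h)" by (rule strict_mono_onD[OF m]) (use h t in auto)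
      then show False using e(2)[OF h(1,2)] by simp
    qed
    have "((\<lambda>t. \<bar>f' t\<bar>) has_integral f b - f a) {a..b}"
    proof (rule fundamental_theorem_of_calculus_interior[OF _ cf])
      fix t assume "t \<in> {a<..<b}"
      then have "\<bar>f' t\<bar> = f' t" using nonneg by auto
      then show "(f has_vector_derivative \<bar>f' t\<bar>) (at t)"
        using df by (simp flip: has_real_derivative_iff_has_vector_derivative)
    qed (use ab in simp)
    moreover have "f a < f b" by (rule strict_mono_onD[OF m]) (use ab in auto)
    ultimately show ?thesis by simp
  qed
  have "strict_mono_on {a..b} g \<or> strict_antimono_on {a..b} g"
    using injective_eq_monotone_map[of "{a..b}" g] inj cont by (auto simp: is_interval_cc)
  then show ?thesis
  proof
    assume "strict_mono_on {a..b} g" then show ?thesis using mono d by blast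
  next
    assume "strict_antimono_on {a..b} g"
    then have m: "strict_mono_on {a..b} (\<lambda>t. - g t)"
      by (auto simp: monotone_on_def)
    have "((\<lambda>t. - g t) has_real_derivative - g' t) (at t)" for t
      using d by (auto intro!: derivative_intros)
    from mono[OF this m] show ?thesis by (simp add: abs_minus_commute)
  qed
qed

context support_body
begin

text \<open>The projection attains its maximum p x and minimum p x - w at one point each, and these
  cut the curve into two arcs. On each arc the projection is injective, hence of variation
  w.\<close>

lemma boundary_projection_variation:
  assumes \<gamma>: "C2_boundary_param K \<gamma>" and d\<gamma>: "\<And>t. (\<gamma> has_vector_derivative \<gamma>' t) (at t)"
    and c\<gamma>': "continuous_on UNIV \<gamma>'"
  shows "integral {0..1} (\<lambda>t. \<bar>\<gamma>' t \<bullet> normal_dir x\<bar>) = 2 * w"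
proof -
  have per: "\<And>t. \<gamma> (t + 1) = \<gamma> t" and inj: "inj_on \<gamma> {0..<1}" and range: "range \<gamma> = frontier K"
    using \<gamma> unfolding C2_boundary_param_def by auto
  define g where "g t = \<gamma> t \<bullet> normal_dir x" for t
  define g' where "g' t = \<gamma>' t \<bullet> normal_dir x" for t
  have dg: "(g has_real_derivative g' t) (at t)" for t
    unfolding g_def[abs_def] g'_def has_real_derivative_iff_has_vector_derivative
    by (rule bounded_linear.has_vector_derivative[OF bounded_linear_inner_left d\<gamma>])
  have cg: "continuous_on A g" for A
    using dg by (meson DERIV_isCont continuous_at_imp_continuous_on)
  have gper: "g (t + 1) = g t" for t by (simp add: g_def per)
  have FK: "\<gamma> t \<in> frontier K" for t using range by auto
  have K: "\<gamma> t \<in> K" for t using FK[of t] frontier_K contact_in by auto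
  have g_le: "g t \<le> p x" for t unfolding g_def by (rule inner_le_p[OF K])
  have g_ge: "p x - w \<le> g t" for t
    using inner_le_p[OF K, of t "x + pi"] width[of x] by (simp add: g_def normal_dir_shift)
  have top: "\<gamma> t = contact x" if "g t = p x" for t
    using contact_unique[OF K] that by (simp add: g_def)
  have bot: "\<gamma> t = contact (x + pi)" if "g t = p x - w" for t
    using contact_unique[OF K, of t "x + pi"] that width[of x] by (simp add: g_def normal_dir_shift)
  obtain a where a: "\<gamma> a = contact x" using frontier_K range by (metis rangeI imageE)
  obtain b0 where b0: "\<gamma> b0 = contact (x + pi)" using frontier_K range by (metis rangeI imageE)
  have ga: "g a = p x" by (simp add: g_def a contact_inner)
  have gb0: "g b0 = p x - w" using width[of x]
    using contact_inner(1)[of "x + pi" "x + pi"] by (simp add: g_def b0 normal_dir_shift)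
  \<comment> \<open>The minimum is moved to a parameter in (a, a + 1), so that [a, b] and [b, a + 1]
    are the two arcs of one period.\<close>
  define b where "b = a + frac (b0 - a)"
  have \<gamma>b: "\<gamma> b = \<gamma> b0"
    using periodic_add_int[of \<gamma> 1 b "\<lfloor>b0 - a\<rfloor>", OF per] by (simp add: b_def frac_def)
  then have gb: "g b = p x - w" using gb0 by (simp add: g_def)
  have "b \<noteq> a" using ga gb w_pos by auto
  then have ab: "a < b" "b < a + 1" using frac_lt_1[of "b0 - a"] frac_ge_0[of "b0 - a"] unfolding b_def by linarith+
  have inj': "s = t" if "\<gamma> s = \<gamma> t" "\<bar>s - t\<bar> < 1" for s t
    using periodic_inj[of \<gamma>, OF per inj] that by blast
  have one: "inj_on g {c..d}"
    if cd: "c < d" "d < c + 1" and ends: "{g c, g d} = {p x, p x - w}" for c d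
  proof (rule inj_onI, rule ccontr)
    fix s t assume st: "s \<in> {c..d}" "t \<in> {c..d}" "g s = g t" "s \<noteq> t"
    have lt: "\<bar>s - t\<bar> < 1" using st cd by auto
    have ne: "\<gamma> s \<noteq> \<gamma> t" using inj' lt st(4) by blast
    have 1: "g s \<noteq> p x" using top[of s] top[of t] st(3) ne by auto
    have 2: "g s \<noteq> p x - w" using bot[of s] bot[of t] st(3) ne by auto
    have gd: "g (c + 1) = g c" by (rule gper)
    \<comment> \<open>The complementary arc runs between the same two extreme values and so takes
      the repeated value a third time; by \<open>chord_points\<close> a line cannot meet the
      boundary in three points.\<close>
    have "\<exists>r. d \<le> r \<and> r \<le> c + 1 \<and> g r = g s"
    proof (cases "g d = p x")
      case True
      then have "g (c + 1) = p x - w" using ends gd w_pos by (auto simp: doubleton_eq_iff)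
      then show ?thesis using IVT2'[of g "c + 1" "g s" d] True g_le g_ge cd cg by auto
    next
      case False
      then have "g d = p x - w" "g (c + 1) = p x" using ends gd by (auto simp: doubleton_eq_iff)
      then show ?thesis using IVT'[of g d "g s" "c + 1"] g_le g_ge cd cg by auto
    qed
    then obtain r where r: "d \<le> r" "r \<le> c + 1" "g r = g s" by blast
    have "r \<noteq> d" "r \<noteq> c + 1" "s \<noteq> c" "s \<noteq> d" "t \<noteq> c" "t \<noteq> d"
      using r st(3) 1 2 ends gd by (auto simp: doubleton_eq_iff)
    then have "\<bar>s - r\<bar> < 1" "s \<noteq> r" "\<bar>t - r\<bar> < 1" "t \<noteq> r" using r st cd by auto
    then have "\<gamma> s \<noteq> \<gamma> r" "\<gamma> t \<noteq> \<gamma> r" using inj' by blast+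
    then show False
      using chord_points[OF FK FK FK, of s x t r] ne r(3) st(3) by (auto simp: g_def)
  qed
  have I1: "((\<lambda>t. \<bar>g' t\<bar>) has_integral \<bar>g b - g a\<bar>) {a..b}"
    by (rule has_integral_abs_deriv_inj[OF dg ab(1) one]) (use ab ga gb in auto)
  have I2: "((\<lambda>t. \<bar>g' t\<bar>) has_integral \<bar>g (a + 1) - g b\<bar>) {b..a + 1}"
    by (rule has_integral_abs_deriv_inj[OF dg ab(2) one]) (use ab ga gb gper[of a] in auto)
  have "((\<lambda>t. \<bar>g' t\<bar>) has_integral \<bar>g b - g a\<bar> + \<bar>g (a + 1) - g b\<bar>) {a..a + 1}"
    by (rule has_integral_combine[OF _ _ I1 I2]) (use ab in auto)
  then have I: "integral {a..a + 1} (\<lambda>t. \<bar>g' t\<bar>) = 2 * w"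
    using ga gb gper[of a] w_pos by (simp add: integral_unique)
  have g'per: "g' (t + 1) = g' t" for t
  proof -
    have "((\<lambda>t. t + 1) has_real_derivative 1) (at t)" by (auto intro!: derivative_eq_intros)
    from DERIV_chain'[OF this dg[of "t + 1"]] have "(g has_real_derivative g' (t + 1)) (at t)"
      by (simp add: gper)
    then show ?thesis by (rule DERIV_unique[OF _ dg])
  qed
  have cg': "continuous_on UNIV g'"
    unfolding g'_def[abs_def] by (intro continuous_intros c\<gamma>')
  have "integral {0..1} (\<lambda>t. \<bar>g' (t + a)\<bar>) = integral {0..1} (\<lambda>t. \<bar>g' t\<bar>)"
    by (rule integral_period_shift[of "\<lambda>t. \<bar>g' t\<bar>"]) (use cg' g'per in \<open>auto intro!: continuous_intros\<close>)
  moreover have "integral {0..1} (\<lambda>t. \<bar>g' (t + a)\<bar>) = integral {a..a + 1} (\<lambda>t. \<bar>g' t\<bar>)"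
    using integral_shift_Icc_real[of 0 1 "\<lambda>t. \<bar>g' t\<bar>" a] by (simp add: o_def add.commute)
  ultimately show ?thesis using I by (simp add: g'_def)
qed

text \<open>Cauchy's formula: the length is \<open>1/4\<close> of the integral over all directions of the total variation
  of the projected curve, and that variation is twice the width.\<close>

theorem closed_curve_length_eq:
  assumes \<gamma>: "C2_boundary_param K \<gamma>"
  shows "closed_curve_length \<gamma> = pi * w"
proof -
  obtain \<gamma>' \<gamma>'' where d: "\<And>t. (\<gamma> has_vector_derivative \<gamma>' t) (at t)" "\<And>t. (\<gamma>' has_vector_derivative \<gamma>'' t) (at t)"
    using \<gamma> unfolding C2_boundary_param_def C2_fun_def by metis
  have c: "continuous_on UNIV \<gamma>'"
    using has_vector_derivative_continuous[OF d(2)] by (auto simp: continuous_on_eq_continuous_at)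
  have vd: "vector_derivative \<gamma> (at t) = \<gamma>' t" for t by (rule vector_derivative_at[OF d(1)])
  have cN: "continuous_on A normal_dir" for A
    using has_vector_derivative_continuous[OF has_vector_derivative_dirs(1)]
    by (auto intro!: continuous_at_imp_continuous_on)
  have "4 * closed_curve_length \<gamma> = integral {0..1} (\<lambda>t. integral {0..2 * pi} (\<lambda>x. \<bar>\<gamma>' t \<bullet> normal_dir x\<bar>))"
    by (simp add: closed_curve_length_def vd integral_abs_inner_normal_dir)
  also have "\<dots> = integral {0..2 * pi} (\<lambda>x. integral {0..1} (\<lambda>t. \<bar>\<gamma>' t \<bullet> normal_dir x\<bar>))"
    unfolding cbox_interval[symmetric]
  proof (rule integral_swap_continuous)
    have 1: "continuous_on (cbox (0, 0) (1, 2 * pi)) (\<lambda>z. \<gamma>' (fst z))"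
      by (rule continuous_on_compose2[OF c]) (auto intro!: continuous_intros)
    have 2: "continuous_on (cbox (0, 0) (1, 2 * pi)) (\<lambda>z::real\<times>real. normal_dir (snd z))"
      by (rule continuous_on_compose2[OF cN[of UNIV]]) (auto intro!: continuous_intros)
    show "continuous_on (cbox (0, 0) (1, 2 * pi)) (\<lambda>(t, x). \<bar>\<gamma>' t \<bullet> normal_dir x\<bar>)"
      unfolding case_prod_unfold by (intro continuous_intros 1 2)
  qed
  also have "\<dots> = 4 * pi * w"
    by (simp add: boundary_projection_variation[OF \<gamma> d(1) c])
  finally show ?thesis by simp
qed

end

section \<open>Tangent coordinates outside the body\<close>

locale smooth_support_body = support_body +
  fixes p'' :: "real \<Rightarrow> real"
  assumes dp': "\<And>x. (p' has_real_derivative p'' x) (at x)"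
begin

lemma continuous_p: "continuous_on A p" and continuous_p': "continuous_on A p'"
  by (auto intro!: continuous_at_imp_continuous_on DERIV_isCont[OF dp] DERIV_isCont[OF dp'])

lemma measurable_p [measurable]: "p \<in> borel_measurable borel" "p' \<in> borel_measurable borel"
  by (rule borel_measurable_continuous_onI[OF continuous_p], rule borel_measurable_continuous_onI[OF continuous_p'])

lemma contact_deriv: "(contact has_vector_derivative (p x + p'' x) *\<^sub>R tangent_dir x) (at x)"
proof -
  have "((\<lambda>x. p x *\<^sub>R normal_dir x + p' x *\<^sub>R tangent_dir x) has_vector_derivative
      (p x *\<^sub>R tangent_dir x + p' x *\<^sub>R normal_dir x) + (p' x *\<^sub>R (- normal_dir x) + p'' x *\<^sub>R tangent_dir x)) (at x)"
    by (intro has_vector_derivative_add has_vector_derivative_scaleR has_vector_derivative_dirs dp dp')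
  then show ?thesis unfolding contact_def[abs_def] by (simp add: scaleR_add_left)
qed

definition tangent_coords :: "real^2 \<Rightarrow> real^2" where
  "tangent_coords z = contact (z$1) + z$2 *\<^sub>R tangent_dir (z$1)"

text \<open>Half-open in the angle, so that every exterior point has exactly one pair of
  coordinates.\<close>

definition coord_domain :: "(real^2) set" where
  "coord_domain = {z. 0 \<le> z$1 \<and> z$1 < 2 * pi \<and> 0 < z$2}"

lemma tangent_coords_deriv:
  "(tangent_coords has_derivative
     (\<lambda>h. h$1 *\<^sub>R ((p (z$1) + p'' (z$1)) *\<^sub>R tangent_dir (z$1) - z$2 *\<^sub>R normal_dir (z$1))
        + h$2 *\<^sub>R tangent_dir (z$1))) (at z within A)"
proof -
  have 0: "((\<lambda>z::real^2. z$1) has_derivative (\<lambda>h. h$1)) (at z within A)"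
    by (rule bounded_linear_imp_has_derivative[OF bounded_linear_vec_nth])
  have 1: "((\<lambda>z. contact (z$1)) has_derivative (\<lambda>h. h$1 *\<^sub>R ((p (z$1) + p'' (z$1)) *\<^sub>R tangent_dir (z$1)))) (at z within A)"
    by (rule has_derivative_compose[OF 0 contact_deriv[of "z$1", unfolded has_vector_derivative_def]])
  have 2: "((\<lambda>z. tangent_dir (z$1)) has_derivative (\<lambda>h. h$1 *\<^sub>R (- normal_dir (z$1)))) (at z within A)"
    by (rule has_derivative_compose[OF 0 has_vector_derivative_dirs(2)[of "z$1" UNIV, unfolded has_vector_derivative_def]])
  have "(tangent_coords has_derivative (\<lambda>h. h$1 *\<^sub>R ((p (z$1) + p'' (z$1)) *\<^sub>R tangent_dir (z$1))
      + (z$2 *\<^sub>R (h$1 *\<^sub>R (- normal_dir (z$1))) + h$2 *\<^sub>R tangent_dir (z$1)))) (at z within A)"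
    unfolding tangent_coords_def[abs_def]
    by (intro has_derivative_add 1 has_derivative_scaleR 2 bounded_linear_imp_has_derivative[OF bounded_linear_vec_nth])
  then show ?thesis by (rule has_derivative_eq_rhs) (auto simp: algebra_simps)
qed

text \<open>The radius of curvature \<open>p + p''\<close> multiplies \<open>tangent_dir\<close>,
  the second column of the derivative, and drops out of the determinant.\<close>

lemma tangent_coords_det:
  "det (matrix (\<lambda>h::real^2. h$1 *\<^sub>R ((p (z$1) + p'' (z$1)) *\<^sub>R tangent_dir (z$1) - z$2 *\<^sub>R normal_dir (z$1))
        + h$2 *\<^sub>R tangent_dir (z$1))) = - (z$2)"
proof -
  have "cos x * (cos x * t) + sin x * (sin x * t) = (cos x * cos x + sin x * sin x) * t" for x t :: real
    by (simp only: distrib_right mult.assoc)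
  then have 1: "cos x * (cos x * t) + sin x * (sin x * t) = t" for x t :: real
    using sin_cos_squared_add3[of x] by simp
  show ?thesis
    using 1[of "z$1" "z$2"] by (simp add: det_2 matrix_def axis_def algebra_simps)
qed

lemma tangent_coords_inj: "inj_on tangent_coords coord_domain"
proof (rule inj_onI)
  fix y z assume y: "y \<in> coord_domain" and z: "z \<in> coord_domain" and eq: "tangent_coords y = tangent_coords z"
  have "normal_dir (y$1) = normal_dir (z$1)"
    by (rule tangent_point_unique[OF eq[unfolded tangent_coords_def]]) (use y z in \<open>auto simp: coord_domain_def\<close>)
  then have 1: "y$1 = z$1" by (rule normal_dir_inj) (use y z in \<open>auto simp: coord_domain_def\<close>)
  then have "(y$2 - z$2) *\<^sub>R tangent_dir (z$1) = 0" using eq by (simp add: tangent_coords_def scaleR_diff_left)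
  then have "norm ((y$2 - z$2) *\<^sub>R tangent_dir (z$1)) = 0" by (simp only: norm_zero)
  then have "y$2 = z$2" by (simp only: norm_scaleR norm_dirs) simp
  with 1 show "y = z" by (simp add: vec_eq_iff forall_2)
qed

lemma tangent_coords_image: "tangent_coords ` coord_domain = - K"
proof (intro equalityI subsetI)
  fix P assume "P \<in> tangent_coords ` coord_domain"
  then show "P \<in> - K" using tangent_point_outside by (auto simp: tangent_coords_def coord_domain_def)
next
  fix P assume "P \<in> - K"
  then obtain x t where "0 \<le> x" "x < 2 * pi" "t > 0" "P = contact x + t *\<^sub>R tangent_dir x"
    using forward_exists by auto
  then show "P \<in> tangent_coords ` coord_domain"
    by (intro image_eqI[of _ _ "vector [x, t]"]) (auto simp: tangent_coords_def coord_domain_def)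
qed

lemma coord_domain_borel [measurable]: "coord_domain \<in> sets borel"
proof -
  have "closed {z::real^2. 0 \<le> z$1}" "open {z::real^2. z$1 < 2 * pi}" "open {z::real^2. 0 < z$2}"
    by (intro closed_Collect_le open_Collect_less continuous_intros)+
  then have "{z::real^2. 0 \<le> z$1} \<inter> ({z. z$1 < 2 * pi} \<inter> {z. 0 < z$2}) \<in> sets borel"
    by (intro sets.Int borel_closed borel_open)
  also have "{z::real^2. 0 \<le> z$1} \<inter> ({z. z$1 < 2 * pi} \<inter> {z. 0 < z$2}) = coord_domain"
    by (auto simp: coord_domain_def)
  finally show ?thesis .
qed

text \<open>\<open>G\<close> is a measurable version of \<open>g\<close> in tangent coordinates. The
  measurability of \<open>g\<close> itself, unclear when \<open>g\<close> involves a definite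
  description, is part of the conclusion.\<close>

theorem integral_outside:
  fixes g :: "real^2 \<Rightarrow> real" and G :: "real \<Rightarrow> real \<Rightarrow> real"
  assumes G_meas [measurable]: "(\<lambda>z. G (fst z) (snd z)) \<in> borel_measurable (borel \<Otimes>\<^sub>M borel)"
    and G_nonneg: "\<And>x t. 0 \<le> G x t"
    and agree: "\<And>x t. 0 < t \<Longrightarrow> g (contact x + t *\<^sub>R tangent_dir x) = G x t"
    and int: "(\<integral>\<^sup>+ x. (\<integral>\<^sup>+ t. ennreal t * ennreal (G x t) * indicator {0<..} t \<partial>lborel)
                * indicator {0..<2 * pi} x \<partial>lborel) = ennreal b"
    and b: "0 \<le> b"
  shows "g absolutely_integrable_on - K" "integral (- K) g = b"
proof -
  define h where "h z = indicat_real coord_domain z * (z$2 * G (z$1) (z$2))" for z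
  have hm: "h \<in> borel_measurable borel"
  proof -
    have "(\<lambda>z::real^2. (\<lambda>z. G (fst z) (snd z)) (z$1, z$2)) \<in> borel_measurable borel"
      by measurable
    then have [measurable]: "(\<lambda>z::real^2. G (z$1) (z$2)) \<in> borel_measurable borel" by simp
    show ?thesis unfolding h_def[abs_def] by measurable
  qed
  have h0: "0 \<le> h z" for z
    using G_nonneg by (auto simp: h_def coord_domain_def indicator_def)
  have "(\<integral>\<^sup>+ z. ennreal (h z) \<partial>lborel) = (\<integral>\<^sup>+ x. \<integral>\<^sup>+ t. ennreal (h (vector [x, t])) \<partial>lborel \<partial>lborel)"
    by (rule nn_integral_vec2) (use hm in measurable)
  also have "\<dots> = (\<integral>\<^sup>+ x. (\<integral>\<^sup>+ t. ennreal t * ennreal (G x t) * indicator {0<..} t \<partial>lborel)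
                * indicator {0..<2 * pi} x \<partial>lborel)"
  proof (rule nn_integral_cong)
    fix x :: real
    have "(\<integral>\<^sup>+ t. ennreal (h (vector [x, t])) \<partial>lborel)
        = (\<integral>\<^sup>+ t. ennreal t * ennreal (G x t) * indicator {0<..} t * indicator {0..<2 * pi} x \<partial>lborel)"
      by (rule nn_integral_cong)
         (auto simp: h_def coord_domain_def indicator_def ennreal_mult G_nonneg)
    also have "\<dots> = (\<integral>\<^sup>+ t. ennreal t * ennreal (G x t) * indicator {0<..} t \<partial>lborel) * indicator {0..<2 * pi} x"
      by (auto simp: indicator_def)
    finally show "(\<integral>\<^sup>+ t. ennreal (h (vector [x, t])) \<partial>lborel) = \<dots>" .
  qed
  finally have "(\<integral>\<^sup>+ z. ennreal (h z) \<partial>lborel) = ennreal b" unfolding int .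
  then have hb: "(h has_integral b) UNIV"
    by (rule nn_integral_has_integral[OF hm h0 _ b])
  let ?D = "\<lambda>z. \<bar>- (z$2)\<bar> * g (tangent_coords z)"
  have "((\<lambda>z. if z \<in> coord_domain then ?D z else 0) has_integral b) UNIV"
  proof -
    have "(\<lambda>z. if z \<in> coord_domain then ?D z else 0) = h"
      by (auto simp: h_def fun_eq_iff coord_domain_def tangent_coords_def agree)
    then show ?thesis using hb by simp
  qed
  then have Db: "(?D has_integral b) coord_domain" by (simp only: has_integral_restrict_UNIV)
  have D0: "0 \<le> ?D z" if "z \<in> coord_domain" for z
    using that G_nonneg by (auto simp: coord_domain_def tangent_coords_def agree)
  have Da: "?D absolutely_integrable_on coord_domain"
    using absolutely_integrable_on_iff_nonneg[of coord_domain ?D] D0 Db by (auto simp: has_integral_integrable)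
  note cv = integrable_change_of_variables_real[where f = g and S = coord_domain and g = tangent_coords,
      OF _ tangent_coords_deriv tangent_coords_inj, unfolded tangent_coords_det, OF _ Da]
  have S: "coord_domain \<in> sets lebesgue" using coord_domain_borel by (simp add: sets_completionI_sets)
  show "g absolutely_integrable_on - K" using cv(1)[OF S] by (simp add: tangent_coords_image)
  show "integral (- K) g = b" using cv(2)[OF S] Db by (simp add: tangent_coords_image integral_unique)
qed

definition centered :: "real \<Rightarrow> real" where "centered x = p x - w / 2"

lemma antiperiodic_centered: "antiperiodic_C1 centered p'"
proof -
  have "centered (x + pi) = - centered x" for x using width[of x] by (simp add: centered_def)
  moreover have "(centered has_vector_derivative p' x) (at x)" for x
    unfolding centered_def[abs_def]
    using dp by (auto intro!: derivative_eq_intros simp flip: has_real_derivative_iff_has_vector_derivative)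
  ultimately show ?thesis by (simp add: antiperiodic_C1_def continuous_p')
qed

lemma nn_integral_period:
  assumes "continuous_on {0..2 * pi} f" "\<And>x. 0 \<le> f x"
  shows "(\<integral>\<^sup>+ x. ennreal (f x) * indicator {0..<2 * pi} x \<partial>lborel) = ennreal (integral {0..2 * pi} f)"
proof -
  have "(f has_integral integral {0..2 * pi} f) {0..2 * pi}"
    by (intro integrable_integral integrable_continuous_real assms)
  then have "(f has_integral integral {0..2 * pi} f) {0..<2 * pi}"
    by (subst has_integral_spike_set_eq[of _ "{0..2 * pi}"])
       (auto intro: negligible_subset[of "{2 * pi}"])
  then show ?thesis by (intro nn_integral_has_integral_lebesgue' assms)
qed

text \<open>The tangent coordinates only see the complement of \<open>K\<close>, so the area is read off from
  a large disc minus \<open>K\<close>.\<close>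

theorem area_eq: "measure lebesgue K = pi * (w / 2)\<^sup>2 - wirtinger_form centered p' / 2"
proof -
  obtain R where R: "R > 0" "\<And>Y. Y \<in> K \<Longrightarrow> norm Y < R"
    using compact_imp_bounded[OF compact_K] unfolding bounded_pos_less by auto
  have nrm: "(norm (contact x + t *\<^sub>R tangent_dir x))\<^sup>2 = (p x)\<^sup>2 + (p' x + t)\<^sup>2" for x t
    unfolding power2_norm_eq_inner contact_def
    by (simp add: inner_add_left inner_add_right inner_dirs power2_eq_square algebra_simps)
  have pp': "(p x)\<^sup>2 + (p' x)\<^sup>2 < R\<^sup>2" for x
    using nrm[of x 0] R(2)[OF contact_in[of x]] power_strict_mono[of "norm (contact x)" R 2] by simp
  \<comment> \<open>The length of the tangent ray inside the disc of radius R, solved from p^2 + (p'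
    + t)^2 = R^2.\<close>
  define T where "T x = sqrt (R\<^sup>2 - (p x)\<^sup>2) - p' x" for x
  have T0: "\<bar>p' x\<bar> < sqrt (R\<^sup>2 - (p x)\<^sup>2)" for x
    using pp'[of x] by (intro real_less_rsqrt) simp
  have Tpos: "0 < T x" for x using T0[of x] by (simp add: T_def abs_if split: if_splits)
  have cT: "continuous_on A T" for A
    unfolding T_def[abs_def] by (intro continuous_intros continuous_p continuous_p')
  have [measurable]: "T \<in> borel_measurable borel"
    by (intro borel_measurable_continuous_onI cT)
  have iff: "norm (contact x + t *\<^sub>R tangent_dir x) < R \<longleftrightarrow> t < T x" if "t > 0" for x t
  proof -
    have "norm (contact x + t *\<^sub>R tangent_dir x) < R \<longleftrightarrow> (norm (contact x + t *\<^sub>R tangent_dir x))\<^sup>2 < R\<^sup>2"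
      using R(1) by (metis less_imp_le norm_ge_zero power2_less_imp_less power_strict_mono zero_less_numeral)
    also have "\<dots> \<longleftrightarrow> (p' x + t)\<^sup>2 < R\<^sup>2 - (p x)\<^sup>2" unfolding nrm by linarith
    also have "\<dots> \<longleftrightarrow> \<bar>p' x + t\<bar> < sqrt (R\<^sup>2 - (p x)\<^sup>2)"
      using real_sqrt_less_iff[of "(p' x + t)\<^sup>2" "R\<^sup>2 - (p x)\<^sup>2"] by simp
    also have "\<dots> \<longleftrightarrow> t < T x"
      using T0[of x] that unfolding T_def by linarith
    finally show ?thesis .
  qed
  define G where "G x t = (if t < T x then 1 else 0 :: real)" for x t
  have int: "(\<integral>\<^sup>+ x. (\<integral>\<^sup>+ t. ennreal t * ennreal (G x t) * indicator {0<..} t \<partial>lborel)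
                * indicator {0..<2 * pi} x \<partial>lborel) = ennreal (integral {0..2 * pi} (\<lambda>x. (T x)\<^sup>2 / 2))"
  proof -
    have "(\<integral>\<^sup>+ t. ennreal t * ennreal (G x t) * indicator {0<..} t \<partial>lborel) = ennreal ((T x)\<^sup>2 / 2)" for x
    proof -
      have "(\<integral>\<^sup>+ t. ennreal t * ennreal (G x t) * indicator {0<..} t \<partial>lborel)
          = (\<integral>\<^sup>+ t. ennreal t * indicator {0<..<T x} t \<partial>lborel)"
        by (rule nn_integral_cong) (auto simp: G_def indicator_def)
      then show ?thesis using nn_integral_linear[of "T x"] Tpos[of x] by simp
    qed
    then show ?thesis
      by (simp only:) (intro nn_integral_period continuous_intros cT, auto)
  qed
  have "integral (- K) (indicat_real (ball 0 R)) = integral {0..2 * pi} (\<lambda>x. (T x)\<^sup>2 / 2)"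
  proof (rule integral_outside(2)[OF _ _ _ int])
    show "(\<lambda>z. G (fst z) (snd z)) \<in> borel_measurable (borel \<Otimes>\<^sub>M borel)" unfolding G_def by measurable
    show "indicat_real (ball 0 R) (contact x + t *\<^sub>R tangent_dir x) = G x t" if "0 < t" for x t
      using iff[OF that, of x] by (simp add: G_def indicator_def)
    show "0 \<le> integral {0..2 * pi} (\<lambda>x. (T x)\<^sup>2 / 2)"
      by (intro integral_nonneg integrable_continuous_real continuous_intros cT) auto
  qed (simp add: G_def)
  moreover have "integral (- K) (indicat_real (ball 0 R)) = pi * R\<^sup>2 - measure lebesgue K"
  proof -
    have KB: "K \<subseteq> ball 0 R" using R(2) by auto
    have M: "ball 0 R \<in> lmeasurable" "K \<in> lmeasurable"
      using lmeasurable_ball lmeasurable_compact[OF compact_K] by auto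
    have "integral (- K) (indicat_real (ball 0 R)) = integral UNIV (\<lambda>x. if x \<in> - K then indicat_real (ball 0 R) x else 0)"
      by (rule integral_restrict_UNIV[symmetric])
    also have "(\<lambda>x. if x \<in> - K then indicat_real (ball 0 R) x else 0) = indicat_real (ball 0 R - K)"
      by (auto simp: fun_eq_iff indicator_def)
    also have "integral UNIV (indicat_real (ball 0 R - K)) = measure lebesgue (ball 0 R - K)"
      by (rule lmeasure_integral_UNIV[symmetric]) (rule fmeasurable.Diff[OF M])
    also have "\<dots> = measure lebesgue (ball (0::real^2) R) - measure lebesgue K"
      by (rule measurable_measure_Diff[OF M(1) _ KB]) (use M in auto)
    also have "measure lebesgue (ball (0::real^2) R) = pi * R\<^sup>2"
      using content_ball[of R "0::real^2"] R(1) by (simp add: unit_ball_vol_2)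
    finally show ?thesis .
  qed
  moreover have "integral {0..2 * pi} (\<lambda>x. (T x)\<^sup>2 / 2) = pi * R\<^sup>2 - pi * (w / 2)\<^sup>2 + wirtinger_form centered p' / 2"
  proof -
    \<comment> \<open>The cross term of T^2 is the derivative of a function of \<open>p\<close>, so
      its integral over a period is 0; the substitution rule expresses this by two integrals between
      the equal values \<open>p 0\<close> and \<open>p (2 * pi)\<close>.\<close>
    have 1: "((\<lambda>x. p' x *\<^sub>R sqrt (R\<^sup>2 - (p x)\<^sup>2)) has_integral
        (integral {p 0..p (2 * pi)} (\<lambda>y. sqrt (R\<^sup>2 - y\<^sup>2)) - integral {p (2 * pi)..p 0} (\<lambda>y. sqrt (R\<^sup>2 - y\<^sup>2)))) {0..2 * pi}"
    proof (rule has_integral_substitution_general[of "{}" _ _ _ "-R" R])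
      show "p ` {0..2 * pi} \<subseteq> {- R..R}"
      proof
        fix y assume "y \<in> p ` {0..2 * pi}"
        then obtain x where y: "y = p x" by auto
        then have "\<bar>y\<bar>\<^sup>2 < R\<^sup>2" using pp'[of x] zero_le_power2[of "p' x"] unfolding power2_abs y by linarith
        then have "\<bar>y\<bar> < R" by (rule power_less_imp_less_base) (use R(1) in simp)
        then show "y \<in> {-R..R}" by auto
      qed
      show "continuous_on {- R..R} (\<lambda>y. sqrt (R\<^sup>2 - y\<^sup>2))" by (intro continuous_intros)
      show "(p has_real_derivative p' x) (at x within {0..2 * pi})" for x
        using dp by (rule has_field_derivative_at_within)
    qed (auto intro: continuous_p)
    have p2: "p (2 * pi) = p 0" using p_periodic[of 0] by simp
    have 1: "((\<lambda>x. p' x * sqrt (R\<^sup>2 - (p x)\<^sup>2)) has_integral 0) {0..2 * pi}" using 1 p2 by simp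
    have cc: "continuous_on A centered" for A
      unfolding centered_def[abs_def] by (intro continuous_intros continuous_p)
    have 2: "(centered has_integral 0) {0..2 * pi}"
      by (rule has_integral_antiperiodic[OF cc]) (use antiperiodic_centered in \<open>auto simp: antiperiodic_C1_def\<close>)
    have 3: "((\<lambda>x. (norm (p' x))\<^sup>2 - (norm (centered x))\<^sup>2) has_integral wirtinger_form centered p') {0..2 * pi}"
      unfolding wirtinger_form_def
      by (intro integrable_integral integrable_continuous_real continuous_intros continuous_p' cc)
    have 4: "((\<lambda>x. (R\<^sup>2 - (w / 2)\<^sup>2) / 2) has_integral 2 * pi * ((R\<^sup>2 - (w / 2)\<^sup>2) / 2)) {0..2 * pi}"
      using has_integral_const_real[of "(R\<^sup>2 - (w / 2)\<^sup>2) / 2" 0 "2 * pi"] by simp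
    have "((\<lambda>x. ((norm (p' x))\<^sup>2 - (norm (centered x))\<^sup>2) / 2 - p' x * sqrt (R\<^sup>2 - (p x)\<^sup>2)
        - centered x * (w / 2) + (R\<^sup>2 - (w / 2)\<^sup>2) / 2)
      has_integral wirtinger_form centered p' / 2 - 0 - 0 * (w / 2) + 2 * pi * ((R\<^sup>2 - (w / 2)\<^sup>2) / 2)) {0..2 * pi}"
      by (rule has_integral_add[OF has_integral_diff[OF has_integral_diff[OF has_integral_divide[OF 3] 1]
            has_integral_mult_left[OF 2]] 4])
    also have "(\<lambda>x. ((norm (p' x))\<^sup>2 - (norm (centered x))\<^sup>2) / 2 - p' x * sqrt (R\<^sup>2 - (p x)\<^sup>2)
        - centered x * (w / 2) + (R\<^sup>2 - (w / 2)\<^sup>2) / 2) = (\<lambda>x. (T x)\<^sup>2 / 2)"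
    proof
      fix x
      have "(sqrt (R\<^sup>2 - (p x)\<^sup>2))\<^sup>2 = R\<^sup>2 - (p x)\<^sup>2"
        by (intro real_sqrt_pow2) (use pp'[of x] zero_le_power2[of "p' x"] in linarith)
      then have "(T x)\<^sup>2 = R\<^sup>2 - (p x)\<^sup>2 + (p' x)\<^sup>2 - 2 * p' x * sqrt (R\<^sup>2 - (p x)\<^sup>2)"
        unfolding T_def power2_diff by (simp add: mult_ac)
      moreover have "(norm (centered x))\<^sup>2 = (p x)\<^sup>2 - p x * w + (w / 2)\<^sup>2" "centered x * (w / 2) = p x * w / 2 - (w / 2)\<^sup>2"
        by (simp_all add: centered_def power2_eq_square field_simps)
      ultimately show "((norm (p' x))\<^sup>2 - (norm (centered x))\<^sup>2) / 2 - p' x * sqrt (R\<^sup>2 - (p x)\<^sup>2)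
        - centered x * (w / 2) + (R\<^sup>2 - (w / 2)\<^sup>2) / 2 = (T x)\<^sup>2 / 2"
        by (simp add: field_simps)
    qed
    finally have "integral {0..2 * pi} (\<lambda>x. (T x)\<^sup>2 / 2)
        = wirtinger_form centered p' / 2 - 0 - 0 * (w / 2) + 2 * pi * ((R\<^sup>2 - (w / 2)\<^sup>2) / 2)"
      by (rule integral_unique)
    also have "\<dots> = pi * R\<^sup>2 - pi * (w / 2)\<^sup>2 + wirtinger_form centered p' / 2"
      by (simp add: field_simps)
    finally show ?thesis .
  qed
  ultimately show ?thesis by simp
qed

end

section \<open>The integral of the visual angle\<close>

lemma has_integral_open_Icc:
  fixes f :: "real \<Rightarrow> real"
  shows "(f has_integral y) {a<..<b} \<longleftrightarrow> (f has_integral y) {a..b}"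
  using has_integral_open_interval[of f y a b] by (simp only: box_real cbox_interval)

lemma one_minus_cos_pos: "0 < s \<Longrightarrow> s < pi \<Longrightarrow> 0 < 1 - cos (s::real)"
  using cos_monotone_0_pi[of 0 s] by simp

lemma absolutely_integrable_dmoment_quotient:
  "(\<lambda>s. dmoment m s / (1 - cos s)) absolutely_integrable_on {0<..<pi}"
proof (rule measurable_bounded_by_integrable_imp_absolutely_integrable)
  have "continuous_on {0<..<pi} (\<lambda>s. dmoment m s / (1 - cos s))"
    by (intro continuous_intros ballI) (use one_minus_cos_pos in fastforce)
  then show "(\<lambda>s. dmoment m s / (1 - cos s)) \<in> borel_measurable (lebesgue_on {0<..<pi})"
    by (rule continuous_imp_measurable_on_sets_lebesgue) auto
  have "((\<lambda>s. real m * real m * pi ^ (m - 1)) has_integral (pi * (real m * real m * pi ^ (m - 1)))) {0<..<pi}"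
    unfolding has_integral_open_Icc using has_integral_const_real[of "real m * real m * pi ^ (m - 1)" 0 pi] by simp
  then show "(\<lambda>s. real m * real m * pi ^ (m - 1)) integrable_on {0<..<pi}" by (rule has_integral_integrable)
  show "norm (dmoment m s / (1 - cos s)) \<le> real m * real m * pi ^ (m - 1)" if "s \<in> {0<..<pi}" for s
    using that one_minus_cos_pos[of s] dmoment_le[of s m] dmoment_nonneg[of s m]
    by (auto simp: pos_divide_le_eq)
qed auto

lemma M_coeff_has_integral:
  "((\<lambda>s. dmoment m s / (1 - cos s)) has_integral M_coeff m) {0<..<pi}"
proof -
  have "deriv (\<lambda>t. t ^ m - sin t ^ m) s = dmoment m s" for s :: real
    by (rule DERIV_imp_deriv) (rule DERIV_moment)
  then have "M_coeff m = integral {0..pi} (\<lambda>s. dmoment m s / (1 - cos s))" by (simp add: M_coeff_def)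
  moreover have "(\<lambda>s. dmoment m s / (1 - cos s)) integrable_on {0..pi}"
    using set_lebesgue_integral_eq_integral(1)[OF absolutely_integrable_dmoment_quotient]
    unfolding integrable_on_def has_integral_open_Icc .
  ultimately show ?thesis unfolding has_integral_open_Icc by (simp add: integrable_integral)
qed

lemma has_integral_dmoment_open:
  assumes "1 \<le> m" "0 \<le> t" "t \<le> pi"
  shows "(dmoment m has_integral t ^ m - sin t ^ m) {0<..<t}"
  unfolding has_integral_open_Icc by (rule has_integral_dmoment[OF assms])

lemma has_integral_dmoment_pi:
  assumes "1 \<le> m"
  shows "(dmoment m has_integral pi ^ m) {0<..<pi}"
proof -
  have 0: "(0::real) ^ m = 0" using assms by (simp add: zero_power)
  have "(dmoment m has_integral pi ^ m - sin pi ^ m) {0<..<pi}"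
    by (rule has_integral_dmoment_open[OF assms]) auto
  then show ?thesis by (simp only: sin_pi 0 diff_zero)
qed

text \<open>From 1 - cos s \<le> 2. It makes the disc value pi (w/2)^2 (2 M_m - pi^m) nonnegative,
  which the lower bound 0 of the theorem needs.\<close>

lemma M_coeff_ge:
  assumes "1 \<le> m"
  shows "pi ^ m \<le> 2 * M_coeff m"
proof -
  have "pi ^ m / 2 \<le> M_coeff m"
  proof (rule has_integral_le[OF has_integral_divide[OF has_integral_dmoment_pi[OF assms]] M_coeff_has_integral])
    fix s assume s: "s \<in> {0<..<pi}"
    have "1 - cos s \<le> 2" using cos_ge_minus_one[of s] by linarith
    then show "dmoment m s / 2 \<le> dmoment m s / (1 - cos s)"
      using s dmoment_nonneg[of s m] one_minus_cos_pos[of s] by (intro divide_left_mono) auto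
  qed
  then show ?thesis by simp
qed

context smooth_support_body
begin

text \<open>Constant width replaces the support value at x + (pi - s) by w minus the one at x -
  s.\<close>

lemma tangent_len_split:
  assumes s: "0 < s" "s < pi"
  shows "tangent_len x s = w / 2 * ((1 + cos s) / sin s) + tangent_defect centered p' s x"
proof -
  have eq: "x - s + pi = x + (pi - s)" by simp
  have p: "p (x + (pi - s)) = w - p (x - s)" using width[of "x - s"] unfolding eq by simp
  show ?thesis
    unfolding tangent_len_def tangent_defect_def centered_def p
    using sin_gt_zero[OF s] by (simp add: field_simps)
qed

text \<open>The contact point lies on the inner side of the support line that bounds the
  segment.\<close>

lemma tangent_len_nonneg:
  assumes s: "0 < s" "s < pi"
  shows "0 \<le> tangent_len x s"
proof -
  have "p x * cos (pi - s) + p' x * sin (pi - s) \<le> p (x + (pi - s))"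
    using inner_le_p[OF contact_in[of x], of "x + (pi - s)"] by (simp add: contact_inner)
  then show ?thesis using sin_gt_zero[OF s] by (simp add: tangent_len_def field_simps)
qed

lemma continuous_tangent_len:
  assumes s: "0 < s" "s < pi"
  shows "continuous_on A (\<lambda>x. tangent_len x s)"
proof -
  have "continuous_on A (\<lambda>x. p (x + (pi - s)))"
    by (rule continuous_on_compose2[OF continuous_p[of UNIV]]) (auto intro!: continuous_intros)
  then show ?thesis
    unfolding tangent_len_def
    by (intro continuous_intros continuous_p continuous_p') (use sin_gt_zero[OF s] in auto)
qed

text \<open>The defect is antiperiodic in x, so the cross term integrates to 0. The constant part is
  cot^2 (s/2) = 2 / (1 - cos s) - 1, the origin of the denominator in
  \<open>M_coeff\<close>.\<close>

lemma integral_tangent_len_square: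
  assumes s: "0 < s" "s < pi"
  shows "integral {0..2 * pi} (\<lambda>x. (tangent_len x s)\<^sup>2 / 2)
    = pi * (w / 2)\<^sup>2 * (2 * (1 / (1 - cos s)) - 1) + defect_energy centered p' s / 2"
proof -
  let ?t = "tangent_defect centered p' s"
  define c where "c = w / 2 * ((1 + cos s) / sin s)"
  have ct: "continuous_on UNIV ?t" by (rule continuous_tangent_defect2[OF antiperiodic_centered s])
  have anti: "?t (x + pi) = - ?t x" for x
  proof -
    have "centered (x + pi - s) = - centered (x - s)" "centered (x + pi) = - centered x"
      using antiperiodic_centered[unfolded antiperiodic_C1_def]
      by (simp_all add: add_diff_eq diff_add_eq flip: diff_add_eq) 
    then show ?thesis
      using antiperiodic_C1_deriv[OF antiperiodic_centered, of x]
      by (simp add: tangent_defect_def algebra_simps)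
  qed
  have 1: "(?t has_integral 0) {0..2 * pi}"
    by (rule has_integral_antiperiodic[OF ct anti]) simp
  have 2: "((\<lambda>x. (norm (?t x))\<^sup>2) has_integral defect_energy centered p' s) {0..2 * pi}"
    unfolding defect_energy_def
    by (intro integrable_integral integrable_continuous_real continuous_intros continuous_on_subset[OF ct]) auto
  have 3: "((\<lambda>x. c\<^sup>2 / 2) has_integral 2 * pi * (c\<^sup>2 / 2)) {0..2 * pi}"
    using has_integral_const_real[of "c\<^sup>2 / 2" 0 "2 * pi"] by simp
  have "((\<lambda>x. c\<^sup>2 / 2 + ?t x * c + (norm (?t x))\<^sup>2 / 2) has_integral
      2 * pi * (c\<^sup>2 / 2) + 0 * c + defect_energy centered p' s / 2) {0..2 * pi}"
    by (rule has_integral_add[OF has_integral_add[OF 3 has_integral_mult_left[OF 1]] has_integral_divide[OF 2]])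
  also have "(\<lambda>x. c\<^sup>2 / 2 + ?t x * c + (norm (?t x))\<^sup>2 / 2) = (\<lambda>x. (tangent_len x s)\<^sup>2 / 2)"
    unfolding tangent_len_split[OF s] c_def[symmetric] by (simp add: fun_eq_iff power2_sum field_simps)
  also have "2 * pi * (c\<^sup>2 / 2) + 0 * c + defect_energy centered p' s / 2 = pi * c\<^sup>2 + defect_energy centered p' s / 2"
    by simp
  finally have "integral {0..2 * pi} (\<lambda>x. (tangent_len x s)\<^sup>2 / 2) = pi * c\<^sup>2 + defect_energy centered p' s / 2"
    by (rule integral_unique)
  moreover have "c\<^sup>2 = (w / 2)\<^sup>2 * (2 * (1 / (1 - cos s)) - 1)"
  proof -
    have pos: "0 < 1 - cos s" by (rule one_minus_cos_pos[OF s])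
    have "(sin s)\<^sup>2 = (1 - cos s) * (1 + cos s)"
      using sin_squared_eq[of s] by (simp add: power2_eq_square algebra_simps)
    moreover have "1 + cos s \<noteq> 0"
    proof
      assume "1 + cos s = 0"
      then have "(sin s)\<^sup>2 = 0" using \<open>(sin s)\<^sup>2 = _\<close> by simp
      then show False using sin_gt_zero[OF s] by simp
    qed
    ultimately have "((1 + cos s) / sin s)\<^sup>2 = (1 + cos s) / (1 - cos s)"
      using pos by (simp add: power_divide power2_eq_square)
    also have "\<dots> = 2 * (1 / (1 - cos s)) - 1" using pos by (simp add: field_simps)
    finally show ?thesis unfolding c_def power_mult_distrib by simp
  qed
  ultimately show ?thesis by simp
qed

lemma measurable_tangent_len [measurable]:
  "(\<lambda>z. tangent_len (fst z) (snd z)) \<in> borel_measurable (borel \<Otimes>\<^sub>M borel)"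
proof -
  have [measurable]: "(sin :: real \<Rightarrow> real) \<in> borel_measurable borel" "(cos :: real \<Rightarrow> real) \<in> borel_measurable borel"
    by (intro borel_measurable_continuous_onI continuous_intros)+
  show ?thesis unfolding tangent_len_def by measurable
qed

text \<open>Tonelli's theorem twice: the integral in t is done first and gives half the square of
  the tangent length, then the one in x, and the weight in s comes last.\<close>

lemma nn_integral_moment_coords:
  assumes m: "1 \<le> m"
  shows "(\<integral>\<^sup>+ x. (\<integral>\<^sup>+ t. ennreal t * (\<integral>\<^sup>+ s. ennreal (dmoment m s) * indicator {0<..<pi} s *
        indicator {0<..} (tangent_len x s - t) \<partial>lborel) * indicator {0<..} t \<partial>lborel) * indicator {0..<2 * pi} x \<partial>lborel)
    = ennreal (pi * (w / 2)\<^sup>2 * (2 * M_coeff m - pi ^ m)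
        + integral {0<..<pi} (\<lambda>s. dmoment m s * defect_energy centered p' s) / 2)" (is "?L = _")
proof -
  have [measurable]: "dmoment m \<in> borel_measurable borel"
    using continuous_dmoment[OF continuous_on_id] by (intro borel_measurable_continuous_onI) simp
  let ?i = "\<lambda>s. ennreal (dmoment m s) * indicator {0<..<pi} s"
  define H where "H s = pi * (w / 2)\<^sup>2 * (2 * (1 / (1 - cos s)) - 1) + defect_energy centered p' s / 2" for s
  have inner: "(\<integral>\<^sup>+ t. ennreal t * (\<integral>\<^sup>+ s. ?i s * indicator {0<..} (tangent_len x s - t) \<partial>lborel)
      * indicator {0<..} t \<partial>lborel) = (\<integral>\<^sup>+ s. ?i s * ennreal ((tangent_len x s)\<^sup>2 / 2) \<partial>lborel)" for x
  proof -
    have [measurable]: "(\<lambda>s. tangent_len x s) \<in> borel_measurable borel"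
      using measurable_compose[OF _ measurable_tangent_len, of "\<lambda>s. (x, s)" borel] by simp
    have "(\<integral>\<^sup>+ t. ennreal t * (\<integral>\<^sup>+ s. ?i s * indicator {0<..} (tangent_len x s - t) \<partial>lborel) * indicator {0<..} t \<partial>lborel)
       = (\<integral>\<^sup>+ t. (\<integral>\<^sup>+ s. ennreal t * (?i s * indicator {0<..} (tangent_len x s - t)) * indicator {0<..} t \<partial>lborel) \<partial>lborel)"
      by (intro nn_integral_cong) (simp add: nn_integral_cmult nn_integral_multc)
    also have "\<dots> = (\<integral>\<^sup>+ s. (\<integral>\<^sup>+ t. ennreal t * (?i s * indicator {0<..} (tangent_len x s - t)) * indicator {0<..} t \<partial>lborel) \<partial>lborel)"
      by (rule lborel_pair.Fubini'[symmetric]) measurable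
    also have "\<dots> = (\<integral>\<^sup>+ s. ?i s * ennreal ((tangent_len x s)\<^sup>2 / 2) \<partial>lborel)"
    proof (rule nn_integral_cong)
      fix s
      show "(\<integral>\<^sup>+ t. ennreal t * (?i s * indicator {0<..} (tangent_len x s - t)) * indicator {0<..} t \<partial>lborel)
          = ?i s * ennreal ((tangent_len x s)\<^sup>2 / 2)"
      proof (cases "s \<in> {0<..<pi}")
        case True
        have "(\<integral>\<^sup>+ t. ennreal t * (?i s * indicator {0<..} (tangent_len x s - t)) * indicator {0<..} t \<partial>lborel)
           = (\<integral>\<^sup>+ t. ?i s * (ennreal t * indicator {0<..<tangent_len x s} t) \<partial>lborel)"
          by (intro nn_integral_cong) (auto simp: indicator_def mult_ac)
        also have "\<dots> = ?i s * (\<integral>\<^sup>+ t. ennreal t * indicator {0<..<tangent_len x s} t \<partial>lborel)"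
          by (rule nn_integral_cmult) measurable
        finally show ?thesis using nn_integral_linear[OF tangent_len_nonneg[of s x]] True by simp
      qed simp
    qed
    finally show ?thesis .
  qed
  have "?L = (\<integral>\<^sup>+ x. (\<integral>\<^sup>+ s. ?i s * ennreal ((tangent_len x s)\<^sup>2 / 2) * indicator {0..<2 * pi} x \<partial>lborel) \<partial>lborel)"
    unfolding inner
    by (intro nn_integral_cong) (auto simp: indicator_def)
  also have "\<dots> = (\<integral>\<^sup>+ s. (\<integral>\<^sup>+ x. ?i s * ennreal ((tangent_len x s)\<^sup>2 / 2) * indicator {0..<2 * pi} x \<partial>lborel) \<partial>lborel)"
  proof (rule lborel_pair.Fubini'[symmetric])
    have [measurable]: "(\<lambda>z. tangent_len (fst z) (snd z)) \<in> borel_measurable (lborel \<Otimes>\<^sub>M lborel)"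
      using measurable_tangent_len by (simp cong: measurable_cong_sets)
    show "(\<lambda>(x, s). ?i s * ennreal ((tangent_len x s)\<^sup>2 / 2) * indicator {0..<2 * pi} x) \<in> borel_measurable (lborel \<Otimes>\<^sub>M lborel)"
      unfolding case_prod_unfold by measurable
  qed
  also have "\<dots> = (\<integral>\<^sup>+ s. ennreal (dmoment m s * H s) * indicator {0<..<pi} s \<partial>lborel)"
  proof (rule nn_integral_cong)
    fix s
    show "(\<integral>\<^sup>+ x. ?i s * ennreal ((tangent_len x s)\<^sup>2 / 2) * indicator {0..<2 * pi} x \<partial>lborel)
        = ennreal (dmoment m s * H s) * indicator {0<..<pi} s"
    proof (cases "s \<in> {0<..<pi}")
      case True
      then have s: "0 < s" "s < pi" by auto
      have [measurable]: "(\<lambda>x. tangent_len x s) \<in> borel_measurable borel"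
        by (intro borel_measurable_continuous_onI continuous_tangent_len s)
      have "(\<integral>\<^sup>+ x. ?i s * ennreal ((tangent_len x s)\<^sup>2 / 2) * indicator {0..<2 * pi} x \<partial>lborel)
          = ?i s * (\<integral>\<^sup>+ x. ennreal ((tangent_len x s)\<^sup>2 / 2) * indicator {0..<2 * pi} x \<partial>lborel)"
        by (subst nn_integral_cmult[symmetric]) (measurable, intro nn_integral_cong mult.assoc)
      also have "\<dots> = ?i s * ennreal (H s)"
        unfolding H_def integral_tangent_len_square[OF s, symmetric]
        by (subst nn_integral_period) (auto intro!: continuous_intros continuous_tangent_len s)
      finally show ?thesis using True dmoment_nonneg[of s m] by (simp add: ennreal_mult')
    qed simp
  qed
  also have "\<dots> = ennreal (pi * (w / 2)\<^sup>2 * (2 * M_coeff m - pi ^ m)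
        + integral {0<..<pi} (\<lambda>s. dmoment m s * defect_energy centered p' s) / 2)"
  proof (rule nn_integral_has_integral_lebesgue')
    have E: "((\<lambda>s. dmoment m s * defect_energy centered p' s) has_integral
        integral {0<..<pi} (\<lambda>s. dmoment m s * defect_energy centered p' s)) {0<..<pi}"
      by (intro integrable_integral set_lebesgue_integral_eq_integral(1)
          absolutely_integrable_dmoment_energy antiperiodic_centered)
    have "((\<lambda>s. pi * (w / 2)\<^sup>2 * (2 * (dmoment m s / (1 - cos s)) - dmoment m s) + dmoment m s * defect_energy centered p' s / 2) has_integral
       pi * (w / 2)\<^sup>2 * (2 * M_coeff m - pi ^ m)
        + integral {0<..<pi} (\<lambda>s. dmoment m s * defect_energy centered p' s) / 2) {0<..<pi}"
      by (rule has_integral_add[OF has_integral_mult_right[OF has_integral_diff[OF has_integral_mult_right[OF M_coeff_has_integral] has_integral_dmoment_pi[OF m]]]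
          has_integral_divide[OF E]])
    then show "((\<lambda>s. dmoment m s * H s) has_integral pi * (w / 2)\<^sup>2 * (2 * M_coeff m - pi ^ m)
        + integral {0<..<pi} (\<lambda>s. dmoment m s * defect_energy centered p' s) / 2) {0<..<pi}"
      by (rule has_integral_eq[rotated]) (simp add: H_def algebra_simps)
    fix s assume "s \<in> {0<..<pi}"
    then have s: "0 < s" "s < pi" by auto
    have "0 \<le> H s"
      unfolding H_def integral_tangent_len_square[OF s, symmetric]
      by (intro integral_nonneg integrable_continuous_real continuous_intros continuous_tangent_len s) auto
    then show "0 \<le> dmoment m s * H s" using dmoment_nonneg[of s m] s by simp
  qed
  finally show ?thesis .
qed

text \<open>The integrand at P is the integral of \<open>dmoment m\<close> over the levels s below
  the visual angle. With those levels expressed by \<open>tangent_len\<close>, this becomes the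
  integral in tangent coordinates.\<close>

theorem visual_angle_integral:
  assumes m: "1 \<le> m"
  defines "f \<equiv> \<lambda>P. visual_angle K P ^ m - sin (visual_angle K P) ^ m"
  shows "f absolutely_integrable_on - K"
    and "integral (- K) f = pi * (w / 2)\<^sup>2 * (2 * M_coeff m - pi ^ m)
        + integral {0<..<pi} (\<lambda>s. dmoment m s * defect_energy centered p' s) / 2"
proof -
  let ?b = "pi * (w / 2)\<^sup>2 * (2 * M_coeff m - pi ^ m)
        + integral {0<..<pi} (\<lambda>s. dmoment m s * defect_energy centered p' s) / 2"
  have [measurable]: "dmoment m \<in> borel_measurable borel"
    using continuous_dmoment[OF continuous_on_id] by (intro borel_measurable_continuous_onI) simp
  \<comment> \<open>The level condition is written as t < \<open>tangent_len x s\<close>, whose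
    joint measurability is evident from the formula.\<close>
  define Q where "Q x t = (\<integral>\<^sup>+ s. ennreal (dmoment m s) * indicator {0<..<pi} s *
        indicator {0<..} (tangent_len x s - t) \<partial>lborel)" for x t
  have Q: "Q x t = ennreal (f (contact x + t *\<^sub>R tangent_dir x))" 
    and f0: "0 \<le> f (contact x + t *\<^sub>R tangent_dir x)" if t: "0 < t" for x t
  proof -
    define v where "v = visual_angle K (contact x + t *\<^sub>R tangent_dir x)"
    have v: "0 < v" "v < pi" and lev: "\<And>s. 0 < s \<Longrightarrow> s < pi \<Longrightarrow> s < v \<longleftrightarrow> t < tangent_len x s"
      unfolding v_def using visual_angle_level[OF t, where x = x] by auto
    have "Q x t = (\<integral>\<^sup>+ s. ennreal (dmoment m s) * indicator {0<..<v} s \<partial>lborel)"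
      unfolding Q_def
    proof (intro nn_integral_cong)
      fix s
      show "ennreal (dmoment m s) * indicator {0<..<pi} s * indicator {0<..} (tangent_len x s - t)
          = ennreal (dmoment m s) * indicator {0<..<v} s"
        using lev[of s] v by (cases "0 < s \<and> s < pi") (auto simp: indicator_def)
    qed
    also have "\<dots> = ennreal (v ^ m - sin v ^ m)"
      by (rule nn_integral_has_integral_lebesgue'[OF _ has_integral_dmoment_open[OF m]])
         (use v in \<open>auto intro!: dmoment_nonneg\<close>)
    finally show "Q x t = ennreal (f (contact x + t *\<^sub>R tangent_dir x))" by (simp add: f_def v_def)
    show "0 \<le> f (contact x + t *\<^sub>R tangent_dir x)"
      using v by (simp add: f_def v_def[symmetric] power_mono sin_x_le_x sin_ge_zero)
  qed
  \<comment> \<open>The values at t \<le> 0 have no geometric meaning; the coordinate domain has t >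
    0.\<close>
  define G where "G x t = enn2real (Q x t)" for x t
  have agree: "f (contact x + t *\<^sub>R tangent_dir x) = G x t" if "0 < t" for x t
    using Q[OF that] f0[OF that] by (simp add: G_def)
  have Gm: "(\<lambda>z. G (fst z) (snd z)) \<in> borel_measurable (borel \<Otimes>\<^sub>M borel)"
  proof -
    have "(\<lambda>y. (\<lambda>z. tangent_len (fst z) (snd z)) (fst (fst y), snd y)) \<in> borel_measurable ((borel \<Otimes>\<^sub>M borel) \<Otimes>\<^sub>M lborel)"
      by measurable
    then have [measurable]: "(\<lambda>y. tangent_len (fst (fst y)) (snd y)) \<in> borel_measurable ((borel \<Otimes>\<^sub>M borel) \<Otimes>\<^sub>M lborel)"
      by simp
    have "(\<lambda>z. \<integral>\<^sup>+ s. ennreal (dmoment m s) * indicator {0<..<pi} s *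
        indicator {0<..} (tangent_len (fst z) s - snd z) \<partial>lborel) \<in> borel_measurable (borel \<Otimes>\<^sub>M borel)"
      by (rule lborel.borel_measurable_nn_integral) (unfold case_prod_unfold, measurable)
    then show ?thesis unfolding G_def Q_def by measurable
  qed
  have "(\<integral>\<^sup>+ x. (\<integral>\<^sup>+ t. ennreal t * ennreal (G x t) * indicator {0<..} t \<partial>lborel) * indicator {0..<2 * pi} x \<partial>lborel)
      = (\<integral>\<^sup>+ x. (\<integral>\<^sup>+ t. ennreal t * Q x t * indicator {0<..} t \<partial>lborel) * indicator {0..<2 * pi} x \<partial>lborel)"
  proof -
    have "ennreal t * ennreal (G x t) * indicator {0<..} t = ennreal t * Q x t * indicator {0<..} t" for x t
      using Q[of t x] f0[of t x] by (cases "t > 0") (auto simp: G_def)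
    then show ?thesis by simp
  qed
  also have "\<dots> = ennreal ?b"
    unfolding Q_def by (rule nn_integral_moment_coords[OF m])
  finally have int: "(\<integral>\<^sup>+ x. (\<integral>\<^sup>+ t. ennreal t * ennreal (G x t) * indicator {0<..} t \<partial>lborel)
      * indicator {0..<2 * pi} x \<partial>lborel) = ennreal ?b" .
  have "0 \<le> integral {0<..<pi} (\<lambda>s. dmoment m s * defect_energy centered p' s)"
  proof -
    obtain B where B: "\<And>x. norm (p' x) \<le> B" using antiperiodic_C1_bounded[OF antiperiodic_centered] by metis
    show ?thesis
      by (intro integral_nonneg set_lebesgue_integral_eq_integral(1)
          absolutely_integrable_dmoment_energy antiperiodic_centered)
         (auto intro!: mult_nonneg_nonneg dmoment_nonneg defect_energy_bounds(1)[OF antiperiodic_centered B])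
  qed
  then have b: "0 \<le> ?b" using M_coeff_ge[OF m] by simp
  show "f absolutely_integrable_on - K"
    by (rule integral_outside(1)[OF Gm _ agree int b]) (simp add: G_def)
  show "integral (- K) f = ?b"
    by (rule integral_outside(2)[OF Gm _ agree int b]) (simp add: G_def)
qed

text \<open>A vanishing defect at \<open>s = \<pi>/2\<close> says \<open>u' x = u (x + \<pi>/2)\<close>, and so \<open>u'' = - u\<close>.\<close>

lemma circle_of_zero_energy:
  assumes m: "1 \<le> m" and E: "integral {0<..<pi} (\<lambda>s. dmoment m s * defect_energy centered p' s) = 0"
  shows "\<exists>c r. r > 0 \<and> frontier K = sphere c r"
proof -
  let ?e = "\<lambda>s. dmoment m s * defect_energy centered p' s"
  obtain B where B: "\<And>x. norm (p' x) \<le> B" using antiperiodic_C1_bounded[OF antiperiodic_centered] by metis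
  have e0: "0 \<le> ?e s" if "s \<in> {0<..<pi}" for s
    using that by (auto intro!: mult_nonneg_nonneg dmoment_nonneg defect_energy_bounds(1)[OF antiperiodic_centered B])
  \<comment> \<open>A compact interval around pi/2 inside the open one, so that the vanishing
    integral of a nonnegative continuous function forces pointwise zeros.\<close>
  have sub: "{pi/4..3*pi/4} \<subseteq> {0<..<pi}"
  proof
    fix s assume "s \<in> {pi/4..3*pi/4}"
    then have "pi / 4 \<le> s" "s \<le> 3 * pi / 4" by auto
    then have "0 < s" "s < pi" using pi_gt_zero by linarith+
    then show "s \<in> {0<..<pi}" by simp
  qed
  have ce: "continuous_on {pi/4..3*pi/4} ?e"
    by (intro continuous_intros continuous_on_subset[OF continuous_defect_energy[OF antiperiodic_centered] sub])
  have "integral {pi/4..3*pi/4} ?e \<le> integral {0<..<pi} ?e"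
    by (rule integral_subset_le[OF sub integrable_continuous_real[OF ce]])
       (use e0 absolutely_integrable_dmoment_energy[OF antiperiodic_centered] in
         \<open>auto intro: set_lebesgue_integral_eq_integral(1)\<close>)
  moreover have "0 \<le> integral {pi/4..3*pi/4} ?e"
    by (rule integral_nonneg[OF integrable_continuous_real[OF ce]]) (use e0 sub in blast)
  ultimately have "integral {pi/4..3*pi/4} ?e = 0" using E by simp
  then have "\<forall>s\<in>{pi/4..3*pi/4}. ?e s = 0"
    using integral_eq_0_iff[OF ce] e0 sub pi_gt_zero by (simp add: subset_iff)
  then have "?e (pi / 2) = 0" by (auto simp: field_simps)
  moreover have "dmoment m (pi / 2) > 0" using m pi_gt_zero by (intro dmoment_pos) auto
  ultimately have V: "defect_energy centered p' (pi / 2) = 0" by simp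
  have ct: "continuous_on A (tangent_defect centered p' (pi / 2))" for A
    using continuous_tangent_defect2[OF antiperiodic_centered, of "pi / 2"] pi_gt_zero
    by (auto intro: continuous_on_subset)
  have t0: "tangent_defect centered p' (pi / 2) x = 0" if "x \<in> {0..2 * pi}" for x
  proof -
    have "continuous_on {0..2 * pi} (\<lambda>x. (norm (tangent_defect centered p' (pi / 2) x))\<^sup>2)"
      by (intro continuous_intros ct)
    from integral_eq_0_iff[OF this] V that show ?thesis by (simp add: defect_energy_def)
  qed
  have cen: "centered (y + pi) = - centered y" for y
    using antiperiodic_centered by (simp add: antiperiodic_C1_def)
  have per: "tangent_defect centered p' (pi / 2) (x + 2 * pi) = tangent_defect centered p' (pi / 2) x" for x
  proof -
    have "centered (y + 2 * pi) = centered y" for y using cen[of y] cen[of "y + pi"] by (simp add: add.assoc)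
    from this[of "x - pi / 2"] this[of x] p'_periodic[of x] show ?thesis
      by (simp add: tangent_defect_def algebra_simps)
  qed
  have p'_eq: "p' x = centered (x + pi / 2)" for x
  proof -
    obtain y where "0 \<le> y" "y < 2 * pi" "tangent_defect centered p' (pi / 2) x = tangent_defect centered p' (pi / 2) y"
      using periodic_reduce[of "tangent_defect centered p' (pi / 2)", OF per] by auto
    then have "tangent_defect centered p' (pi / 2) x = 0" using t0[of y] by simp
    then have "p' x = - centered (x - pi / 2)" by (simp add: tangent_defect_def)
    also have "\<dots> = centered (x + pi / 2)" using cen[of "x - pi / 2"] by (simp add: algebra_simps)
    finally show ?thesis .
  qed
  have p''_eq: "p'' x = - centered x" for x
  proof -
    have "((\<lambda>x. centered (x + pi / 2)) has_real_derivative p' (x + pi / 2)) (at x)"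
      unfolding centered_def using dp_at[of "pi / 2" x] by (auto intro!: derivative_eq_intros simp: add.commute)
    moreover have "(\<lambda>x. centered (x + pi / 2)) = p'" using p'_eq by auto
    ultimately have "p'' x = p' (x + pi / 2)" using DERIV_unique[OF dp'[of x]] by simp
    also have "\<dots> = - centered x" using p'_eq[of "x + pi / 2"] cen[of x] by (simp add: algebra_simps)
    finally show ?thesis .
  qed
  \<comment> \<open>The candidate for the centre: its derivative is p + p'' - w/2 = 0 times the
    tangent vector.\<close>
  have "((\<lambda>x. contact x - (w / 2) *\<^sub>R normal_dir x) has_vector_derivative
      (p x + p'' x) *\<^sub>R tangent_dir x - (w / 2) *\<^sub>R tangent_dir x) (at x)" for x
    by (auto intro!: derivative_eq_intros contact_deriv has_vector_derivative_dirs)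
  moreover have "(p x + p'' x) *\<^sub>R tangent_dir x - (w / 2) *\<^sub>R tangent_dir x = 0" for x
    by (simp add: p''_eq centered_def)
  ultimately have "((\<lambda>x. contact x - (w / 2) *\<^sub>R normal_dir x) has_vector_derivative 0) (at x)" for x
    by simp
  then obtain c where c: "\<And>x. contact x - (w / 2) *\<^sub>R normal_dir x = c"
    using has_derivative_zero_constant[of UNIV "\<lambda>x. contact x - (w / 2) *\<^sub>R normal_dir x"]
    by (auto simp: has_vector_derivative_def)
  have con: "contact x = c + (w / 2) *\<^sub>R normal_dir x" for x using c[of x] by (simp add: algebra_simps)
  have "range contact = sphere c (w / 2)"
  proof (intro equalityI subsetI)
    fix P assume "P \<in> range contact"
    then show "P \<in> sphere c (w / 2)" using w_pos by (auto simp: con dist_norm)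
  next
    fix P assume "P \<in> sphere c (w / 2)"
    then have "norm (P - c) = w / 2" by (simp add: dist_norm norm_minus_commute)
    then have "norm ((P - c) /\<^sub>R (w / 2)) = 1" using w_pos by simp
    then obtain x where x: "(P - c) /\<^sub>R (w / 2) = normal_dir x" using unit_vec2_normal_dir by metis
    have "P = c + (w / 2) *\<^sub>R normal_dir x" unfolding x[symmetric] using w_pos by simp
    then show "P \<in> range contact" using con by auto
  qed
  then show ?thesis using frontier_K w_pos by (intro exI[of _ c] exI[of _ "w / 2"]) simp
qed

end

text \<open>Integrability is asserted along with the inequalities because \<open>LINT\<close> of a
  non-integrable function is 0 by convention.\<close>

theorem theorem7p2:
  fixes K :: "(real^2) set" and \<gamma> :: "real \<Rightarrow> real^2" and F L \<Delta> :: real and m :: nat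
  assumes "compact K" and "convex K" and "constant_width K"
    and "C2_boundary_param K \<gamma>"
    and "C2_fun (support_fun K)"
    and F: "F = measure lebesgue K"
    and L: "L = closed_curve_length \<gamma>"
    and \<Delta>: "\<Delta> = L\<^sup>2 - 4 * pi * F"
    and "m \<ge> 1"
  shows "let f = (\<lambda>P. visual_angle K P ^ m - sin (visual_angle K P) ^ m);
             I = (LINT P:- K|lebesgue. f P);
             R = - (pi ^ m * F) + M_coeff m * (L\<^sup>2 / (2 * pi))
                 - pi ^ (m - 1) / 4 * (1 - (3/4) ^ m) * \<Delta>
         in set_integrable lebesgue (- K) f \<and> I \<ge> R \<and> R \<ge> 0 \<and>
            (I = R \<longrightarrow> (\<exists>c r. r > 0 \<and> frontier K = sphere c r))"
proof -
  obtain p' p'' where dp: "\<And>x. (support_fun K has_real_derivative p' x) (at x)"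
      and dp': "\<And>x. (p' has_real_derivative p'' x) (at x)"
    using \<open>C2_fun (support_fun K)\<close> unfolding C2_fun_def has_real_derivative_iff_has_vector_derivative by blast
  obtain w where w: "\<And>x. support_fun K x + support_fun K (x + pi) = w"
    using \<open>constant_width K\<close> unfolding constant_width_def by blast
  have frontier_sub: "frontier K \<subseteq> K"
    using compact_imp_closed[OF \<open>compact K\<close>] by (rule frontier_subset_closed)
  have range: "range \<gamma> = frontier K" and inj: "inj_on \<gamma> {0..<1}"
    using \<open>C2_boundary_param K \<gamma>\<close> unfolding C2_boundary_param_def by auto
  have \<gamma>K: "\<gamma> t \<in> K" for t using range frontier_sub by auto
  \<comment> \<open>Two distinct boundary points exist by injectivity of the parametrization; the
    width in the direction of their difference is at least their distance.\<close>
  have "w > 0"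
  proof -
    define v where "v = \<gamma> 0 - \<gamma> (1/2)"
    have "v \<noteq> 0" using inj_onD[OF inj, of 0 "1/2"] by (auto simp: v_def)
    then have "norm (v /\<^sub>R norm v) = 1" by simp
    then obtain y where y: "v /\<^sub>R norm v = normal_dir y" using unit_vec2_normal_dir by metis
    have "0 < norm v" using \<open>v \<noteq> 0\<close> by simp
    also have "norm v = v \<bullet> normal_dir y"
      unfolding y[symmetric] using \<open>v \<noteq> 0\<close> by (simp add: dot_square_norm power2_eq_square)
    also have "\<dots> = \<gamma> 0 \<bullet> normal_dir y + \<gamma> (1/2) \<bullet> normal_dir (y + pi)"
      by (simp add: v_def inner_diff_left normal_dir_shift)
    also have "\<dots> \<le> support_fun K y + support_fun K (y + pi)"
      by (intro add_mono inner_le_support_fun \<open>compact K\<close> \<gamma>K)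
    finally show ?thesis by (simp add: w)
  qed
  interpret smooth_support_body K "support_fun K" p' w p''
    by unfold_locales (use assms(1,2) \<gamma>K dp dp' w \<open>w > 0\<close> in auto)
  define f where "f = (\<lambda>P. visual_angle K P ^ m - sin (visual_angle K P) ^ m)"
  define E where "E = integral {0<..<pi} (\<lambda>s. dmoment m s * defect_energy centered p' s)"
  define D where "D = wirtinger_form centered p'"
  define a where "a = w / 2"
  define R where "R = - (pi ^ m * F) + M_coeff m * (L\<^sup>2 / (2 * pi)) - pi ^ (m - 1) / 4 * (1 - (3/4) ^ m) * \<Delta>"
  have fi: "set_integrable lebesgue (- K) f"
    unfolding f_def by (rule visual_angle_integral(1)[OF \<open>m \<ge> 1\<close>])
  have I: "(LINT P:- K|lebesgue. f P) = pi * a\<^sup>2 * (2 * M_coeff m - pi ^ m) + E / 2"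
    using set_lebesgue_integral_eq_integral(2)[OF fi] visual_angle_integral(2)[OF \<open>m \<ge> 1\<close>]
    by (simp add: f_def E_def a_def)
  have D0: "0 \<le> D" and ED: "(pi - 1/2) ^ m * D \<le> E"
    unfolding D_def E_def using energy_ge_wirtinger_form[OF antiperiodic_centered \<open>m \<ge> 1\<close>] by auto
  have La: "L = 2 * pi * a" using closed_curve_length_eq[OF \<open>C2_boundary_param K \<gamma>\<close>] by (simp add: L a_def)
  have Fa: "F = pi * a\<^sup>2 - D / 2" unfolding F D_def a_def by (rule area_eq)
  have Da: "\<Delta> = 2 * pi * D" unfolding \<Delta> La Fa by (simp add: power2_eq_square algebra_simps)
  \<comment> \<open>The term pi^m D/2 coming from the area cancels against the one in the deficit
    term.\<close>
  have R: "R = pi * a\<^sup>2 * (2 * M_coeff m - pi ^ m) + (3 * pi / 4) ^ m * D / 2"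
  proof -
    have "pi ^ m = pi * pi ^ (m - 1)" using \<open>m \<ge> 1\<close> by (cases m) auto
    then have "pi ^ (m - 1) / 4 * (1 - (3/4) ^ m) * \<Delta> = pi ^ m * D / 2 - (3 * pi / 4) ^ m * D / 2"
      unfolding Da by (simp add: power_mult_distrib power_divide algebra_simps)
    moreover have "M_coeff m * (L\<^sup>2 / (2 * pi)) = pi * a\<^sup>2 * (2 * M_coeff m)"
      unfolding La by (simp add: power2_eq_square)
    ultimately show ?thesis unfolding R_def Fa by (simp add: algebra_simps)
  qed
  \<comment> \<open>The base inequality is equivalent to pi > 2. Its strictness is what yields D = 0
    in the equality case.\<close>
  have lt: "(3 * pi / 4) ^ m < (pi - 1/2) ^ m"
    using pi_gt3 \<open>m \<ge> 1\<close> by (intro power_strict_mono) auto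
  have gap: "((pi - 1/2) ^ m - (3 * pi / 4) ^ m) * D \<le> E - (3 * pi / 4) ^ m * D"
    using ED by (simp add: left_diff_distrib)
  have "0 \<le> ((pi - 1/2) ^ m - (3 * pi / 4) ^ m) * D" using lt D0 by simp
  then have "R \<le> (LINT P:- K|lebesgue. f P)" unfolding I R using gap by linarith
  moreover have "0 \<le> R" unfolding R using M_coeff_ge[OF \<open>m \<ge> 1\<close>] D0 by simp
  moreover have "\<exists>c r. r > 0 \<and> frontier K = sphere c r" if "(LINT P:- K|lebesgue. f P) = R"
  proof -
    have E3: "E = (3 * pi / 4) ^ m * D" using that unfolding I R by simp
    then have "((pi - 1/2) ^ m - (3 * pi / 4) ^ m) * D \<le> 0" using gap by simp
    then have "D = 0" using lt D0 by (auto simp: mult_le_0_iff)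
    then have "E = 0" using E3 by simp
    then show ?thesis unfolding E_def by (rule circle_of_zero_energy[OF \<open>m \<ge> 1\<close>])
  qed
  ultimately show ?thesis using fi unfolding Let_def R_def f_def by blast
qed

end
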